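(* Let $L$ be a tabular quasi-normal modal logic that has the Craig interpolation property. Then one can associate to each signature $\sigma$ a finite set $\widehat\sigma$ of propositional variables and polynomial-time computable maps $\mathit{tr}_L:\mathrm{ML}(\sigma)\to\mathrm{PL}(\widehat\sigma)$ and $\mathit{rt}_L:\mathrm{PL}(\widehat\sigma)\to\mathrm{ML}(\sigma)$ (for fixed $L$) such that: whenever $\varphi\to\psi\in L$ for modal formulas $\varphi,\psi$ and $\chi$ is a propositional Craig interpolant for $\mathit{tr}_L(\varphi)\to\mathit{tr}_L(\psi)$, then $\mathit{rt}_L(\chi)$ is a Craig interpolant for $\varphi\to\psi$ in $L$. (These maps can be taken to be the same ones that, for every modal $\varphi$ and signature $\tau$, send every propositional uniform $\widehat\tau$-interpolant of $\mathit{tr}_L(\varphi)$ to a strongest $L(\tau)$-implicate of $\varphi$.)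
   Context: Signatures are finite sets of atoms. PL: propositional formulas with $\top,\neg,\wedge$; ML: additionally $\Box$. $\mathrm{sig}(\varphi)$ = atoms of $\varphi$. $\mathrm{Log}(\mathcal F)$ for a class $\mathcal F$ of pointed Kripke frames is the set of modal formulas valid at the distinguished world of each member under all valuations. A quasi-normal modal logic is a set of modal formulas containing all formulas valid in all pointed frames and closed under modus ponens and uniform substitution; it is tabular if it equals $\mathrm{Log}(\mathcal F)$ for a finite set of finite pointed frames. A Craig interpolant for $\varphi\to\psi\in L$ in $L$ is a modal $\chi$ with $\varphi\to\chi\in L$, $\chi\to\psi\in L$ and $\mathrm{sig}(\chi)\subseteq\mathrm{sig}(\varphi)\cap\mathrm{sig}(\psi)$; $L$ has the Craig interpolation property if every $\varphi\to\psi\in L$ has one. A propositional Craig interpolant for a tautology $\alpha\to\beta$ is a propositional $\chi$ with $\alpha\to\chi$, $\chi\to\beta$ tautologies and $\mathrm{sig}(\chi)\subseteq\mathrm{sig}(\alpha)\cap\mathrm{sig}(\beta)$. Strongest $L(\sigma)$-implicate of $\varphi$: modal $\chi$, $\mathrm{sig}(\chi)\subseteq\sigma$, $\varphi\to\chi\in L$, and $\chi\to\psi\in L$ whenever $\mathrm{sig}(\psi)\subseteq\sigma$ and $\varphi\to\psi\in L$. Propositional uniform $S$-interpolant of $\xi$: propositional $\chi$, $\mathrm{sig}(\chi)\subseteq S$, $\xi\to\chi$ tautology, $\chi\to\psi$ tautology whenever $\mathrm{sig}(\psi)\cap\mathrm{sig}(\xi)\subseteq S$ and $\xi\to\psi$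 tautology. *)

theory Defs
  imports Main "HOL-Computational_Algebra.Polynomial"
begin

section \<open>Syntax\<close>

text \<open>The set functions \<open>pl_sig\<close> and \<open>ml_sig\<close> generated by the datatype package return the atoms
  occurring in a formula, i.e. its signature.\<close>

datatype (pl_sig: 'a) pl =
    PTop
  | PVar 'a
  | PNeg "'a pl"
  | PAnd "'a pl" "'a pl"

datatype (ml_sig: 'a) ml =
    MTop
  | MVar 'a
  | MNeg "'a ml"
  | MAnd "'a ml" "'a ml"
  | MBox "'a ml"

definition PImp :: "'a pl \<Rightarrow> 'a pl \<Rightarrow> 'a pl" where
  "PImp \<alpha> \<beta> = PNeg (PAnd \<alpha> (PNeg \<beta>))"

definition MImp :: "'a ml \<Rightarrow> 'a ml \<Rightarrow> 'a ml" where
  "MImp \<phi> \<psi> = MNeg (MAnd \<phi> (MNeg \<psi>))"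

primrec ml_subst :: "('a \<Rightarrow> 'a ml) \<Rightarrow> 'a ml \<Rightarrow> 'a ml" where
  "ml_subst s MTop = MTop"
| "ml_subst s (MVar p) = s p"
| "ml_subst s (MNeg \<phi>) = MNeg (ml_subst s \<phi>)"
| "ml_subst s (MAnd \<phi> \<psi>) = MAnd (ml_subst s \<phi>) (ml_subst s \<psi>)"
| "ml_subst s (MBox \<phi>) = MBox (ml_subst s \<phi>)"


section \<open>Propositional logic\<close>

primrec pl_sat :: "('a \<Rightarrow> bool) \<Rightarrow> 'a pl \<Rightarrow> bool" where
  "pl_sat v PTop \<longleftrightarrow> True"
| "pl_sat v (PVar p) \<longleftrightarrow> v p"
| "pl_sat v (PNeg \<alpha>) \<longleftrightarrow> \<not> pl_sat v \<alpha>"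
| "pl_sat v (PAnd \<alpha> \<beta>) \<longleftrightarrow> pl_sat v \<alpha> \<and> pl_sat v \<beta>"

definition tautology :: "'a pl \<Rightarrow> bool" where
  "tautology \<alpha> \<longleftrightarrow> (\<forall>v. pl_sat v \<alpha>)"

definition pl_craig_interpolant :: "'a pl \<Rightarrow> 'a pl \<Rightarrow> 'a pl \<Rightarrow> bool" where
  "pl_craig_interpolant \<alpha> \<beta> \<chi> \<longleftrightarrow>
     tautology (PImp \<alpha> \<chi>) \<and> tautology (PImp \<chi> \<beta>) \<and> pl_sig \<chi> \<subseteq> pl_sig \<alpha> \<inter> pl_sig \<beta>"

definition pl_uniform_interpolant :: "'a set \<Rightarrow> 'a pl \<Rightarrow> 'a pl \<Rightarrow> bool" where
  "pl_uniform_interpolant S \<xi> \<chi> \<longleftrightarrow>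
     pl_sig \<chi> \<subseteq> S \<and> tautology (PImp \<xi> \<chi>) \<and>
     (\<forall>\<psi>. pl_sig \<psi> \<inter> pl_sig \<xi> \<subseteq> S \<and> tautology (PImp \<xi> \<psi>) \<longrightarrow> tautology (PImp \<chi> \<psi>))"


section \<open>Modal logics\<close>

text \<open>A pointed frame is a triple of a set of worlds, an accessibility relation and a distinguished
  world. The point need not generate the frame.\<close>

type_synonym 'w pframe = "'w set \<times> ('w \<times> 'w) set \<times> 'w"

definition pointed_frame :: "'w pframe \<Rightarrow> bool" where
  "pointed_frame = (\<lambda>(W, R, r). R \<subseteq> W \<times> W \<and> r \<in> W)"

primrec ml_sat :: "('w \<times> 'w) set \<Rightarrow> ('a \<Rightarrow> 'w set) \<Rightarrow> 'w \<Rightarrow> 'a ml \<Rightarrow> bool" where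
  "ml_sat R V x MTop \<longleftrightarrow> True"
| "ml_sat R V x (MVar p) \<longleftrightarrow> x \<in> V p"
| "ml_sat R V x (MNeg \<phi>) \<longleftrightarrow> \<not> ml_sat R V x \<phi>"
| "ml_sat R V x (MAnd \<phi> \<psi>) \<longleftrightarrow> ml_sat R V x \<phi> \<and> ml_sat R V x \<psi>"
| "ml_sat R V x (MBox \<phi>) \<longleftrightarrow> (\<forall>y. (x, y) \<in> R \<longrightarrow> ml_sat R V y \<phi>)"

definition Log :: "'w pframe set \<Rightarrow> 'a ml set" where
  "Log \<F> = {\<phi>. \<forall>(W, R, r) \<in> \<F>. \<forall>V. (\<forall>p. V p \<subseteq> W) \<longrightarrow> ml_sat R V r \<phi>}"

text \<open>Worlds are taken from \<open>nat\<close>. This loses nothing: every finite frame is isomorphic to one on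
  \<open>nat\<close>, and by the finite model property (or the downward Loewenheim-Skolem theorem) a modal
  formula valid in all pointed frames over \<open>nat\<close> is valid in all pointed frames.\<close>

definition quasi_normal :: "'a ml set \<Rightarrow> bool" where
  "quasi_normal L \<longleftrightarrow>
     Log {F :: nat pframe. pointed_frame F} \<subseteq> L \<and>
     (\<forall>\<phi> \<psi>. \<phi> \<in> L \<and> MImp \<phi> \<psi> \<in> L \<longrightarrow> \<psi> \<in> L) \<and>
     (\<forall>s \<phi>. \<phi> \<in> L \<longrightarrow> ml_subst s \<phi> \<in> L)"

definition tabular :: "'a ml set \<Rightarrow> bool" where
  "tabular L \<longleftrightarrow>
     (\<exists>\<F> :: nat pframe set. finite \<F> \<and> (\<forall>F \<in> \<F>. pointed_frame F \<and> finite (fst F)) \<and> L = Log \<F>)"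

definition ml_craig_interpolant :: "'a ml set \<Rightarrow> 'a ml \<Rightarrow> 'a ml \<Rightarrow> 'a ml \<Rightarrow> bool" where
  "ml_craig_interpolant L \<phi> \<psi> \<chi> \<longleftrightarrow>
     MImp \<phi> \<chi> \<in> L \<and> MImp \<chi> \<psi> \<in> L \<and> ml_sig \<chi> \<subseteq> ml_sig \<phi> \<inter> ml_sig \<psi>"

definition craig_interpolation_property :: "'a ml set \<Rightarrow> bool" where
  "craig_interpolation_property L \<longleftrightarrow>
     (\<forall>\<phi> \<psi>. MImp \<phi> \<psi> \<in> L \<longrightarrow> (\<exists>\<chi>. ml_craig_interpolant L \<phi> \<psi> \<chi>))"

definition strongest_implicate :: "'a ml set \<Rightarrow> 'a set \<Rightarrow> 'a ml \<Rightarrow> 'a ml \<Rightarrow> bool" where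
  "strongest_implicate L \<sigma> \<phi> \<chi> \<longleftrightarrow>
     ml_sig \<chi> \<subseteq> \<sigma> \<and> MImp \<phi> \<chi> \<in> L \<and>
     (\<forall>\<psi>. ml_sig \<psi> \<subseteq> \<sigma> \<and> MImp \<phi> \<psi> \<in> L \<longrightarrow> MImp \<chi> \<psi> \<in> L)"


section \<open>Polynomial-time computability\<close>

text \<open>Deterministic multi-tape Turing machines. Symbols and states are initial segments of the
  natural numbers, symbol 0 is the blank, state 0 is the start state, and every state
  \<open>\<ge> num_states\<close> is halting. Given the current state and the list of scanned symbols, \<open>transition\<close> returns
  the next state and, for each tape, the symbol to write and the head movement.\<close>

record tm =
  num_tapes :: nat
  num_symbols :: nat
  num_states :: nat
  transition :: "nat \<Rightarrow> nat list \<Rightarrow> nat \<times> (nat \<times> int) list"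

definition tm_wf :: "tm \<Rightarrow> bool" where
  "tm_wf M \<longleftrightarrow>
     1 \<le> num_tapes M \<and> 1 \<le> num_symbols M \<and>
     (\<forall>q < num_states M. \<forall>ss. length ss = num_tapes M \<and> set ss \<subseteq> {..<num_symbols M} \<longrightarrow>
        (case transition M q ss of (q', acts) \<Rightarrow>
           q' \<le> num_states M \<and> length acts = num_tapes M \<and>
           (\<forall>(a, d) \<in> set acts. a < num_symbols M \<and> d \<in> {-1, 0, 1})))"

text \<open>Tapes are two-way infinite and are viewed relative to the head, which is always at cell 0;
  moving the head shifts the tape contents.\<close>

type_synonym tape = "int \<Rightarrow> nat"

definition tape_act :: "nat \<times> int \<Rightarrow> tape \<Rightarrow> tape" where
  "tape_act = (\<lambda>(a, d) T i. (T(0 := a)) (i + d))"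

definition tm_step :: "tm \<Rightarrow> nat \<times> tape list \<Rightarrow> nat \<times> tape list" where
  "tm_step M = (\<lambda>(q, Ts).
     if q < num_states M
     then (case transition M q (map (\<lambda>T. T 0) Ts) of (q', acts) \<Rightarrow> (q', map2 tape_act acts Ts))
     else (q, Ts))"

definition word_tape :: "nat list \<Rightarrow> tape" where
  "word_tape w = (\<lambda>i. if 0 \<le> i \<and> i < int (length w) then w ! nat i else 0)"

definition tm_init :: "tm \<Rightarrow> nat list \<Rightarrow> nat \<times> tape list" where
  "tm_init M w = (0, word_tape w # replicate (num_tapes M - 1) (\<lambda>_. 0))"

text \<open>The output is the word on the first tape that starts at the head and extends to the right up to
  the first blank.\<close>

definition tm_output :: "nat \<times> tape list \<Rightarrow> nat list \<Rightarrow> bool" where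
  "tm_output C w \<longleftrightarrow>
     0 \<notin> set w \<and> (\<forall>i < length w. (hd (snd C)) (int i) = w ! i) \<and> (hd (snd C)) (int (length w)) = 0"

definition polytime :: "('x \<Rightarrow> nat list) \<Rightarrow> ('y \<Rightarrow> nat list) \<Rightarrow> ('x \<Rightarrow> 'y) \<Rightarrow> bool" where
  "polytime enc enc' f \<longleftrightarrow>
     (\<exists>M (b :: nat poly). tm_wf M \<and>
        (\<forall>x. set (enc x) \<subseteq> {1..<num_symbols M} \<and>
           (\<exists>t \<le> poly b (length (enc x)).
              let C = (tm_step M ^^ t) (tm_init M (enc x))
              in num_states M \<le> fst C \<and> tm_output C (enc' (f x)))))"

text \<open>Formulas over the atoms \<open>p\<^sub>0, p\<^sub>1, \<dots>\<close> are written as words over the letters 1 to 7 in prefix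
  (Polish) notation; an atom is the letter 5 followed by its index in binary, least significant bit
  first, with 6 and 7 as the binary digits. Words are non-blank, and the letters 6 and 7 occur only
  inside atoms, so no terminator is needed.\<close>

fun binary :: "nat \<Rightarrow> nat list" where
  "binary n = (if n = 0 then [] else (if even n then 6 else 7) # binary (n div 2))"

declare binary.simps [simp del]

primrec pl_code :: "nat pl \<Rightarrow> nat list" where
  "pl_code PTop = [1]"
| "pl_code (PVar p) = 5 # binary p"
| "pl_code (PNeg \<alpha>) = 2 # pl_code \<alpha>"
| "pl_code (PAnd \<alpha> \<beta>) = 3 # pl_code \<alpha> @ pl_code \<beta>"

primrec ml_code :: "nat ml \<Rightarrow> nat list" where
  "ml_code MTop = [1]"
| "ml_code (MVar p) = 5 # binary p"
| "ml_code (MNeg \<phi>) = 2 # ml_code \<phi>"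
| "ml_code (MAnd \<phi> \<psi>) = 3 # ml_code \<phi> @ ml_code \<psi>"
| "ml_code (MBox \<phi>) = 4 # ml_code \<phi>"

end

theory Submission
  imports Defs
begin

text \<open>A tabular logic is the logic of finitely many roots in one finite frame. If no root is redundant,
  interpolation makes the models on these roots homogeneous: if two of them satisfy the same formulas over
  \<open>\<sigma>\<close>, name all worlds of the first by fresh atoms and all worlds of the second by other fresh atoms;
  without a common model of the two descriptions there would be an interpolant over \<open>\<sigma>\<close> that separates them,
  and a common model yields p-morphisms onto both, which must be automorphisms. Hence the models agree on
  \<open>\<sigma>\<close> up to an automorphism, and every automorphism-invariant property is modally definable.

  The translation of \<open>\<phi>\<close> says, for one of the roots, that the root is selected and \<open>\<phi>\<close> is true at it; the
  variables tell which atom holds at which world. Naive unfolding of the boxes is exponential, so the formula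
  is split into a subformula and a context of about half the size, with a disjunction over the possible truth sets of
  the subformula, as in Spira's balancing of Boolean formulas.

  Conversely, a propositional \<open>\<chi>\<close> becomes a modal formula that is true if \<open>\<chi>\<close> is true for all automorphic
  copies of the model, and false if it is false for all of them; this suffices because translations are invariant.
  A bounded number of atoms of \<open>\<chi>\<close> separates all worlds that can be separated, and the modal formula is a disjunction
  over all choices of these atoms.\<close>

section \<open>A stack language and its compilation to Turing machines\<close>

text \<open>Both maps are computed on codes, so each construction is given twice: on formulas, for
  the semantics, and on words, for the machine. The available control structure is weak: folds over
  the letters of a word with a bound on the accumulator, and no recursion over syntax trees. Prefix
  notation compensates for this. Every suffix of a code that starts at a token begins with a
  complete subformula, so a homomorphic translation amounts to emitting, at each suffix, the image
  of its leading token. Recursion of unbounded depth is avoided in two ways. The backward map nests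
  \<open>J * J\<close> loops over the atoms of its input, a number fixed with the logic. The forward
  map runs in rounds, each of which rewrites all pending tasks of a partially translated formula at
  once. Halving would let logarithmically many rounds do, but one more round than there are letters
  is simpler to count and harmless, because a potential that never increases bounds every
  intermediate word. The frame, its roots and the defining modal formulas depend on the logic alone
  and are built into the programs.\<close>

type_synonym word = "nat list"
type_synonym store = "nat \<Rightarrow> word"

datatype com =
    Skip
  | Push nat nat
  | Pop nat
  | Seq com com
  | Test nat nat com com
  | While nat com

definition hd0 :: "word \<Rightarrow> nat" where
  "hd0 w = (case w of [] \<Rightarrow> 0 | a # _ \<Rightarrow> a)"

lemma hd0_simps [simp]: "hd0 [] = 0" "hd0 (a # w) = a"
  by (simp_all add: hd0_def)

text \<open>The cost counts basic operations; the machine below needs at most twice as many steps. A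
  unit of cost pushes at most one letter, so the cost also bounds the growth of every
  register.\<close>

inductive big :: "com \<Rightarrow> store \<Rightarrow> nat \<Rightarrow> store \<Rightarrow> bool" where
  Skip: "big Skip s 1 s"
| Push: "big (Push r a) s 1 (s(r := a # s r))"
| Pop: "big (Pop r) s 1 (s(r := tl (s r)))"
| Seq: "big c s t s1 \<Longrightarrow> big c' s1 t' s2 \<Longrightarrow> big (Seq c c') s (t + t') s2"
| TestT: "hd0 (s r) = a \<Longrightarrow> big c s t s1 \<Longrightarrow> big (Test r a c c') s (t + 1) s1"
| TestF: "hd0 (s r) \<noteq> a \<Longrightarrow> big c' s t s1 \<Longrightarrow> big (Test r a c c') s (t + 1) s1"
| WhileF: "s r = [] \<Longrightarrow> big (While r c) s 1 s"
| WhileT: "s r \<noteq> [] \<Longrightarrow> big c s t s1 \<Longrightarrow> big (While r c) s1 t' s2 \<Longrightarrow> big (While r c) s (t + t' + 1) s2"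

primrec wfc :: "nat \<Rightarrow> nat \<Rightarrow> com \<Rightarrow> bool" where
  "wfc K G Skip \<longleftrightarrow> True"
| "wfc K G (Push r a) \<longleftrightarrow> r < K \<and> 0 < a \<and> a < G"
| "wfc K G (Pop r) \<longleftrightarrow> r < K"
| "wfc K G (Seq c c') \<longleftrightarrow> wfc K G c \<and> wfc K G c'"
| "wfc K G (Test r a c c') \<longleftrightarrow> r < K \<and> wfc K G c \<and> wfc K G c'"
| "wfc K G (While r c) \<longleftrightarrow> r < K \<and> wfc K G c"

lemma wfc_mono: "wfc K G c \<Longrightarrow> K \<le> K' \<Longrightarrow> wfc K' G c"
  by (induction c) auto

definition valid :: "nat \<Rightarrow> word \<Rightarrow> bool" where
  "valid G w \<longleftrightarrow> set w \<subseteq> {0<..<G}"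

text \<open>A 0 on a stack would look like its bottom, because the blank is what the head scans on
  an empty stack. Programs that push only letters between 1 and \<open>G - 1\<close> never create
  this ambiguity.\<close>

lemma big_valid:
  "big c s t s' \<Longrightarrow> wfc K G c \<Longrightarrow> (\<And>r. valid G (s r)) \<Longrightarrow> valid G (s' r)"
proof (induction arbitrary: r rule: big.induct)
  case (Pop q s)
  have "set (tl (s q)) \<subseteq> set (s q)" by (cases "s q") auto
  then show ?case using Pop.prems(2)[of q] Pop.prems(2)[of r] by (auto simp: valid_def)
qed (auto simp: valid_def)

lemma big_length: "big c s t s' \<Longrightarrow> length (s' r) \<le> length (s r) + t"
  by (induction rule: big.induct) auto

primrec nst :: "com \<Rightarrow> nat" where
  "nst Skip = 1"
| "nst (Push r a) = 2"
| "nst (Pop r) = 1"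
| "nst (Seq c c') = nst c + nst c'"
| "nst (Test r a c c') = 1 + nst c + nst c'"
| "nst (While r c) = 1 + nst c"

lemma nst_pos: "0 < nst c"
  by (induction c) auto

definition idle :: "nat list \<Rightarrow> (nat \<times> int) list" where
  "idle = map (\<lambda>a. (a, 0))"

text \<open>The top of a stack is the scanned cell and the stack extends to the right. A push moves
  left and then writes, which takes two states; a pop moves right and leaves its letter behind as
  garbage. The state \<open>nst c\<close> is the exit of \<open>c\<close>, so that subprograms can
  be laid out one after another.\<close>

primrec del :: "com \<Rightarrow> nat \<Rightarrow> nat list \<Rightarrow> nat \<times> (nat \<times> int) list" where
  "del Skip = (\<lambda>q ss. (1, idle ss))"
| "del (Push r a) = (\<lambda>q ss. if q = 0 then (1, (idle ss)[r := (ss ! r, -1)]) else (2, (idle ss)[r := (a, 0)]))"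
| "del (Pop r) = (\<lambda>q ss. (1, (idle ss)[r := (ss ! r, 1)]))"
| "del (Seq c c') = (\<lambda>q ss. if q < nst c then del c q ss
     else (let (q', acts) = del c' (q - nst c) ss in (q' + nst c, acts)))"
| "del (Test r a c c') = (\<lambda>q ss.
     if q = 0 then (if ss ! r = a then 1 else 1 + nst c, idle ss)
     else if q < 1 + nst c then
       (let (q', acts) = del c (q - 1) ss in (if q' = nst c then 1 + nst c + nst c' else q' + 1, acts))
     else (let (q', acts) = del c' (q - 1 - nst c) ss in (q' + (1 + nst c), acts)))"
| "del (While r c) = (\<lambda>q ss.
     if q = 0 then (if ss ! r = 0 then 1 + nst c else 1, idle ss)
     else (let (q', acts) = del c (q - 1) ss in (if q' = nst c then 0 else q' + 1, acts)))"

definition mach :: "nat \<Rightarrow> nat \<Rightarrow> com \<Rightarrow> tm" where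
  "mach K G c = \<lparr>num_tapes = K, num_symbols = G, num_states = nst c, transition = del c\<rparr>"

lemma del_wf:
  assumes "wfc K G c" "q < nst c" "length ss = K" "set ss \<subseteq> {..<G}"
  shows "fst (del c q ss) \<le> nst c \<and> length (snd (del c q ss)) = K \<and>
    (\<forall>(a, d) \<in> set (snd (del c q ss)). a < G \<and> d \<in> {-1, 0, 1})"
  using assms
proof (induction c arbitrary: q)
  case (Push r a)
  then show ?case
    by (auto simp: idle_def set_conv_nth nth_list_update subset_iff split: if_splits)
next
  case (Pop r)
  then show ?case
    by (auto simp: idle_def set_conv_nth nth_list_update subset_iff split: if_splits)
next
  case (Seq c c')
  show ?case
  proof (cases "q < nst c")
    case True
    then show ?thesis using Seq.IH(1)[of q] Seq.prems by auto
  next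
    case False
    then show ?thesis using Seq.IH(2)[of "q - nst c"] Seq.prems by (auto simp: split: prod.splits)
  qed
next
  case (Test r a c c')
  consider "q = 0" | "q \<noteq> 0" "q < 1 + nst c" | "q \<noteq> 0" "\<not> q < 1 + nst c" by blast
  then show ?case
  proof cases
    case 1
    then show ?thesis using Test.prems nst_pos[of c] nst_pos[of c'] by (auto simp: idle_def)
  next
    case 2
    then have "q - 1 < nst c" by linarith
    then show ?thesis using 2 Test.IH(1)[of "q - 1"] Test.prems by (auto split: prod.splits)
  next
    case 3
    then have "q - 1 - nst c < nst c'" using Test.prems by simp
    then show ?thesis using 3 Test.IH(2)[of "q - 1 - nst c"] Test.prems by (auto split: prod.splits)
  qed
next
  case (While r c)
  show ?case
  proof (cases "q = 0")
    case True
    then show ?thesis using While.prems by (auto simp: idle_def)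
  next
    case False
    then have "q - 1 < nst c" using While.prems by simp
    then show ?thesis using False While.IH[of "q - 1"] While.prems by (auto split: prod.splits)
  qed
qed (auto simp: idle_def)

definition run1 :: "(nat \<Rightarrow> nat list \<Rightarrow> nat \<times> (nat \<times> int) list) \<Rightarrow> nat \<Rightarrow> ((nat \<times> tape list) \<times> (nat \<times> tape list)) set" where
  "run1 d n = {((q, Ts), (q', Ts')). q < n \<and>
     q' = fst (d q (map (\<lambda>T. T 0) Ts)) \<and> Ts' = map2 tape_act (snd (d q (map (\<lambda>T. T 0) Ts))) Ts}"

lemma run1_tm_step: "(C, C') \<in> run1 (del c) (nst c) ^^ k \<Longrightarrow> (tm_step (mach K G c) ^^ k) C = C'"
proof (induction k arbitrary: C')
  case (Suc k)
  then obtain D where "(C, D) \<in> run1 (del c) (nst c) ^^ k" "(D, C') \<in> run1 (del c) (nst c)" by auto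
  then show ?case using Suc.IH
    by (auto simp: run1_def tm_step_def mach_def split: prod.splits)
qed simp

text \<open>The renaming \<open>h\<close> has to commute with transitions only at the running states
  below \<open>n\<close>. Where it sends the exit of a subprogram is free, and this is how the exit
  of a branch or of a loop body is redirected.\<close>

lemma run1_lift:
  assumes "((q, Ts), (q', Ts')) \<in> run1 d n ^^ k"
    and "\<And>q ss. q < n \<Longrightarrow> h q < n' \<and> d' (h q) ss = (h (fst (d q ss)), snd (d q ss))"
  shows "((h q, Ts), (h q', Ts')) \<in> run1 d' n' ^^ k"
  using assms(1)
proof (induction k arbitrary: q' Ts')
  case (Suc k)
  then obtain q1 Ts1 where "((q, Ts), (q1, Ts1)) \<in> run1 d n ^^ k" and 1: "((q1, Ts1), (q', Ts')) \<in> run1 d n"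
    by auto
  then have "((h q, Ts), (h q1, Ts1)) \<in> run1 d' n' ^^ k" using Suc.IH by blast
  moreover have "((h q1, Ts1), (h q', Ts')) \<in> run1 d' n'"
    using 1 assms(2)[of q1 "map (\<lambda>T. T 0) Ts1"] by (auto simp: run1_def)
  ultimately show ?case by auto
qed simp

text \<open>Cells to the left of the head are unconstrained: they hold the garbage of earlier pops,
  which a push overwrites.\<close>

definition stack_tape :: "tape \<Rightarrow> word \<Rightarrow> bool" where
  "stack_tape T w \<longleftrightarrow> (\<forall>i::nat. T (int i) = (if i < length w then w ! i else 0))"

definition tapes :: "nat \<Rightarrow> tape list \<Rightarrow> store \<Rightarrow> bool" where
  "tapes K Ts s \<longleftrightarrow> length Ts = K \<and> (\<forall>r < K. stack_tape (Ts ! r) (s r))"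

lemma stack_tape_hd: "stack_tape T w \<Longrightarrow> T 0 = hd0 w"
  unfolding stack_tape_def by (drule spec[of _ 0]) (cases w; simp)

lemma map2_idle: "map2 tape_act (idle (map (\<lambda>T. T 0) Ts)) Ts = Ts"
  by (rule nth_equalityI) (auto simp: idle_def tape_act_def)

lemma map2_idle_update:
  "r < length Ts \<Longrightarrow> map2 tape_act ((idle (map (\<lambda>T. T 0) Ts))[r := x]) Ts = Ts[r := tape_act x (Ts ! r)]"
  by (rule nth_equalityI) (auto simp: idle_def tape_act_def nth_list_update)

lemma del_embed:
  "q < nst c \<Longrightarrow> q < nst (Seq c c') \<and> del (Seq c c') q ss = (fst (del c q ss), snd (del c q ss))"
  "q < nst c' \<Longrightarrow> q + nst c < nst (Seq c c') \<and>
    del (Seq c c') (q + nst c) ss = (fst (del c' q ss) + nst c, snd (del c' q ss))"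
  "q < nst c \<Longrightarrow> (if q = nst c then nst (Test r a c c') else q + 1) < nst (Test r a c c') \<and>
    del (Test r a c c') (if q = nst c then nst (Test r a c c') else q + 1) ss =
      (if fst (del c q ss) = nst c then nst (Test r a c c') else fst (del c q ss) + 1, snd (del c q ss))"
  "q < nst c' \<Longrightarrow> q + (1 + nst c) < nst (Test r a c c') \<and>
    del (Test r a c c') (q + (1 + nst c)) ss = (fst (del c' q ss) + (1 + nst c), snd (del c' q ss))"
  "q < nst c \<Longrightarrow> (if q = nst c then 0 else q + 1) < nst (While r c) \<and>
    del (While r c) (if q = nst c then 0 else q + 1) ss =
      (if fst (del c q ss) = nst c then 0 else fst (del c q ss) + 1, snd (del c q ss))"
  by (simp_all add: split_def Let_def)

lemma run1I: "q < n \<Longrightarrow> d q (map (\<lambda>T. T 0) Ts) = (q', acts) \<Longrightarrow> ((q, Ts), (q', map2 tape_act acts Ts)) \<in> run1 d n"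
  by (simp add: run1_def)

text \<open>The factor 2 is due to \<open>Push\<close>; every other construct adds at most one
  machine step to those of its parts. Validity makes the entry test of a loop correct: a nonempty
  stack shows a nonblank letter.\<close>

lemma compile_correct:
  assumes "big c s t s'" "wfc K G c" "\<And>r. valid G (s r)" "tapes K Ts s"
  shows "\<exists>k \<le> 2 * t. \<exists>Ts'. ((0, Ts), (nst c, Ts')) \<in> run1 (del c) (nst c) ^^ k \<and> tapes K Ts' s'"
  using assms
proof (induction arbitrary: Ts rule: big.induct)
  case (Skip s)
  have "((0, Ts), (1, Ts)) \<in> run1 (del Skip) (nst Skip)"
    using run1I[of 0 "nst Skip" "del Skip" Ts 1] by (simp add: map2_idle)
  then have "((0, Ts), (1, Ts)) \<in> run1 (del Skip) (nst Skip) ^^ 1" by simp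
  then show ?case using Skip.prems
    by (intro exI[of _ 1] conjI exI[of _ Ts]) auto
next
  case (Push r a s)
  let ?Ts = "Ts[r := tape_act (hd0 (s r), -1) (Ts ! r)]"
  let ?Us = "?Ts[r := tape_act (a, 0) (?Ts ! r)]"
  have r: "r < length Ts" "stack_tape (Ts ! r) (s r)" using Push.prems by (auto simp: tapes_def)
  have h: "map (\<lambda>T. T 0) Ts ! r = hd0 (s r)" using r stack_tape_hd by simp
  have "((0, Ts), (1, ?Ts)) \<in> run1 (del (Push r a)) 2"
    using run1I[of 0 2 "del (Push r a)" Ts 1] r h by (simp add: map2_idle_update)
  moreover have "((1, ?Ts), (2, ?Us)) \<in> run1 (del (Push r a)) 2"
    using run1I[of 1 2 "del (Push r a)" ?Ts 2] r map2_idle_update[of r ?Ts "(a, 0)"] by simp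
  ultimately have "((0, Ts), (2, ?Us)) \<in> run1 (del (Push r a)) 2 ^^ 2" by (auto simp: numeral_2_eq_2)
  moreover have "stack_tape (?Us ! r) (a # s r)"
    unfolding stack_tape_def
  proof
    fix i :: nat
    show "(?Us ! r) (int i) = (if i < length (a # s r) then (a # s r) ! i else 0)"
    proof (cases i)
      case 0
      then show ?thesis using r by (simp add: tape_act_def)
    next
      case (Suc j)
      then have "(?Us ! r) (int i) = (if j = 0 then hd0 (s r) else (Ts ! r) (int j))"
        using r by (auto simp: tape_act_def)
      then show ?thesis using Suc r(2) stack_tape_hd[OF r(2)] by (cases "s r") (auto simp: stack_tape_def)
    qed
  qed
  then have "tapes K ?Us (s(r := a # s r))"
    using Push.prems r by (auto simp: tapes_def nth_list_update)
  ultimately show ?case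
    by (intro exI[of _ 2] conjI exI[of _ ?Us]) (simp_all del: del.simps relpow.simps fun_upd_apply)
next
  case (Pop r s)
  let ?Ts = "Ts[r := tape_act (hd0 (s r), 1) (Ts ! r)]"
  have r: "r < length Ts" "stack_tape (Ts ! r) (s r)" using Pop.prems by (auto simp: tapes_def)
  have h: "map (\<lambda>T. T 0) Ts ! r = hd0 (s r)" using r stack_tape_hd by simp
  have "((0, Ts), (1, ?Ts)) \<in> run1 (del (Pop r)) 1"
    using run1I[of 0 1 "del (Pop r)" Ts 1] r h by (simp add: map2_idle_update)
  then have "((0, Ts), (1, ?Ts)) \<in> run1 (del (Pop r)) 1 ^^ 1" by simp
  moreover have "stack_tape (?Ts ! r) (tl (s r))"
    unfolding stack_tape_def
  proof
    fix i :: nat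
    have "(Ts ! r) (int (Suc i)) = (if Suc i < length (s r) then s r ! Suc i else 0)"
      using r(2) unfolding stack_tape_def by blast
    then show "(?Ts ! r) (int i) = (if i < length (tl (s r)) then tl (s r) ! i else 0)"
      using r by (cases "s r") (auto simp: tape_act_def add.commute)
  qed
  then have "tapes K ?Ts (s(r := tl (s r)))"
    using Pop.prems r by (auto simp: tapes_def nth_list_update)
  ultimately show ?case
    by (intro exI[of _ 1] conjI exI[of _ ?Ts]) (simp_all del: del.simps relpow.simps fun_upd_apply)
next
  case (Seq c s t s1 c' t' s2)
  let ?d = "del (Seq c c')" and ?n = "nst (Seq c c')"
  have wf: "wfc K G c" "wfc K G c'" using Seq.prems by auto
  obtain k Ts1 where 1: "k \<le> 2 * t" "((0, Ts), (nst c, Ts1)) \<in> run1 (del c) (nst c) ^^ k" "tapes K Ts1 s1"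
    using Seq.IH(1)[OF wf(1) Seq.prems(2,3)] by blast
  have v: "\<And>r. valid G (s1 r)" using big_valid[OF Seq.hyps(1)] Seq.prems by auto
  obtain k' Ts2 where 2: "k' \<le> 2 * t'" "((0, Ts1), (nst c', Ts2)) \<in> run1 (del c') (nst c') ^^ k'" "tapes K Ts2 s2"
    using Seq.IH(2)[OF wf(2) v 1(3)] by blast
  have "((0, Ts), (nst c, Ts1)) \<in> run1 ?d ?n ^^ k"
    using run1_lift[OF 1(2), of "\<lambda>q. q" ?n ?d, OF del_embed(1)] nst_pos[of c] by (simp add: add_ac del: del.simps relpow.simps)
  moreover have "((nst c, Ts1), (?n, Ts2)) \<in> run1 ?d ?n ^^ k'"
    using run1_lift[OF 2(2), of "\<lambda>q. q + nst c" ?n ?d, OF del_embed(2)] nst_pos[of c] by (simp add: add_ac del: del.simps relpow.simps)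
  ultimately have "((0, Ts), (?n, Ts2)) \<in> run1 ?d ?n ^^ (k + k')"
    by (subst relpow_add) (rule relcomp.relcompI)
  then show ?case using 1 2 by (intro exI[of _ "k + k'"] conjI exI[of _ Ts2]) (simp_all del: del.simps relpow.simps)
next
  case (TestT s r a c t s1 c')
  let ?d = "del (Test r a c c')" and ?n = "nst (Test r a c c')"
  have wf: "wfc K G c" using TestT.prems by auto
  obtain k Ts1 where 1: "k \<le> 2 * t" "((0, Ts), (nst c, Ts1)) \<in> run1 (del c) (nst c) ^^ k" "tapes K Ts1 s1"
    using TestT.IH[OF wf TestT.prems(2,3)] by blast
  have r: "r < length Ts" "stack_tape (Ts ! r) (s r)" using TestT.prems by (auto simp: tapes_def)
  have "((0, Ts), (1, Ts)) \<in> run1 ?d ?n"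
    using run1I[of 0 ?n ?d Ts 1] r stack_tape_hd[OF r(2)] TestT.hyps by (simp add: map2_idle)
  moreover have "((1, Ts), (?n, Ts1)) \<in> run1 ?d ?n ^^ k"
    using run1_lift[OF 1(2), of "\<lambda>q. if q = nst c then ?n else q + 1" ?n ?d, OF del_embed(3)] nst_pos[of c] by (simp add: add_ac del: del.simps relpow.simps)
  ultimately have "((0, Ts), (?n, Ts1)) \<in> run1 ?d ?n ^^ Suc k" by (rule relpow_Suc_I2)
  then show ?case using 1 by (intro exI[of _ "Suc k"] conjI exI[of _ Ts1]) (simp_all del: del.simps relpow.simps)
next
  case (TestF s r a c' t s1 c)
  let ?d = "del (Test r a c c')" and ?n = "nst (Test r a c c')"
  have wf: "wfc K G c'" using TestF.prems by auto
  obtain k Ts1 where 1: "k \<le> 2 * t" "((0, Ts), (nst c', Ts1)) \<in> run1 (del c') (nst c') ^^ k" "tapes K Ts1 s1"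
    using TestF.IH[OF wf TestF.prems(2,3)] by blast
  have r: "r < length Ts" "stack_tape (Ts ! r) (s r)" using TestF.prems by (auto simp: tapes_def)
  have "((0, Ts), (1 + nst c, Ts)) \<in> run1 ?d ?n"
    using run1I[of 0 ?n ?d Ts "1 + nst c"] r stack_tape_hd[OF r(2)] TestF.hyps by (simp add: map2_idle)
  moreover have "((1 + nst c, Ts), (?n, Ts1)) \<in> run1 ?d ?n ^^ k"
    using run1_lift[OF 1(2), of "\<lambda>q. q + (1 + nst c)" ?n ?d, OF del_embed(4)] nst_pos[of c] by (simp add: add_ac del: del.simps relpow.simps)
  ultimately have "((0, Ts), (?n, Ts1)) \<in> run1 ?d ?n ^^ Suc k" by (rule relpow_Suc_I2)
  then show ?case using 1 by (intro exI[of _ "Suc k"] conjI exI[of _ Ts1]) (simp_all del: del.simps relpow.simps)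
next
  case (WhileF s r c)
  let ?d = "del (While r c)" and ?n = "nst (While r c)"
  have r: "r < length Ts" "stack_tape (Ts ! r) (s r)" using WhileF.prems by (auto simp: tapes_def)
  have "((0, Ts), (?n, Ts)) \<in> run1 ?d ?n"
    using run1I[of 0 ?n ?d Ts ?n] r stack_tape_hd[OF r(2)] WhileF.hyps by (simp add: map2_idle)
  then have "((0, Ts), (?n, Ts)) \<in> run1 ?d ?n ^^ 1" by simp
  then show ?case using WhileF.prems by (intro exI[of _ 1] conjI exI[of _ Ts]) auto
next
  case (WhileT s r c t s1 t' s2)
  let ?d = "del (While r c)" and ?n = "nst (While r c)"
  have wf: "wfc K G c" using WhileT.prems by auto
  obtain k Ts1 where 1: "k \<le> 2 * t" "((0, Ts), (nst c, Ts1)) \<in> run1 (del c) (nst c) ^^ k" "tapes K Ts1 s1"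
    using WhileT.IH(1)[OF wf WhileT.prems(2,3)] by blast
  have v: "\<And>r. valid G (s1 r)" using big_valid[OF WhileT.hyps(2)] WhileT.prems by auto
  obtain k' Ts2 where 2: "k' \<le> 2 * t'" "((0, Ts1), (?n, Ts2)) \<in> run1 ?d ?n ^^ k'" "tapes K Ts2 s2"
    using WhileT.IH(2)[OF WhileT.prems(1) v 1(3)] by blast
  have r: "r < length Ts" "stack_tape (Ts ! r) (s r)" using WhileT.prems by (auto simp: tapes_def)
  have "hd0 (s r) \<noteq> 0" using WhileT.hyps(1) WhileT.prems(2)[of r] by (cases "s r") (auto simp: valid_def)
  then have "((0, Ts), (1, Ts)) \<in> run1 ?d ?n"
    using run1I[of 0 ?n ?d Ts 1] r stack_tape_hd[OF r(2)] by (simp add: map2_idle)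
  moreover have "((1, Ts), (0, Ts1)) \<in> run1 ?d ?n ^^ k"
    using run1_lift[OF 1(2), of "\<lambda>q. if q = nst c then 0 else q + 1" ?n ?d, OF del_embed(5)] nst_pos[of c] by (simp add: add_ac del: del.simps relpow.simps)
  ultimately have "((0, Ts), (0, Ts1)) \<in> run1 ?d ?n ^^ Suc k" by (rule relpow_Suc_I2)
  then have "((0, Ts), (?n, Ts2)) \<in> run1 ?d ?n ^^ (Suc k + k')"
    using 2(2) by (subst relpow_add) (rule relcomp.relcompI)
  then show ?case using 1 2 by (intro exI[of _ "Suc k + k'"] conjI exI[of _ Ts2]) (simp_all del: del.simps relpow.simps)
qed

section \<open>Polynomial-time word functions\<close>

text \<open>A single power is enough: its base is at least 2, so constants and sums are absorbed by
  raising the exponent.\<close>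

definition polyb :: "('e \<Rightarrow> nat) \<Rightarrow> ('e \<Rightarrow> nat) \<Rightarrow> bool" where
  "polyb N g \<longleftrightarrow> (\<exists>k. \<forall>e. g e \<le> (N e + 2) ^ k)"

lemma polyb_mono: "polyb N g \<Longrightarrow> (\<And>e. h e \<le> g e) \<Longrightarrow> polyb N h"
  unfolding polyb_def by (meson order_trans)

lemma polyb_id: "polyb N N"
  unfolding polyb_def by (rule exI[of _ 1]) simp

lemma polyb_const: "polyb N (\<lambda>_. c)"
  unfolding polyb_def
proof (rule exI[of _ c], rule allI)
  fix e
  have "c < 2 ^ c" by (rule less_exp)
  also have "(2::nat) ^ c \<le> (N e + 2) ^ c" by (rule power_mono) auto
  finally show "c \<le> (N e + 2) ^ c" by simp
qed

lemma polyb_mult: "polyb N g \<Longrightarrow> polyb N h \<Longrightarrow> polyb N (\<lambda>e. g e * h e)"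
  unfolding polyb_def by (metis mult_le_mono power_add)

lemma polyb_add:
  assumes "polyb N g" "polyb N h"
  shows "polyb N (\<lambda>e. g e + h e)"
proof -
  obtain i j where i: "\<And>e. g e \<le> (N e + 2) ^ i" and j: "\<And>e. h e \<le> (N e + 2) ^ j"
    using assms unfolding polyb_def by blast
  have "g e + h e \<le> (N e + 2) ^ (i + j + 1)" for e
  proof -
    have "(N e + 2) ^ i \<le> (N e + 2) ^ (i + j)" "(N e + 2) ^ j \<le> (N e + 2) ^ (i + j)"
      by (rule power_increasing; simp)+
    then have "g e + h e \<le> 2 * (N e + 2) ^ (i + j)" using i[of e] j[of e] by linarith
    also have "\<dots> \<le> (N e + 2) * (N e + 2) ^ (i + j)" by (intro mult_right_mono) auto
    finally show ?thesis by simp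
  qed
  then show ?thesis unfolding polyb_def by blast
qed

lemma polyb_power: "polyb N g \<Longrightarrow> polyb N (\<lambda>e. g e ^ k)"
  by (induction k) (auto intro: polyb_const[of N "1::nat", simplified] polyb_mult)

lemma polyb_comp: "polyb N M \<Longrightarrow> polyb M g \<Longrightarrow> polyb N g"
proof -
  assume M: "polyb N M" and "polyb M g"
  then obtain k where k: "\<And>e. g e \<le> (M e + 2) ^ k" unfolding polyb_def by blast
  have "polyb N (\<lambda>e. (M e + 2) ^ k)" by (intro polyb_power polyb_add M polyb_const)
  then show "polyb N g" using k by (rule polyb_mono)
qed

lemma polyb_leI:
  assumes "polyb M g" "\<And>e. M e \<le> N e"
  shows "polyb N g"
  using assms(2) by (intro polyb_comp[OF polyb_mono[OF polyb_id] assms(1)])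

lemma polyb_Suc: "polyb N g \<Longrightarrow> polyb N (\<lambda>e. Suc (g e))"
  using polyb_add[OF _ polyb_const[of N 1]] by simp

lemmas polyb_intros = polyb_Suc polyb_id polyb_const polyb_add polyb_mult polyb_power

section \<open>Programs with time bounds\<close>

definition runs :: "com \<Rightarrow> store \<Rightarrow> nat \<Rightarrow> store \<Rightarrow> bool" where
  "runs c s T s' \<longleftrightarrow> (\<exists>t \<le> T. big c s t s')"

lemma runs_mono: "runs c s T s' \<Longrightarrow> T \<le> T' \<Longrightarrow> runs c s T' s'"
  unfolding runs_def using order_trans by blast

lemma runs_length: "runs c s T s' \<Longrightarrow> length (s' r) \<le> length (s r) + T"
  unfolding runs_def using big_length by (metis add_left_mono order_trans)

lemma runs_valid: "runs c s T s' \<Longrightarrow> wfc K G c \<Longrightarrow> (\<And>r. valid G (s r)) \<Longrightarrow> valid G (s' r)"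
  unfolding runs_def using big_valid by blast

lemma runs_Skip: "runs Skip s 1 s"
  unfolding runs_def using big.Skip by blast

lemma runs_Push: "runs (Push r a) s 1 (s(r := a # s r))"
  unfolding runs_def using big.Push by blast

lemma runs_Pop: "runs (Pop r) s 1 (s(r := tl (s r)))"
  unfolding runs_def using big.Pop by blast

lemma runs_Seq: "runs c s T s1 \<Longrightarrow> runs c' s1 T' s2 \<Longrightarrow> runs (Seq c c') s (T + T') s2"
  unfolding runs_def using big.Seq by (meson add_mono)

lemma runs_Test: "runs (if hd0 (s r) = a then c else c') s T s' \<Longrightarrow> runs (Test r a c c') s (T + 1) s'"
  unfolding runs_def using TestT[of s r a c _ s' c'] TestF[of s r a c' _ s' c]
  by (cases "hd0 (s r) = a") force+

lemma runs_WhileF: "s r = [] \<Longrightarrow> runs (While r c) s 1 s"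
  unfolding runs_def using big.WhileF by blast

lemma runs_WhileT:
  assumes "s r \<noteq> []" "runs c s T s1" "runs (While r c) s1 T' s2"
  shows "runs (While r c) s (T + T' + 1) s2"
proof -
  obtain t t' where "t \<le> T" "big c s t s1" "t' \<le> T'" "big (While r c) s1 t' s2"
    using assms(2,3) unfolding runs_def by blast
  then show ?thesis using big.WhileT[of s r, OF assms(1)] unfolding runs_def
    by (intro exI[of _ "t + t' + 1"]) auto
qed

primrec branch :: "nat \<Rightarrow> (nat \<Rightarrow> com) \<Rightarrow> nat \<Rightarrow> com" where
  "branch r f 0 = Skip"
| "branch r f (Suc n) = Test r n (f n) (branch r f n)"

lemma runs_branch: "hd0 (s r) < n \<Longrightarrow> runs (f (hd0 (s r))) s T s' \<Longrightarrow> runs (branch r f n) s (T + n) s'"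
proof (induction n)
  case (Suc n)
  show ?case
  proof (cases "hd0 (s r) = n")
    case True
    then show ?thesis using Suc.prems runs_Test[of s r n "f n" "branch r f n" T s']
      by (auto elim: runs_mono)
  next
    case False
    then have "runs (branch r f n) s (T + n) s'" using Suc by auto
    then show ?thesis using False runs_Test[of s r n "f n" "branch r f n" "T + n" s'] by simp
  qed
qed simp

lemma wfc_branch: "r < K \<Longrightarrow> (\<And>a. a < n \<Longrightarrow> wfc K G (f a)) \<Longrightarrow> wfc K G (branch r f n)"
  by (induction n) auto

text \<open>The dispatch in \<open>move\<close> ranges over all letters below \<open>G\<close>,
  including 0, which must not be pushed; hence the default for 0.\<close>

fun push_all :: "nat list \<Rightarrow> nat \<Rightarrow> com" where
  "push_all qs 0 = Skip"
| "push_all [] a = Skip"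
| "push_all (q # qs) a = Seq (Push q a) (push_all qs a)"

lemma runs_push_all:
  "a \<noteq> 0 \<Longrightarrow> distinct qs \<Longrightarrow>
    runs (push_all qs a) s (length qs + 1) (\<lambda>q. if q \<in> set qs then a # s q else s q)"
proof (induction qs arbitrary: s)
  case Nil
  then show ?case using runs_Skip by (cases a) auto
next
  case (Cons q qs)
  obtain b where b: "a = Suc b" using Cons.prems by (cases a) auto
  have "runs (push_all qs a) (s(q := a # s q)) (length qs + 1)
     (\<lambda>p. if p \<in> set qs then a # (s(q := a # s q)) p else (s(q := a # s q)) p)"
    using Cons by auto
  moreover have "(\<lambda>p. if p \<in> set qs then a # (s(q := a # s q)) p else (s(q := a # s q)) p)
     = (\<lambda>p. if p \<in> set (q # qs) then a # s p else s p)" using Cons.prems by auto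
  ultimately show ?case using runs_Seq[OF runs_Push] b by (fastforce elim: runs_mono)
qed

lemma wfc_push_all: "(\<And>q. q \<in> set qs \<Longrightarrow> q < K) \<Longrightarrow> a < G \<Longrightarrow> wfc K G (push_all qs a)"
  by (induction qs a rule: push_all.induct) auto

text \<open>Pouring reverses the word. A pour without target clears a register, and a second pour
  out of an intermediate register into two targets makes a copy.\<close>

definition move :: "nat \<Rightarrow> nat \<Rightarrow> nat list \<Rightarrow> com" where
  "move G r qs = While r (Seq (branch r (push_all qs) G) (Pop r))"

lemma wfc_move: "r < K \<Longrightarrow> (\<And>q. q \<in> set qs \<Longrightarrow> q < K) \<Longrightarrow> wfc K G (move G r qs)"
  by (auto simp: move_def intro!: wfc_branch wfc_push_all)

lemma runs_move:
  assumes "valid G (s r)" "r \<notin> set qs" "distinct qs"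
  shows "runs (move G r qs) s (length (s r) * (length qs + G + 3) + 1)
    (\<lambda>q. if q = r then [] else if q \<in> set qs then rev (s r) @ s q else s q)"
  using assms
proof (induction "s r" arbitrary: s)
  case Nil
  have "(\<lambda>q. if q = r then [] else if q \<in> set qs then rev (s r) @ s q else s q) = s"
    using Nil.hyps by (auto simp: fun_eq_iff)
  then show ?case using runs_WhileF[of s r] Nil.hyps by (simp add: move_def)
next
  case (Cons a w)
  let ?s1 = "\<lambda>q. if q \<in> set qs then a # s q else s q"
  let ?s2 = "?s1(r := tl (?s1 r))"
  have a: "0 < a" "a < G" using Cons.prems(1) Cons.hyps(2)[symmetric] by (auto simp: valid_def)
  have h: "hd0 (s r) = a" using Cons.hyps(2)[symmetric] by simp
  have "runs (branch r (push_all qs) G) s (length qs + 1 + G) ?s1"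
    by (rule runs_branch) (use a h Cons.prems(3) runs_push_all[of a qs s] in auto)
  then have 1: "runs (Seq (branch r (push_all qs) G) (Pop r)) s (length qs + 1 + G + 1) ?s2"
    by (rule runs_Seq) (rule runs_Pop)
  have s2: "?s2 r = w" using Cons.hyps(2)[symmetric] Cons.prems(2) by simp
  have "valid G (?s2 r)" using Cons.prems(1) Cons.hyps(2)[symmetric] s2 by (auto simp: valid_def)
  from Cons.hyps(1)[of ?s2, OF s2[symmetric] this Cons.prems(2,3)]
  have "runs (move G r qs) s (length qs + 1 + G + 1 + (length w * (length qs + G + 3) + 1) + 1)
    (\<lambda>q. if q = r then [] else if q \<in> set qs then rev (?s2 r) @ ?s2 q else ?s2 q)"
    unfolding move_def s2 using 1 Cons.hyps(2)[symmetric] by (intro runs_WhileT) auto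
  moreover have "(\<lambda>q. if q = r then [] else if q \<in> set qs then rev (?s2 r) @ ?s2 q else ?s2 q)
    = (\<lambda>q. if q = r then [] else if q \<in> set qs then rev (s r) @ s q else s q)"
    unfolding s2 using Cons.hyps(2)[symmetric] by (auto simp: fun_eq_iff)
  moreover have "length qs + 1 + G + 1 + (length w * (length qs + G + 3) + 1) + 1
     = length (s r) * (length qs + G + 3) + 1"
    using Cons.hyps(2)[symmetric] by simp
  ultimately show ?case by simp
qed

lemma runs_clear:
  "valid G (s r) \<Longrightarrow> runs (move G r []) s (length (s r) * (G + 3) + 1) (s(r := []))"
proof -
  assume "valid G (s r)"
  from runs_move[of G s r "[]", OF this] show ?thesis by (simp add: fun_upd_def cong: if_cong)
qed

lemma runs_move1:
  assumes "valid G (s r)" "r \<noteq> q"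
  shows "runs (move G r [q]) s (length (s r) * (G + 4) + 1) (s(r := [], q := rev (s r) @ s q))"
proof -
  have "(\<lambda>p. if p = r then [] else if p \<in> set [q] then rev (s r) @ s p else s p) = s(r := [], q := rev (s r) @ s q)"
    using assms(2) by (auto simp: fun_eq_iff)
  then show ?thesis using runs_move[of G s r "[q]", OF assms(1)] assms(2) by (simp add: add.commute)
qed

lemma valid_rev [simp]: "valid G (rev w) \<longleftrightarrow> valid G w"
  and valid_Nil [simp]: "valid G []"
  and valid_append [simp]: "valid G (v @ w) \<longleftrightarrow> valid G v \<and> valid G w"
  and valid_Cons [simp]: "valid G (a # w) \<longleftrightarrow> 0 < a \<and> a < G \<and> valid G w"
  by (auto simp: valid_def)

text \<open>Two reversals preserve the order; register \<open>d + 2\<close> is scratch space.\<close>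

definition settle :: "nat \<Rightarrow> nat \<Rightarrow> com" where
  "settle G d = Seq (move G d []) (Seq (move G (d + 1) [d + 2]) (move G (d + 2) [d]))"

lemma wfc_settle: "d + 2 < K \<Longrightarrow> wfc K G (settle G d)"
  by (auto simp: settle_def intro!: wfc_move)

lemma runs_settle:
  assumes v: "\<And>r. valid G (s r)" and e: "s (d + 2) = []"
  shows "runs (settle G d) s ((length (s d) + length (s (d + 1)) + 1) * (3 * G + 20)) (s(d := s (d + 1), d + 1 := []))"
proof -
  let ?s1 = "s(d := [])"
  let ?s2 = "?s1(d + 1 := [], d + 2 := rev (s (d + 1)))"
  let ?s3 = "?s2(d + 2 := [], d := s (d + 1))"
  have 1: "runs (move G d []) s (length (s d) * (G + 3) + 1) ?s1" by (rule runs_clear[OF v])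
  have 2: "runs (move G (d + 1) [d + 2]) ?s1 (length (s (d + 1)) * (G + 4) + 1) ?s2"
    using runs_move1[of G ?s1 "d + 1" "d + 2"] v e by simp
  have 3: "runs (move G (d + 2) [d]) ?s2 (length (s (d + 1)) * (G + 4) + 1) ?s3"
    using runs_move1[of G ?s2 "d + 2" d] v by simp
  have 4: "?s3 = s(d := s (d + 1), d + 1 := [])" using e by (auto simp: fun_eq_iff)
  have "runs (settle G d) s ((length (s d) * (G + 3) + 1) + ((length (s (d + 1)) * (G + 4) + 1) + (length (s (d + 1)) * (G + 4) + 1)))
    (s(d := s (d + 1), d + 1 := []))"
    unfolding settle_def using runs_Seq[OF 1 runs_Seq[OF 2 3]] 4 by simp
  then show ?thesis by (rule runs_mono) (simp add: algebra_simps)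
qed

section \<open>Functions on registers computable in polynomial time\<close>

definition sz :: "('e \<Rightarrow> word) list \<Rightarrow> 'e \<Rightarrow> nat" where
  "sz xs e = sum_list (map (\<lambda>x. length (x e)) xs)"

lemma sz_simps [simp]: "sz [] e = 0" "sz (x # xs) e = length (x e) + sz xs e" "sz (xs @ ys) e = sz xs e + sz ys e"
  by (simp_all add: sz_def)

definition env_ok :: "nat \<Rightarrow> ('e \<Rightarrow> word) list \<Rightarrow> nat list \<Rightarrow> nat \<Rightarrow> 'e \<Rightarrow> store \<Rightarrow> bool" where
  "env_ok G xs \<rho> d e s \<longleftrightarrow>
     (\<forall>r. valid G (s r)) \<and> (\<forall>i < length xs. s (\<rho> ! i) = (xs ! i) e) \<and> (\<forall>r \<ge> d. s r = [])"

text \<open>\<open>PT G xs f\<close>: from registers holding the values of \<open>xs\<close>, wherever they are located, a program computes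
  \<open>f\<close> in polynomial time into the first free register and restores everything else.\<close>

definition PT :: "nat \<Rightarrow> ('e \<Rightarrow> word) list \<Rightarrow> ('e \<Rightarrow> word) \<Rightarrow> bool" where
  "PT G xs f \<longleftrightarrow> (\<forall>\<rho> d. length \<rho> = length xs \<longrightarrow> (\<forall>r \<in> set \<rho>. r < d) \<longrightarrow>
     (\<exists>c K T. wfc K G c \<and> polyb (sz xs) T \<and>
        (\<forall>e s. env_ok G xs \<rho> d e s \<longrightarrow> runs c s (T e) (s(d := f e)))))"

lemma PTD:
  assumes "PT G xs f" "length \<rho> = length xs" "\<forall>r \<in> set \<rho>. r < d"
  shows "\<exists>c K T. (\<forall>K'. K \<le> K' \<longrightarrow> wfc K' G c) \<and> polyb (sz xs) T \<and>
    (\<forall>e s. env_ok G xs \<rho> d e s \<longrightarrow> runs c s (T e) (s(d := f e)))"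
proof -
  obtain c K T where "wfc K G c" "polyb (sz xs) T"
    "\<forall>e s. env_ok G xs \<rho> d e s \<longrightarrow> runs c s (T e) (s(d := f e))"
    using assms unfolding PT_def by blast
  then show ?thesis using wfc_mono by blast
qed

lemma env_ok_result:
  assumes "env_ok G xs \<rho> d e s" "runs c s T (s(d := w))" "wfc K G c"
  shows "valid G w" "length w \<le> T"
proof -
  show "valid G w" using runs_valid[OF assms(2,3), of d] assms(1) by (auto simp: env_ok_def)
  show "length w \<le> T" using runs_length[OF assms(2), of d] assms(1) by (auto simp: env_ok_def)
qed

text \<open>The register of the result cannot have grown by more than the running time, so
  \<open>PT\<close> already contains a polynomial bound on the length of the value.\<close>

lemma PT_result:
  assumes "PT G xs f"
  obtains T where "polyb (sz xs) T"
    "\<And>e. \<forall>x \<in> set xs. valid G (x e) \<Longrightarrow> valid G (f e) \<and> length (f e) \<le> T e"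
proof -
  let ?\<rho> = "[0..<length xs]"
  obtain c K T where c: "\<And>K'. K \<le> K' \<Longrightarrow> wfc K' G c" and T: "polyb (sz xs) T"
    and r: "\<And>e s. env_ok G xs ?\<rho> (length xs) e s \<Longrightarrow> runs c s (T e) (s(length xs := f e))"
    using PTD[OF assms, of ?\<rho> "length xs"] by auto
  have "valid G (f e) \<and> length (f e) \<le> T e" if "\<forall>x \<in> set xs. valid G (x e)" for e
  proof -
    let ?s = "\<lambda>r. if r < length xs then (xs ! r) e else []"
    have "env_ok G xs ?\<rho> (length xs) e ?s" using that by (auto simp: env_ok_def)
    from env_ok_result[OF this r[OF this] c[OF order_refl]] show ?thesis by blast
  qed
  then show thesis using T that by blast
qed

lemma PT_cong:
  assumes "PT G xs f" "\<And>e. \<forall>x \<in> set xs. valid G (x e) \<Longrightarrow> f e = f' e"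
  shows "PT G xs f'"
  unfolding PT_def
proof (intro allI impI)
  fix \<rho> :: "nat list" and d :: nat assume a: "length \<rho> = length xs" "\<forall>r \<in> set \<rho>. r < d"
  have eq: "f e = f' e" if "env_ok G xs \<rho> d e s" for e s
    using that assms(2)[of e] unfolding env_ok_def by (metis in_set_conv_nth)
  show "\<exists>c K T. wfc K G c \<and> polyb (sz xs) T \<and>
        (\<forall>e s. env_ok G xs \<rho> d e s \<longrightarrow> runs c s (T e) (s(d := f' e)))"
    using PTD[OF assms(1) a] eq by (metis order_refl)
qed

text \<open>A program sees only register contents, so the same one serves under any
  reparametrisation of the environment. Loop bodies use this: they live over environments enlarged
  by an accumulator and the unread input.\<close>

lemma PT_reindex:
  assumes "PT G xs f"
  shows "PT G (map (\<lambda>x. x \<circ> \<pi>) xs) (f \<circ> \<pi>)"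
  unfolding PT_def
proof (intro allI impI)
  fix \<rho> :: "nat list" and d :: nat assume a: "length \<rho> = length (map (\<lambda>x. x \<circ> \<pi>) xs)" "\<forall>r \<in> set \<rho>. r < d"
  obtain c K T where c: "\<And>K'. K \<le> K' \<Longrightarrow> wfc K' G c" and T: "polyb (sz xs) T"
    and r: "\<And>e s. env_ok G xs \<rho> d e s \<Longrightarrow> runs c s (T e) (s(d := f e))"
    using PTD[OF assms, of \<rho> d] a by auto
  have "sz (map (\<lambda>x. x \<circ> \<pi>) xs) e = sz xs (\<pi> e)" for e by (simp add: sz_def comp_def)
  then have "polyb (sz (map (\<lambda>x. x \<circ> \<pi>) xs)) (T \<circ> \<pi>)" using T by (auto simp: polyb_def)
  moreover have "env_ok G (map (\<lambda>x. x \<circ> \<pi>) xs) \<rho> d e s \<Longrightarrow> env_ok G xs \<rho> d (\<pi> e) s" for e s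
    by (simp add: env_ok_def)
  ultimately show "\<exists>c K T. wfc K G c \<and> polyb (sz (map (\<lambda>x. x \<circ> \<pi>) xs)) T \<and>
        (\<forall>e s. env_ok G (map (\<lambda>x. x \<circ> \<pi>) xs) \<rho> d e s \<longrightarrow> runs c s (T e) (s(d := (f \<circ> \<pi>) e)))"
    using c r by (intro exI[of _ c] exI[of _ K] exI[of _ "T \<circ> \<pi>"]) auto
qed

lemma PT_weaken:
  assumes "PT G xs f" "set xs \<subseteq> set ys"
  shows "PT G ys f"
  unfolding PT_def
proof (intro allI impI)
  fix \<rho> :: "nat list" and d :: nat assume a: "length \<rho> = length ys" "\<forall>r \<in> set \<rho>. r < d"
  have "\<forall>x \<in> set xs. \<exists>i < length ys. ys ! i = x" using assms(2) by (metis in_set_conv_nth subsetD)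
  then obtain p where p: "\<And>x. x \<in> set xs \<Longrightarrow> p x < length ys \<and> ys ! p x = x" by metis
  let ?\<rho> = "map (\<lambda>x. \<rho> ! p x) xs"
  have "\<forall>r \<in> set ?\<rho>. r < d" using p a by auto
  then obtain c K T where c: "\<And>K'. K \<le> K' \<Longrightarrow> wfc K' G c" and T: "polyb (sz xs) T"
    and r: "\<And>e s. env_ok G xs ?\<rho> d e s \<Longrightarrow> runs c s (T e) (s(d := f e))"
    using PTD[OF assms(1), of ?\<rho> d] by auto
  have "sz xs e \<le> length xs * sz ys e" for e
    using assms(2)
  proof (induction xs)
    case (Cons x xs)
    have "length (x e) \<le> sz ys e" using Cons.prems unfolding sz_def
      by (intro member_le_sum_list) auto
    then show ?case using Cons by simp
  qed simp
  then have "polyb (sz ys) (sz xs)" by (rule polyb_mono[OF polyb_mult[OF polyb_const polyb_id]])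
  then have "polyb (sz ys) T" using T polyb_comp by blast
  moreover have "env_ok G ys \<rho> d e s \<Longrightarrow> env_ok G xs ?\<rho> d e s" for e s
    using p by (auto simp: env_ok_def)
  ultimately show "\<exists>c K T. wfc K G c \<and> polyb (sz ys) T \<and>
        (\<forall>e s. env_ok G ys \<rho> d e s \<longrightarrow> runs c s (T e) (s(d := f e)))"
    using c r by blast
qed

lemma PT_const:
  assumes "valid G w"
  shows "PT G xs (\<lambda>_. w)"
  unfolding PT_def
proof (intro allI impI)
  fix \<rho> :: "nat list" and d assume a: "length \<rho> = length xs" "\<forall>r \<in> set \<rho>. r < d"
  have "\<exists>c. wfc (d + 1) G c \<and> (\<forall>s. s d = [] \<longrightarrow> runs c s (length w + 1) (s(d := w)))"
    using assms
  proof (induction w)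
    case Nil
    have "runs Skip s 1 (s(d := []))" if "s d = []" for s
      using runs_Skip[of s] that by (metis fun_upd_triv)
    then show ?case by (intro exI[of _ Skip]) (simp del: fun_upd_apply)
  next
    case (Cons a w)
    then obtain c where c: "wfc (d + 1) G c" "\<And>s. s d = [] \<Longrightarrow> runs c s (length w + 1) (s(d := w))" by (auto simp del: fun_upd_apply)
    have "runs (Seq c (Push d a)) s (length (a # w) + 1) (s(d := a # w))" if "s d = []" for s
      using runs_Seq[OF c(2)[of s, OF that] runs_Push[of d a]] by simp
    then show ?case using c(1) Cons.prems by (intro exI[of _ "Seq c (Push d a)"]) (simp del: fun_upd_apply)
  qed
  then obtain c where "wfc (d + 1) G c" "\<And>s. s d = [] \<Longrightarrow> runs c s (length w + 1) (s(d := w))" by blast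
  then show "\<exists>c K T. wfc K G c \<and> polyb (sz xs) T \<and>
        (\<forall>e s. env_ok G xs \<rho> d e s \<longrightarrow> runs c s (T e) (s(d := w)))"
    by (intro exI[of _ c] exI[of _ "d + 1"] exI[of _ "\<lambda>_. length w + 1"])
      (auto simp: env_ok_def intro: polyb_const)
qed

lemma PT_var:
  assumes "x \<in> set xs"
  shows "PT G xs x"
  unfolding PT_def
proof (intro allI impI)
  fix \<rho> :: "nat list" and d :: nat assume a: "length \<rho> = length xs" "\<forall>r \<in> set \<rho>. r < d"
  obtain i where i: "i < length xs" "xs ! i = x" using assms by (metis in_set_conv_nth)
  define r where "r = \<rho> ! i"
  have r: "r < d" using i a by (simp add: r_def)
  \<comment> \<open>The second pour restores the source \<open>r\<close> and delivers the copy in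
    \<open>d\<close>, both in the original order.\<close>
  let ?c = "Seq (move G r [d + 1]) (move G (d + 1) [d, r])"
  have c: "wfc (d + 2) G ?c" using r by (auto intro!: wfc_move)
  have "runs ?c s (length (x e) * (2 * G + 9) + 2) (s(d := x e))" if ok: "env_ok G xs \<rho> d e s" for e s
  proof -
    have v: "\<And>r. valid G (s r)" and s: "s r = x e" "\<And>r. r \<ge> d \<Longrightarrow> s r = []"
      using ok i by (auto simp: env_ok_def r_def)
    let ?s1 = "s(r := [], d + 1 := rev (x e))"
    have 1: "runs (move G r [d + 1]) s (length (x e) * (G + 4) + 1) ?s1"
      using runs_move1[of G s r "d + 1"] r v[of r] s by simp
    have "(\<lambda>q. if q = d + 1 then [] else if q \<in> set [d, r] then rev (?s1 (d + 1)) @ ?s1 q else ?s1 q) = s(d := x e)"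
      using s r by (auto simp: fun_eq_iff)
    then have 2: "runs (move G (d + 1) [d, r]) ?s1 (length (x e) * (G + 5) + 1) (s(d := x e))"
      using runs_move[of G ?s1 "d + 1" "[d, r]"] r v by (simp add: s(1)[symmetric] add.commute)
    show ?thesis by (rule runs_mono[OF runs_Seq[OF 1 2]]) (simp add: algebra_simps)
  qed
  moreover have "length (x e) \<le> sz xs e" for e
    using assms unfolding sz_def by (intro member_le_sum_list) auto
  then have "polyb (sz xs) (\<lambda>e. length (x e))" by (rule polyb_mono[OF polyb_id])
  then have "polyb (sz xs) (\<lambda>e. length (x e) * (2 * G + 9) + 2)" by (intro polyb_intros)
  ultimately show "\<exists>c K T. wfc K G c \<and> polyb (sz xs) T \<and>
        (\<forall>e s. env_ok G xs \<rho> d e s \<longrightarrow> runs c s (T e) (s(d := x e)))"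
    using c by (intro exI[of _ ?c] exI[of _ "d + 2"] exI[of _ "\<lambda>e. length (x e) * (2 * G + 9) + 2"]) blast
qed

lemma env_ok_snoc:
  assumes "env_ok G xs \<rho> d e s" "length \<rho> = length xs" "\<And>r. r \<in> set \<rho> \<Longrightarrow> r < d" "valid G (f e)"
  shows "env_ok G (xs @ [f]) (\<rho> @ [d]) (d + 1) e (s(d := f e))"
  using assms by (auto simp: env_ok_def nth_append less_Suc_eq)
    (metis nat_neq_iff nth_mem)+

text \<open>The running time of \<open>f\<close> bounds the length of its value, hence the input
  size of \<open>g\<close>; polynomial bounds compose. The intermediate value occupies the free
  register \<open>d\<close> until \<open>settle\<close> overwrites it with the result.\<close>

lemma PT_let:
  assumes "PT G xs f" "PT G (xs @ [f]) g"
  shows "PT G xs g"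
  unfolding PT_def
proof (intro allI impI)
  fix \<rho> :: "nat list" and d :: nat assume a: "length \<rho> = length xs" "\<forall>r \<in> set \<rho>. r < d"
  obtain c K T where c: "\<And>K'. K \<le> K' \<Longrightarrow> wfc K' G c" and T: "polyb (sz xs) T"
    and r: "\<And>e s. env_ok G xs \<rho> d e s \<Longrightarrow> runs c s (T e) (s(d := f e))"
    using PTD[OF assms(1) a] by auto
  have "\<forall>r \<in> set (\<rho> @ [d]). r < d + 1" using a(2) by auto
  then obtain c' K' T' where c': "\<And>K''. K' \<le> K'' \<Longrightarrow> wfc K'' G c'" and T': "polyb (sz (xs @ [f])) T'"
    and r': "\<And>e s. env_ok G (xs @ [f]) (\<rho> @ [d]) (d + 1) e s \<Longrightarrow> runs c' s (T' e) (s(d + 1 := g e))"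
    using PTD[OF assms(2), of "\<rho> @ [d]" "d + 1"] a(1) by auto
  obtain k where k: "\<And>e. T' e \<le> (sz (xs @ [f]) e + 2) ^ k" using T' by (auto simp: polyb_def)
  let ?T' = "\<lambda>e. (sz xs e + T e + 2) ^ k"
  let ?U = "\<lambda>e. T e + ?T' e + (T e + ?T' e + 1) * (3 * G + 20)"
  let ?c = "Seq (Seq c c') (settle G d)"
  have "polyb (sz xs) ?U" by (intro polyb_intros T)
  moreover have "wfc (K + K' + d + 3) G ?c" using c c' by (auto intro!: wfc_settle)
  moreover have "runs ?c s (?U e) (s(d := g e))" if ok: "env_ok G xs \<rho> d e s" for e s
  proof -
    have v: "valid G (f e)" "length (f e) \<le> T e" using env_ok_result[OF ok r[OF ok]] c by blast+
    let ?s1 = "s(d := f e)"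
    let ?s2 = "?s1(d + 1 := g e)"
    have ok1: "env_ok G (xs @ [f]) (\<rho> @ [d]) (d + 1) e ?s1" using env_ok_snoc[of G xs \<rho> d e s f] ok a v by auto
    have v': "valid G (g e)" "length (g e) \<le> T' e" using env_ok_result[OF ok1 r'[OF ok1]] c' by blast+
    have "T' e \<le> (sz (xs @ [f]) e + 2) ^ k" by (rule k)
    also have "\<dots> \<le> ?T' e" by (rule power_mono) (use v in simp_all)
    finally have t: "T' e \<le> ?T' e" .
    have "?s2(d := g e, d + 1 := []) = s(d := g e)" using ok by (auto simp: env_ok_def fun_eq_iff)
    moreover have "runs (settle G d) ?s2 ((length (f e) + length (g e) + 1) * (3 * G + 20)) (?s2(d := g e, d + 1 := []))"
      using runs_settle[of G ?s2 d] ok v v' by (simp add: env_ok_def)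
    ultimately have "runs ?c s (T e + T' e + (length (f e) + length (g e) + 1) * (3 * G + 20)) (s(d := g e))"
      using runs_Seq[OF runs_Seq[OF r[OF ok] r'[OF ok1]]] by metis
    then show ?thesis
    proof (rule runs_mono)
      show "T e + T' e + (length (f e) + length (g e) + 1) * (3 * G + 20) \<le> ?U e"
        using v v' t by (intro add_mono mult_right_mono) auto
    qed
  qed
  ultimately show "\<exists>c K T. wfc K G c \<and> polyb (sz xs) T \<and>
        (\<forall>e s. env_ok G xs \<rho> d e s \<longrightarrow> runs c s (T e) (s(d := g e)))" by blast
qed

lemma PT_comp:
  assumes "PT G xs f" "\<And>x. x \<in> set xs \<Longrightarrow> PT G ys x"
  shows "PT G ys f"
proof -
  have "PT G (ys @ xs) f \<Longrightarrow> (\<And>x. x \<in> set xs \<Longrightarrow> PT G ys x) \<Longrightarrow> PT G ys f"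
  proof (induction xs rule: rev_induct)
    case (snoc x xs)
    have "PT G (ys @ xs) x" by (rule PT_weaken[of G ys]) (use snoc.prems in auto)
    then have "PT G (ys @ xs) f" by (rule PT_let) (use snoc.prems in simp)
    then show ?case using snoc by simp
  qed simp
  moreover have "PT G (ys @ xs) f" using assms(1) by (rule PT_weaken) auto
  ultimately show ?thesis using assms(2) by blast
qed

lemma PT_cons:
  assumes "PT G xs f" "0 < a" "a < G"
  shows "PT G xs (\<lambda>e. a # f e)"
  unfolding PT_def
proof (intro allI impI)
  fix \<rho> :: "nat list" and d :: nat assume l: "length \<rho> = length xs" "\<forall>r \<in> set \<rho>. r < d"
  obtain c K T where c: "\<And>K'. K \<le> K' \<Longrightarrow> wfc K' G c" and T: "polyb (sz xs) T"
    and r: "\<And>e s. env_ok G xs \<rho> d e s \<Longrightarrow> runs c s (T e) (s(d := f e))"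
    using PTD[OF assms(1) l] by auto
  have "runs (Seq c (Push d a)) s (T e + 1) (s(d := a # f e))" if "env_ok G xs \<rho> d e s" for e s
    using runs_Seq[OF r[OF that] runs_Push[of d a]] by simp
  then show "\<exists>c K T. wfc K G c \<and> polyb (sz xs) T \<and>
        (\<forall>e s. env_ok G xs \<rho> d e s \<longrightarrow> runs c s (T e) (s(d := a # f e)))"
    using c assms by (intro exI[of _ "Seq c (Push d a)"] exI[of _ "K + d + 1"] exI[of _ "\<lambda>e. T e + 1"])
      (auto intro!: polyb_Suc T)
qed

lemma PT_tl:
  assumes "PT G xs f"
  shows "PT G xs (\<lambda>e. tl (f e))"
  unfolding PT_def
proof (intro allI impI)
  fix \<rho> :: "nat list" and d :: nat assume l: "length \<rho> = length xs" "\<forall>r \<in> set \<rho>. r < d"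
  obtain c K T where c: "\<And>K'. K \<le> K' \<Longrightarrow> wfc K' G c" and T: "polyb (sz xs) T"
    and r: "\<And>e s. env_ok G xs \<rho> d e s \<Longrightarrow> runs c s (T e) (s(d := f e))"
    using PTD[OF assms(1) l] by auto
  have "runs (Seq c (Pop d)) s (T e + 1) (s(d := tl (f e)))" if "env_ok G xs \<rho> d e s" for e s
    using runs_Seq[OF r[OF that] runs_Pop[of d]] by simp
  then show "\<exists>c K T. wfc K G c \<and> polyb (sz xs) T \<and>
        (\<forall>e s. env_ok G xs \<rho> d e s \<longrightarrow> runs c s (T e) (s(d := tl (f e))))"
    using c by (intro exI[of _ "Seq c (Pop d)"] exI[of _ "K + d + 1"] exI[of _ "\<lambda>e. T e + 1"])
      (auto intro!: polyb_Suc T)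
qed

lemma PT_if_var:
  assumes "h \<in> set xs" "PT G xs f" "PT G xs g"
  shows "PT G xs (\<lambda>e. if hd0 (h e) = a then f e else g e)"
  unfolding PT_def
proof (intro allI impI)
  fix \<rho> :: "nat list" and d :: nat assume l: "length \<rho> = length xs" "\<forall>r \<in> set \<rho>. r < d"
  obtain c K T where c: "\<And>K'. K \<le> K' \<Longrightarrow> wfc K' G c" and T: "polyb (sz xs) T"
    and r: "\<And>e s. env_ok G xs \<rho> d e s \<Longrightarrow> runs c s (T e) (s(d := f e))"
    using PTD[OF assms(2) l] by auto
  obtain c' K' T' where c': "\<And>K''. K' \<le> K'' \<Longrightarrow> wfc K'' G c'" and T': "polyb (sz xs) T'"
    and r': "\<And>e s. env_ok G xs \<rho> d e s \<Longrightarrow> runs c' s (T' e) (s(d := g e))"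
    using PTD[OF assms(3) l] by auto
  obtain i where i: "i < length xs" "xs ! i = h" using assms(1) by (metis in_set_conv_nth)
  let ?c = "Test (\<rho> ! i) a c c'"
  have "runs ?c s (T e + T' e + 1) (s(d := if hd0 (h e) = a then f e else g e))" if ok: "env_ok G xs \<rho> d e s" for e s
  proof -
    have "s (\<rho> ! i) = h e" using ok i by (auto simp: env_ok_def)
    then show ?thesis using r[OF ok] r'[OF ok] by (intro runs_Test) (auto elim: runs_mono)
  qed
  moreover have "wfc (K + K' + d) G ?c" using c c' i l by (auto simp: trans_less_add2)
  moreover have "polyb (sz xs) (\<lambda>e. T e + T' e + 1)" by (intro polyb_intros T T')
  ultimately show "\<exists>c K T. wfc K G c \<and> polyb (sz xs) T \<and>
        (\<forall>e s. env_ok G xs \<rho> d e s \<longrightarrow> runs c s (T e) (s(d := if hd0 (h e) = a then f e else g e)))"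
    by blast
qed

lemma PT_if:
  assumes "PT G xs h" "PT G xs f" "PT G xs g"
  shows "PT G xs (\<lambda>e. if hd0 (h e) = a then f e else g e)"
  by (rule PT_let[OF assms(1)]) (intro PT_if_var PT_weaken[OF assms(2)] PT_weaken[OF assms(3)]; auto)

text \<open>Only finitely many letters occur, so \<open>f\<close> may depend on the scanned letter
  in any way whatsoever: its finitely many branches are chosen one by one.\<close>

lemma PT_case:
  assumes "PT G xs h" "0 < G" "\<And>a. a < G \<Longrightarrow> PT G xs (f a)"
  shows "PT G xs (\<lambda>e. f (hd0 (h e)) e)"
proof -
  have "PT G xs (\<lambda>e. if hd0 (h e) < n then f (hd0 (h e)) e else f 0 e)" if "n \<le> G" for n
    using that
  proof (induction n)
    case 0
    then show ?case using assms(3)[of 0] assms(2) by simp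
  next
    case (Suc n)
    have "PT G xs (\<lambda>e. if hd0 (h e) = n then f n e else if hd0 (h e) < n then f (hd0 (h e)) e else f 0 e)"
      using Suc by (intro PT_if assms) auto
    moreover have "(\<lambda>e. if hd0 (h e) = n then f n e else if hd0 (h e) < n then f (hd0 (h e)) e else f 0 e)
      = (\<lambda>e. if hd0 (h e) < Suc n then f (hd0 (h e)) e else f 0 e)" by (auto simp: less_Suc_eq)
    ultimately show ?case by simp
  qed
  then have 1: "PT G xs (\<lambda>e. if hd0 (h e) < G then f (hd0 (h e)) e else f 0 e)" by blast
  obtain T where T: "\<And>e. \<forall>x \<in> set xs. valid G (x e) \<Longrightarrow> valid G (h e) \<and> length (h e) \<le> T e"
    using PT_result[OF assms(1)] by blast
  show ?thesis
  proof (rule PT_cong[OF 1])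
    fix e assume "\<forall>x \<in> set xs. valid G (x e)"
    then have "valid G (h e)" using T by blast
    then have "hd0 (h e) < G" using assms(2) by (cases "h e") auto
    then show "(if hd0 (h e) < G then f (hd0 (h e)) e else f 0 e) = f (hd0 (h e)) e" by simp
  qed
qed

text \<open>\<open>A e j\<close> is the value of the accumulator after \<open>j\<close> rounds. The step only has to be
  computable on the environments that occur, which \<open>z\<close> describes.\<close>

lemma PT_fold:
  fixes A :: "'e \<Rightarrow> nat \<Rightarrow> word" and acc rest F :: "'d \<Rightarrow> word"
  assumes x: "PT G xs x" and i: "PT G xs (\<lambda>e. A e 0)"
    and step: "PT G (ys @ [acc, rest]) F" and len: "length ys = length xs"
    and rel: "\<And>e j. \<forall>x \<in> set xs. valid G (x e) \<Longrightarrow> j < length (x e) \<Longrightarrow>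
      \<exists>z. (\<forall>k < length xs. (ys ! k) z = (xs ! k) e) \<and> acc z = A e j \<and> rest z = drop j (x e) \<and> F z = A e (Suc j)"
    and B: "polyb (\<lambda>e. sz xs e + length (x e) + length (A e 0)) B"
      "\<And>e j. \<forall>x \<in> set xs. valid G (x e) \<Longrightarrow> j \<le> length (x e) \<Longrightarrow> length (A e j) \<le> B e"
  shows "PT G xs (\<lambda>e. A e (length (x e)))"
  unfolding PT_def
proof (intro allI impI)
  fix \<rho> :: "nat list" and d :: nat assume a: "length \<rho> = length xs" "\<forall>r \<in> set \<rho>. r < d"
  obtain c1 K1 T1 where c1: "\<And>K'. K1 \<le> K' \<Longrightarrow> wfc K' G c1" and T1: "polyb (sz xs) T1"
    and r1: "\<And>e s. env_ok G xs \<rho> d e s \<Longrightarrow> runs c1 s (T1 e) (s(d := x e))"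
    using PTD[OF x a] by auto
  let ?\<rho>2 = "\<rho> @ [d]"
  have a2: "length (\<rho> @ [d]) = length (xs @ [x])" "\<forall>r \<in> set ?\<rho>2. r < d + 1" using a by auto
  have "PT G (xs @ [x]) (\<lambda>e. A e 0)" using i by (rule PT_weaken) auto
  from PTD[OF this a2] obtain c2 K2 T2
    where c2: "\<And>K'. K2 \<le> K' \<Longrightarrow> wfc K' G c2" and T2: "polyb (sz (xs @ [x])) T2"
    and r2: "\<And>e s. env_ok G (xs @ [x]) ?\<rho>2 (d + 1) e s \<Longrightarrow> runs c2 s (T2 e) (s(d + 1 := A e 0))"
    by auto
  let ?\<rho>3 = "\<rho> @ [d + 1, d]"
  have a3: "length ?\<rho>3 = length (ys @ [acc, rest])" "\<forall>r \<in> set ?\<rho>3. r < d + 2" using a len by auto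
  from PTD[OF step a3] obtain c3 K3 T3
    where c3: "\<And>K'. K3 \<le> K' \<Longrightarrow> wfc K' G c3" and T3: "polyb (sz (ys @ [acc, rest])) T3"
    and r3: "\<And>z s. env_ok G (ys @ [acc, rest]) ?\<rho>3 (d + 2) z s \<Longrightarrow> runs c3 s (T3 z) (s(d + 2 := F z))"
    by auto
  obtain k2 where k2: "\<And>e. T2 e \<le> (sz (xs @ [x]) e + 2) ^ k2" using T2 by (auto simp: polyb_def)
  obtain k3 where k3: "\<And>z. T3 z \<le> (sz (ys @ [acc, rest]) z + 2) ^ k3" using T3 by (auto simp: polyb_def)
  obtain kb where kb: "\<And>e. B e \<le> (sz xs e + length (x e) + length (A e 0) + 2) ^ kb" using B(1) by (auto simp: polyb_def)
  \<comment> \<open>The bound \<open>B\<close> limits the accumulator in all rounds, so each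
    iteration obeys the same polynomial \<open>?I\<close>. Iterating a polynomial-time step without
    such a bound could produce exponential growth.\<close>
  let ?T2 = "\<lambda>e. (sz xs e + T1 e + 2) ^ k2"
  let ?B = "\<lambda>e. (sz xs e + T1 e + ?T2 e + 2) ^ kb"
  let ?T3 = "\<lambda>e. (sz xs e + ?B e + T1 e + 2) ^ k3"
  let ?I = "\<lambda>e. ?T3 e + ((?B e + ?B e + 1) * (3 * G + 20) + 1)"
  let ?W = "\<lambda>e. T1 e * (?I e + 1) + 1"
  let ?U = "\<lambda>e. T1 e + (?T2 e + (?W e + (?B e + 1) * (3 * G + 20)))"
  have U: "polyb (sz xs) ?U" by (intro polyb_intros T1)
  let ?body = "Seq c3 (Seq (settle G (d + 1)) (Pop d))"
  let ?c = "Seq c1 (Seq c2 (Seq (While d ?body) (settle G d)))"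
  let ?K = "K1 + K2 + K3 + d + 4"
  have wf: "wfc ?K G ?c" using c1 c2 c3
    by (auto intro!: wfc_settle wfc_branch wfc_push_all wfc_move)
  have "runs ?c s (?U e) (s(d := A e (length (x e))))" if ok: "env_ok G xs \<rho> d e s" for e s
  proof -
    have sv: "\<And>r. valid G (s r)" and sd: "\<And>r. d \<le> r \<Longrightarrow> s r = []" and sx: "\<And>i. i < length xs \<Longrightarrow> s (\<rho> ! i) = (xs ! i) e"
      using ok by (auto simp: env_ok_def)
    have vxs: "\<forall>y \<in> set xs. valid G (y e)"
      using sv sx by (metis in_set_conv_nth)
    have vx: "valid G (x e)" "length (x e) \<le> T1 e" using env_ok_result[OF ok r1[OF ok]] c1 by blast+
    let ?s1 = "s(d := x e)"
    have ok1: "env_ok G (xs @ [x]) ?\<rho>2 (d + 1) e ?s1" using env_ok_snoc[of G xs \<rho> d e s x] ok a vx by auto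
    have v0: "valid G (A e 0)" "length (A e 0) \<le> T2 e" using env_ok_result[OF ok1 r2[OF ok1]] c2 by blast+
    have "T2 e \<le> (sz (xs @ [x]) e + 2) ^ k2" by (rule k2)
    also have "\<dots> \<le> ?T2 e" by (rule power_mono) (use vx in simp_all)
    finally have t2: "T2 e \<le> ?T2 e" .
    have "B e \<le> (sz xs e + length (x e) + length (A e 0) + 2) ^ kb" by (rule kb)
    also have "\<dots> \<le> ?B e"
      by (rule power_mono) (use vx v0 t2 in simp_all)
    finally have b: "B e \<le> ?B e" .
    have bA: "length (A e j) \<le> ?B e" if "j \<le> length (x e)" for j using B(2)[of e j, OF vxs that] b by linarith
    define st where "st j = s(d := drop j (x e), d + 1 := A e j)" for j
    have it: "runs ?body (st j) (?I e) (st (Suc j)) \<and> valid G (A e (Suc j))"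
      if j: "j < length (x e)" and vj: "valid G (A e j)" for j
    proof -
      obtain z where z: "\<And>k. k < length xs \<Longrightarrow> (ys ! k) z = (xs ! k) e" "acc z = A e j"
        "rest z = drop j (x e)" "F z = A e (Suc j)" using rel[of e j, OF vxs j] by blast
      have "valid G (drop j (x e))"
        using vx(1) by (auto simp: valid_def dest: in_set_dropD)
      then have vst: "valid G (st j r)" for r using sv vj by (simp add: st_def)
      have okz: "env_ok G (ys @ [acc, rest]) ?\<rho>3 (d + 2) z (st j)"
        unfolding env_ok_def
      proof (intro conjI allI impI)
        show "valid G (st j r)" for r by (rule vst)
        show "st j (?\<rho>3 ! i) = ((ys @ [acc, rest]) ! i) z" if i: "i < length (ys @ [acc, rest])" for i
        proof -
          consider "i < length xs" | "i = length xs" | "i = length xs + 1" using i len by fastforce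
          then show ?thesis
          proof cases
            case 1
            then have "\<rho> ! i < d" using a by auto
            then have "\<rho> ! i \<noteq> d" "\<rho> ! i \<noteq> Suc d" by simp_all
            then show ?thesis using 1 z sx a len by (simp add: nth_append st_def)
          qed (use z a len in \<open>simp_all add: nth_append st_def\<close>)
        qed
        show "st j r = []" if "d + 2 \<le> r" for r using that sd by (simp add: st_def)
      qed
      let ?t2 = "(st j)(d + 2 := A e (Suc j))"
      have 1: "runs c3 (st j) (T3 z) ?t2" using r3[OF okz] z by simp
      have vF: "valid G (A e (Suc j))" using env_ok_result(1)[OF okz r3[OF okz]] c3 z by auto
      have "sz ys z = sz xs e" unfolding sz_def using z(1) len
        by (intro arg_cong[of _ _ sum_list]) (auto intro!: nth_equalityI)
      then have "T3 z \<le> (sz xs e + (length (A e j) + length (drop j (x e))) + 2) ^ k3" using k3[of z] z by simp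
      also have "\<dots> \<le> ?T3 e" by (rule power_mono) (use bA[of j] vx j in simp_all)
      finally have t3: "T3 z \<le> ?T3 e" .
      let ?t3 = "?t2(d + 1 := A e (Suc j), d + 2 := [])"
      have 2: "runs (settle G (d + 1)) ?t2 ((length (A e j) + length (A e (Suc j)) + 1) * (3 * G + 20)) ?t3"
        using runs_settle[of G ?t2 "d + 1"] vst vF sd by (simp add: st_def)
      have eq: "?t3(d := tl (?t3 d)) = st (Suc j)"
        using sd by (auto simp: st_def fun_eq_iff drop_Suc tl_drop)
      have 3: "runs (Pop d) ?t3 1 (st (Suc j))" using runs_Pop[of d ?t3] eq by simp
      have "runs ?body (st j) (T3 z + ((length (A e j) + length (A e (Suc j)) + 1) * (3 * G + 20) + 1)) (st (Suc j))"
        by (intro runs_Seq[OF 1] runs_Seq[OF 2] 3)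
      then have "runs ?body (st j) (?I e) (st (Suc j))"
        by (rule runs_mono) (use t3 bA[of j] bA[of "Suc j"] j in \<open>intro add_mono mult_right_mono; simp\<close>)
      then show ?thesis using vF by blast
    qed
    have vA: "valid G (A e j)" if "j \<le> length (x e)" for j
      using that by (induction j) (use v0 it in auto)
    have loop: "n \<le> length (x e) \<Longrightarrow> runs (While d ?body) (st (length (x e) - n)) (n * (?I e + 1) + 1) (st (length (x e)))" for n
    proof (induction n)
      case 0
      have "st (length (x e)) d = []" by (simp add: st_def)
      then show ?case using runs_WhileF by simp
    next
      case (Suc n)
      let ?j = "length (x e) - Suc n"
      have j: "?j < length (x e)" "Suc ?j = length (x e) - n" using Suc.prems by auto
      have "runs ?body (st ?j) (?I e) (st (length (x e) - n))" using it[OF j(1) vA] j by auto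
      moreover have "st ?j d \<noteq> []" using j by (simp add: st_def)
      ultimately have "runs (While d ?body) (st ?j) (?I e + (n * (?I e + 1) + 1) + 1) (st (length (x e)))"
        using Suc by (intro runs_WhileT) auto
      then show ?case by (rule runs_mono) simp
    qed
    have "st 0 = ?s1(d + 1 := A e 0)" by (simp add: st_def)
    then have R2: "runs c2 ?s1 (?T2 e) (st 0)" using r2[OF ok1] t2 by (auto elim: runs_mono)
    have "runs (While d ?body) (st 0) (length (x e) * (?I e + 1) + 1) (st (length (x e)))"
      using loop[of "length (x e)"] by simp
    then have R3: "runs (While d ?body) (st 0) (?W e) (st (length (x e)))"
      by (rule runs_mono) (intro add_mono mult_right_mono vx order_refl; simp)
    let ?n = "length (x e)"
    have "(st ?n)(d := st ?n (d + 1), d + 1 := []) = s(d := A e ?n)"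
      using sd by (auto simp: st_def fun_eq_iff)
    moreover have "\<And>r. valid G (st ?n r)" using sv vA by (simp add: st_def)
    ultimately have "runs (settle G d) (st ?n) ((length (A e ?n) + 1) * (3 * G + 20)) (s(d := A e ?n))"
      using runs_settle[of G "st ?n" d] sd by (simp add: st_def)
    then have R4: "runs (settle G d) (st ?n) ((?B e + 1) * (3 * G + 20)) (s(d := A e ?n))"
      by (rule runs_mono) (use bA[of ?n] in \<open>intro mult_right_mono; simp\<close>)
    show ?thesis
      by (intro runs_Seq[OF r1[OF ok]] runs_Seq[OF R2] runs_Seq[OF R3] R4)
  qed
  with wf U show "\<exists>c K T. wfc K G c \<and> polyb (sz xs) T \<and>
        (\<forall>e s. env_ok G xs \<rho> d e s \<longrightarrow> runs c s (T e) (s(d := A e (length (x e)))))"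
    by blast
qed

lemma PT_lift: "PT G xs h \<Longrightarrow> PT G (map (\<lambda>y z. y (fst z)) xs @ ys) (\<lambda>z. h (fst z))"
  by (rule PT_weaken[OF PT_reindex[of G xs h fst, unfolded comp_def]]) auto

lemma PT_acc: "PT G (ys @ [\<lambda>z. fst (snd z), \<lambda>z. snd (snd z)]) (\<lambda>z. fst (snd z))"
  and PT_rest: "PT G (ys @ [\<lambda>z. fst (snd z), \<lambda>z. snd (snd z)]) (\<lambda>z. snd (snd z))"
  by (rule PT_var, simp)+

text \<open>Growth by at most \<open>K\<close> letters per round keeps the accumulator linear, which
  discharges the size condition of \<open>PT_fold\<close>. The letter being processed is the head of
  the unread input.\<close>

lemma PT_foldl:
  assumes x: "PT G xs x" and i: "PT G xs i"
    and step: "PT G (map (\<lambda>y z. y (fst z)) xs @ [\<lambda>z. fst (snd z), \<lambda>z. snd (snd z)])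
      (\<lambda>z. F (fst z) (hd0 (snd (snd z))) (fst (snd z)))"
    and B: "\<And>e a c. length (F e a c) \<le> length c + K"
  shows "PT G xs (\<lambda>e. fold (F e) (x e) (i e))"
proof -
  let ?A = "\<lambda>e j. fold (F e) (take j (x e)) (i e)"
  have len: "length (?A e j) \<le> length (i e) + K * j" if "j \<le> length (x e)" for e j
    using that
  proof (induction j)
    case (Suc j)
    then show ?case using B[of e "x e ! j" "?A e j"] by (simp add: take_Suc_conv_app_nth)
  qed simp
  have "PT G xs (\<lambda>e. ?A e (length (x e)))"
  proof (rule PT_fold[OF x _ step])
    show "PT G xs (\<lambda>e. ?A e 0)" using i by simp
    show "\<exists>z. (\<forall>k<length xs. (map (\<lambda>y z. y (fst z)) xs ! k) z = (xs ! k) e) \<and>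
            fst (snd z) = ?A e j \<and> snd (snd z) = drop j (x e) \<and>
            F (fst z) (hd0 (snd (snd z))) (fst (snd z)) = ?A e (Suc j)" if "j < length (x e)" for e j
      using that by (intro exI[of _ "(e, ?A e j, drop j (x e))"])
        (simp add: take_Suc_conv_app_nth Cons_nth_drop_Suc[symmetric])
    show "polyb (\<lambda>e. sz xs e + length (x e) + length (?A e 0)) (\<lambda>e. length (i e) + K * length (x e))"
      by (rule polyb_mono[of _ "\<lambda>e. (sz xs e + length (x e) + length (?A e 0)) + K * (sz xs e + length (x e) + length (?A e 0))"])
        (intro polyb_intros, simp add: algebra_simps)
    show "length (?A e j) \<le> length (i e) + K * length (x e)" if "j \<le> length (x e)" for e j
      using len[OF that] that by (meson add_left_mono mult_le_mono2 order_trans)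
  qed simp
  then show ?thesis by simp
qed

text \<open>The general form of a one-pass rewriting with lookahead: the output at a position may
  depend on the entire rest of the word. All homomorphic translations below are instances.\<close>

primrec sfx :: "(word \<Rightarrow> word) \<Rightarrow> word \<Rightarrow> word" where
  "sfx g [] = []"
| "sfx g (a # w) = g (a # w) @ sfx g w"

lemma sfx_conv_concat: "sfx g w = concat (map (\<lambda>i. g (drop i w)) [0..<length w])"
proof (induction w)
  case (Cons a w)
  have "[0..<length (a # w)] = 0 # map Suc [0..<length w]" by (simp add: upt_conv_Cons map_Suc_upt del: upt_Suc)
  then show ?case using Cons by (simp add: comp_def)
qed simp

section \<open>Word operations as polynomial-time combinators\<close>

context
  fixes G :: nat
  assumes G: "0 < G"
begin

lemma PT_cons_hd:
  assumes "PT G xs l" "PT G xs h"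
  shows "PT G xs (\<lambda>e. if hd0 (l e) = 0 then h e else hd0 (l e) # h e)"
proof (rule PT_case[OF assms(1) G])
  fix a assume "a < G"
  then show "PT G xs (\<lambda>e. if a = 0 then h e else a # h e)"
    using PT_cons[OF assms(2), of a] assms(2) by (cases "a = 0") auto
qed

text \<open>The folds below must assign some value to the letter 0, which cannot be pushed. Register
  contents are valid words without 0, so it is enough to check the intended equation on
  those.\<close>

lemma PT_valid_cong:
  assumes "PT G xs (\<lambda>e. F (f e) e)" "PT G xs f" "\<And>e. valid G (f e) \<Longrightarrow> F (f e) e = h e"
  shows "PT G xs h"
proof (rule PT_result[OF assms(2)])
  fix T assume T: "\<And>e. \<forall>x \<in> set xs. valid G (x e) \<Longrightarrow> valid G (f e) \<and> length (f e) \<le> T e"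
  show ?thesis
  proof (rule PT_cong[OF assms(1)])
    show "F (f e) e = h e" if "\<forall>x \<in> set xs. valid G (x e)" for e
      using T[of e] that assms(3) by blast
  qed
qed

lemma PT_rev:
  assumes "PT G xs f"
  shows "PT G xs (\<lambda>e. rev (f e))"
proof -
  let ?F = "\<lambda>a c. if a = 0 then c else a # c"
  have 1: "PT G xs (\<lambda>e. fold ?F (f e) [])"
    by (rule PT_foldl[OF assms, where K = 1]) (simp_all add: PT_const PT_cons_hd PT_acc PT_rest)
  have "fold ?F w c = rev w @ c" if "valid G w" for w c
    using that by (induction w arbitrary: c) auto
  then show ?thesis by (intro PT_valid_cong[where F = "\<lambda>w e. fold ?F w []", OF 1 assms]) simp
qed

lemma PT_append:
  assumes "PT G xs f" "PT G xs g"
  shows "PT G xs (\<lambda>e. f e @ g e)"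
proof -
  let ?F = "\<lambda>a c. if a = 0 then c else a # c"
  have 1: "PT G xs (\<lambda>e. fold ?F (rev (f e)) (g e))"
    by (rule PT_foldl[OF PT_rev[OF assms(1)] assms(2), where K = 1]) (simp_all add: PT_cons_hd PT_acc PT_rest)
  have "fold ?F (rev w) c = w @ c" if "valid G w" for w c
    using that unfolding foldr_conv_fold[symmetric] by (induction w) auto
  then show ?thesis
    by (intro PT_valid_cong[where F = "\<lambda>w e. fold ?F (rev w) (g e)", OF 1 assms(1)]) simp
qed

lemma PT_foldr:
  assumes "PT G xs x" "PT G xs i"
    "PT G (map (\<lambda>y z. y (fst z)) xs @ [\<lambda>z. fst (snd z), \<lambda>z. snd (snd z)])
      (\<lambda>z. F (fst z) (hd0 (snd (snd z))) (fst (snd z)))"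
    "\<And>e a c. length (F e a c) \<le> length c + K"
  shows "PT G xs (\<lambda>e. foldr (F e) (x e) (i e))"
  using PT_foldl[OF PT_rev[OF assms(1)] assms(2-4)] by (simp add: foldr_conv_fold)

lemma PT_takeWhile:
  assumes "PT G xs x"
  shows "PT G xs (\<lambda>e. takeWhile P (x e))"
proof -
  let ?F = "\<lambda>a c. if P a then if a = 0 then c else a # c else []"
  have 1: "PT G xs (\<lambda>e. foldr ?F (x e) [])"
  proof (rule PT_foldr[OF assms, where K = 1])
    let ?ys = "map (\<lambda>y z. y (fst z)) xs @ [\<lambda>z. fst (snd z), \<lambda>z. snd (snd z)]"
    have "PT G ?ys (\<lambda>z. (\<lambda>a z. if P a then if hd0 (snd (snd z)) = 0 then fst (snd z) else hd0 (snd (snd z)) # fst (snd z)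
        else []) (hd0 (snd (snd z))) z)"
    proof (rule PT_case[where f = "\<lambda>a z. if P a then if hd0 (snd (snd z)) = 0 then fst (snd z) else hd0 (snd (snd z)) # fst (snd z) else []"])
      fix a
      show "PT G ?ys (\<lambda>z. if P a then if hd0 (snd (snd z)) = 0 then fst (snd z) else hd0 (snd (snd z)) # fst (snd z) else [])"
        by (cases "P a") (simp_all add: PT_const PT_cons_hd PT_acc PT_rest)
    qed (rule PT_rest G)+
    then show "PT G ?ys (\<lambda>z. ?F (hd0 (snd (snd z))) (fst (snd z)))" by simp
  qed (simp_all add: PT_const)
  have "foldr ?F w [] = takeWhile P w" if "valid G w" for w
    using that by (induction w) auto
  then show ?thesis by (intro PT_valid_cong[where F = "\<lambda>w e. foldr ?F w []", OF 1 assms]) simp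
qed

text \<open>Words serve as unary counters: a letter of \<open>x\<close> removes one letter of
  \<open>y\<close>. All length comparisons below are of this kind, so no arithmetic on numbers has
  to be programmed.\<close>

lemma PT_drop_length:
  assumes "PT G xs x" "PT G xs y"
  shows "PT G xs (\<lambda>e. drop (length (x e)) (y e))"
proof -
  have "PT G xs (\<lambda>e. fold (\<lambda>_ c. tl c) (x e) (y e))"
    by (rule PT_foldl[OF assms, where K = 0]) (simp_all add: PT_tl PT_acc)
  moreover have "fold (\<lambda>_ c. tl c) w v = drop (length w) v" for w v :: word
    by (induction w arbitrary: v) (auto simp: drop_Suc)
  ultimately show ?thesis by simp
qed

lemma PT_dropWhile:
  assumes "PT G xs x"
  shows "PT G xs (\<lambda>e. dropWhile P (x e))"
  using PT_drop_length[OF PT_takeWhile[OF assms] assms] by (simp add: dropWhile_eq_drop)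

lemma PT_take_diff:
  assumes "PT G xs x" "PT G xs y"
  shows "PT G xs (\<lambda>e. take (length (y e) - length (x e)) (y e))"
  using PT_rev[OF PT_drop_length[OF assms(1) PT_rev[OF assms(2)]]] by (simp add: rev_drop)

text \<open>There are as many suffixes as letters and \<open>g\<close> is polynomially bounded on
  each of them, so the concatenated output satisfies the bound that \<open>PT_fold\<close> asks
  for.\<close>

lemma PT_sfx:
  assumes w: "PT G xs w" and g: "PT G (map (\<lambda>y z. y (fst z)) xs @ [snd]) (\<lambda>z. g (fst z) (snd z))"
  shows "PT G xs (\<lambda>e. sfx (g e) (w e))"
proof -
  let ?A = "\<lambda>e j. concat (map (\<lambda>i. g e (drop i (w e))) [0..<j])"
  obtain Tg where Tg: "polyb (sz (map (\<lambda>y z. y (fst z)) xs @ [snd])) Tg"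
    "\<And>z. \<forall>x \<in> set (map (\<lambda>y z. y (fst z)) xs @ [snd]). valid G (x z) \<Longrightarrow> length (g (fst z) (snd z)) \<le> Tg z"
    by (rule PT_result[OF g]) blast
  obtain Tw where Tw: "\<And>e. \<forall>x \<in> set xs. valid G (x e) \<Longrightarrow> valid G (w e) \<and> length (w e) \<le> Tw e"
    using PT_result[OF w] by blast
  obtain k where k: "\<And>z. Tg z \<le> (sz (map (\<lambda>y z. y (fst z)) xs @ [snd]) z + 2) ^ k"
    using Tg(1) unfolding polyb_def by blast
  have sz_fst: "sz (map (\<lambda>y z. y (fst z)) xs) z = sz xs (fst z)" for z :: "'a \<times> word"
    by (simp add: sz_def comp_def)
  let ?ys = "map (\<lambda>y z. y (fst z)) xs :: ('a \<times> word \<times> word \<Rightarrow> word) list"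
  have "PT G (?ys @ [\<lambda>z. snd (snd z)]) (\<lambda>z. g (fst z) (snd (snd z)))"
    using PT_reindex[OF g, of "\<lambda>z. (fst z, snd (snd z))"] by (simp add: comp_def)
  then have g': "PT G (?ys @ [\<lambda>z. fst (snd z), \<lambda>z. snd (snd z)]) (\<lambda>z. g (fst z) (snd (snd z)))"
    by (rule PT_weaken) auto
  have "PT G xs (\<lambda>e. ?A e (length (w e)))"
  proof (rule PT_fold[OF w])
    show "PT G xs (\<lambda>e. ?A e 0)" by (simp add: PT_const)
    show "PT G (?ys @ [\<lambda>z. fst (snd z), \<lambda>z. snd (snd z)]) (\<lambda>z. fst (snd z) @ g (fst z) (snd (snd z)))"
      by (rule PT_append[OF _ g']) (rule PT_acc)
    show "\<exists>z. (\<forall>k<length xs. (?ys ! k) z = (xs ! k) e) \<and> fst (snd z) = ?A e j \<and> snd (snd z) = drop j (w e) \<and>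
            fst (snd z) @ g (fst z) (snd (snd z)) = ?A e (Suc j)" for e j
      by (intro exI[of _ "(e, ?A e j, drop j (w e))"]) simp
    let ?B = "\<lambda>e. length (w e) * (sz xs e + length (w e) + 2) ^ k"
    show "polyb (\<lambda>e. sz xs e + length (w e) + length (?A e 0)) ?B"
      by (rule polyb_mono[of _ "\<lambda>e. (sz xs e + length (w e) + length (?A e 0)) * ((sz xs e + length (w e) + length (?A e 0)) + 2) ^ k"])
        (intro polyb_intros, simp)
    show "length (?A e j) \<le> ?B e" if v: "\<forall>x \<in> set xs. valid G (x e)" and j: "j \<le> length (w e)" for e j
    proof -
      have "length (g e (drop i (w e))) \<le> (sz xs e + length (w e) + 2) ^ k" for i
      proof -
        have "valid G (drop i (w e))" using Tw[of e] v by (auto simp: valid_def dest: in_set_dropD)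
        then have "length (g e (drop i (w e))) \<le> Tg (e, drop i (w e))"
          using Tg(2)[of "(e, drop i (w e))"] v by auto
        also have "\<dots> \<le> (sz xs e + length (drop i (w e)) + 2) ^ k"
          using k[of "(e, drop i (w e))"] by (simp add: sz_fst)
        also have "\<dots> \<le> (sz xs e + length (w e) + 2) ^ k" by (rule power_mono) auto
        finally show ?thesis .
      qed
      then have "length (?A e j) \<le> j * (sz xs e + length (w e) + 2) ^ k"
        by (induction j) (auto simp: add_mono add.commute)
      also have "\<dots> \<le> ?B e" using j by (rule mult_right_mono) simp
      finally show ?thesis .
    qed
  qed simp
  then show ?thesis by (simp add: sfx_conv_concat)
qed

end

lemma poly_power_bound: "poly ([:2, 1:] ^ k) n = (n + 2) ^ k" for n :: nat
  by (simp add: poly_power add.commute)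

lemma polytimeI:
  fixes enc :: "'x \<Rightarrow> word"
  assumes P: "PT G [enc] (\<lambda>x. enc' (f x))" and v: "\<And>x. valid G (enc x)" and G: "0 < G"
  shows "polytime enc enc' f"
proof -
  obtain c K T where c: "\<And>K'. K \<le> K' \<Longrightarrow> wfc K' G c" and T: "polyb (sz [enc]) T"
    and r: "\<And>x s. env_ok G [enc] [0] 1 x s \<Longrightarrow> runs c s (T x) (s(1 := enc' (f x)))"
    using PTD[OF P, of "[0]" 1] by auto
  \<comment> \<open>The input is on tape 0, where the output is expected too; \<open>settle\<close>
    moves the result there from register 1.\<close>
  let ?c = "Seq c (settle G 0)" and ?K = "K + 3"
  let ?M = "mach ?K G ?c"
  let ?U = "\<lambda>x. 2 * (T x + (sz [enc] x + T x + 1) * (3 * G + 20))"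
  have "polyb (sz [enc]) ?U" by (intro polyb_intros T)
  then obtain k where k: "\<And>x. ?U x \<le> (sz [enc] x + 2) ^ k" by (auto simp: polyb_def)
  have wfc: "wfc ?K G ?c" using c by (auto intro: wfc_settle)
  have wf: "tm_wf ?M"
    unfolding tm_wf_def
  proof (intro conjI allI impI)
    fix q ss assume "q < num_states ?M" "length ss = num_tapes ?M \<and> set ss \<subseteq> {..<num_symbols ?M}"
    then show "case transition ?M q ss of (q', acts) \<Rightarrow> q' \<le> num_states ?M \<and> length acts = num_tapes ?M \<and>
           (\<forall>(a, d) \<in> set acts. a < num_symbols ?M \<and> d \<in> {-1, 0, 1})"
      using del_wf[OF wfc, of q ss] by (auto simp: mach_def simp del: del.simps nst.simps)
  qed (use G in \<open>auto simp: mach_def\<close>)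
  have main: "\<exists>t \<le> poly ([:2, 1:] ^ k) (length (enc x)). let C = (tm_step ?M ^^ t) (tm_init ?M (enc x))
      in num_states ?M \<le> fst C \<and> tm_output C (enc' (f x))" for x
  proof -
    let ?s = "\<lambda>r::nat. if r = 0 then enc x else []"
    let ?y = "enc' (f x)"
    have ok: "env_ok G [enc] [0] 1 x ?s" using v by (auto simp: env_ok_def)
    have vy: "valid G ?y" "length ?y \<le> T x" using env_ok_result[OF ok r[OF ok] c[OF order_refl]] by auto
    let ?s' = "?s(1 := ?y, 0 := ?y, 0 + 1 := [])"
    have "runs (settle G 0) (?s(1 := ?y)) ((length (enc x) + length ?y + 1) * (3 * G + 20)) ?s'"
      using runs_settle[of G "?s(1 := ?y)" 0] v vy by simp
    from runs_Seq[OF r[OF ok] this]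
    have "runs ?c ?s (T x + (length (enc x) + length ?y + 1) * (3 * G + 20)) ?s'" .
    then obtain t where t: "t \<le> T x + (length (enc x) + length ?y + 1) * (3 * G + 20)" "big ?c ?s t ?s'"
      unfolding runs_def by blast
    have vs: "\<And>r. valid G (?s r)" using v by simp
    have tp: "tapes ?K (snd (tm_init ?M (enc x))) ?s"
      by (auto simp: tapes_def tm_init_def mach_def nth_Cons' stack_tape_def word_tape_def)
    obtain j Ts' where j: "j \<le> 2 * t" "((0, snd (tm_init ?M (enc x))), (nst ?c, Ts')) \<in> run1 (del ?c) (nst ?c) ^^ j"
      and ts: "tapes ?K Ts' ?s'"
      using compile_correct[OF t(2) wfc vs tp] by blast
    have st: "(tm_step ?M ^^ j) (tm_init ?M (enc x)) = (nst ?c, Ts')"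
      using run1_tm_step[OF j(2)] by (simp add: tm_init_def del: nst.simps)
    have "stack_tape (Ts' ! 0) (?s' 0)" using ts[unfolded tapes_def, THEN conjunct2, rule_format, of 0] by simp
    moreover have "length Ts' = ?K" using ts unfolding tapes_def by (rule conjunct1)
    then have "hd Ts' = Ts' ! 0" by (cases Ts') simp_all
    moreover have "?s' 0 = ?y" by simp
    ultimately have "stack_tape (hd Ts') ?y" by (simp only:)
    then have "tm_output (nst ?c, Ts') ?y" using vy(1)
      by (auto simp: tm_output_def stack_tape_def valid_def)
    moreover have "j \<le> poly ([:2, 1:] ^ k) (length (enc x))"
    proof -
      have "(length (enc x) + length ?y + 1) * (3 * G + 20) \<le> (length (enc x) + T x + 1) * (3 * G + 20)"
        by (rule mult_right_mono) (use vy in simp_all)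
      then have "j \<le> 2 * (T x + (length (enc x) + T x + 1) * (3 * G + 20))"
        by (intro order_trans[OF j(1)] mult_le_mono2 order_trans[OF t(1)] add_left_mono)
      then have "j \<le> ?U x" by simp
      also have "\<dots> \<le> poly ([:2, 1:] ^ k) (length (enc x))" using k[of x] by (simp only: poly_power_bound) simp
      finally show ?thesis .
    qed
    moreover have "num_states ?M = nst ?c" by (simp add: mach_def)
    ultimately show ?thesis using st by (intro exI[of _ j]) (simp only: Let_def fst_conv order_refl simp_thms)
  qed
  have "set (enc x) \<subseteq> {1..<num_symbols ?M}" for x
    using v[of x] by (auto simp: valid_def mach_def Suc_le_eq)
  then show ?thesis unfolding polytime_def using wf main by blast
qed

section \<open>Tabular logics with interpolation are homogeneous\<close>

lemma ml_sat_pmorphism: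
  assumes fwd: "\<And>x y. x \<in> X \<Longrightarrow> (x, y) \<in> R \<Longrightarrow> y \<in> X \<and> (f x, f y) \<in> R'"
    and bwd: "\<And>x z. x \<in> X \<Longrightarrow> (f x, z) \<in> R' \<Longrightarrow> \<exists>y. (x, y) \<in> R \<and> f y = z"
    and val: "\<And>p x. x \<in> X \<Longrightarrow> p \<in> S \<Longrightarrow> x \<in> U p \<longleftrightarrow> f x \<in> V p"
  shows "x \<in> X \<Longrightarrow> ml_sig \<phi> \<subseteq> S \<Longrightarrow> ml_sat R U x \<phi> \<longleftrightarrow> ml_sat R' V (f x) \<phi>"
proof (induction \<phi> arbitrary: x)
  case (MBox \<phi>)
  show ?case
  proof
    assume l: "ml_sat R U x (MBox \<phi>)"
    show "ml_sat R' V (f x) (MBox \<phi>)" unfolding ml_sat.simps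
    proof (intro allI impI)
      fix z assume "(f x, z) \<in> R'"
      then obtain y where "(x, y) \<in> R" "f y = z" using bwd MBox.prems by blast
      then show "ml_sat R' V z \<phi>" using l MBox.IH[of y] MBox.prems fwd by auto
    qed
  next
    assume r: "ml_sat R' V (f x) (MBox \<phi>)"
    show "ml_sat R U x (MBox \<phi>)" unfolding ml_sat.simps
    proof (intro allI impI)
      fix y assume "(x, y) \<in> R"
      then show "ml_sat R U y \<phi>" using r MBox.IH[of y] MBox.prems fwd by auto
    qed
  qed
qed (use val in auto)

lemma ml_sat_cong:
  assumes "\<And>p. p \<in> ml_sig \<phi> \<Longrightarrow> U p = V p"
  shows "ml_sat R U x \<phi> \<longleftrightarrow> ml_sat R V x \<phi>"
  using ml_sat_pmorphism[of UNIV R "\<lambda>x. x" R "ml_sig \<phi>" U V x \<phi>] assms by auto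

lemma ml_sat_subst: "ml_sat R V x (ml_subst s \<phi>) \<longleftrightarrow> ml_sat R (\<lambda>p. {y. ml_sat R V y (s p)}) x \<phi>"
  by (induction \<phi> arbitrary: x) auto

type_synonym model = "(nat \<Rightarrow> nat set) \<times> nat"

definition msat :: "(nat \<times> nat) set \<Rightarrow> model \<Rightarrow> nat ml \<Rightarrow> bool" where
  "msat R m \<phi> \<longleftrightarrow> ml_sat R (fst m) (snd m) \<phi>"

lemma msat_simps [simp]:
  "msat R m MTop" "msat R m (MNeg \<phi>) \<longleftrightarrow> \<not> msat R m \<phi>"
  "msat R m (MAnd \<phi> \<psi>) \<longleftrightarrow> msat R m \<phi> \<and> msat R m \<psi>"
  by (simp_all add: msat_def)

lemma separate_conj:
  assumes "finite N" "\<And>m. m \<in> N \<Longrightarrow> \<exists>\<phi>. ml_sig \<phi> \<subseteq> \<sigma> \<and> msat R t \<phi> \<and> \<not> msat R m \<phi>"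
  shows "\<exists>\<phi>. ml_sig \<phi> \<subseteq> \<sigma> \<and> msat R t \<phi> \<and> (\<forall>m \<in> N. \<not> msat R m \<phi>)"
  using assms
proof (induction N)
  case empty
  then show ?case by (intro exI[of _ MTop]) simp
next
  case (insert m N)
  then obtain \<phi> where 1: "ml_sig \<phi> \<subseteq> \<sigma>" "msat R t \<phi>" "\<forall>m \<in> N. \<not> msat R m \<phi>" by auto
  obtain \<psi> where 2: "ml_sig \<psi> \<subseteq> \<sigma>" "msat R t \<psi>" "\<not> msat R m \<psi>" using insert.prems by blast
  show ?case using 1 2 by (intro exI[of _ "MAnd \<phi> \<psi>"]) auto
qed

text \<open>Combined with \<open>separate_conj\<close>, separation of single models from each other
  yields one formula, a disjunction of conjunctions, that separates two finite sets of
  models.\<close>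

lemma separate_disj:
  assumes "finite M" "\<And>m. m \<in> M \<Longrightarrow> \<exists>\<phi>. ml_sig \<phi> \<subseteq> \<sigma> \<and> msat R m \<phi> \<and> (\<forall>n \<in> N. \<not> msat R n \<phi>)"
  shows "\<exists>\<phi>. ml_sig \<phi> \<subseteq> \<sigma> \<and> (\<forall>m \<in> M. msat R m \<phi>) \<and> (\<forall>n \<in> N. \<not> msat R n \<phi>)"
  using assms
proof (induction M)
  case empty
  then show ?case by (intro exI[of _ "MNeg MTop"]) simp
next
  case (insert m M)
  then obtain \<phi> where 1: "ml_sig \<phi> \<subseteq> \<sigma>" "\<forall>m \<in> M. msat R m \<phi>" "\<forall>m \<in> N. \<not> msat R m \<phi>" by auto
  obtain \<psi> where 2: "ml_sig \<psi> \<subseteq> \<sigma>" "msat R m \<psi>" "\<forall>m \<in> N. \<not> msat R m \<psi>" using insert.prems by blast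
  show ?case using 1 2 by (intro exI[of _ "MNeg (MAnd (MNeg \<phi>) (MNeg \<psi>))"]) auto
qed

definition teq :: "(nat \<times> nat) set \<Rightarrow> nat set \<Rightarrow> model \<Rightarrow> model \<Rightarrow> bool" where
  "teq R \<sigma> m n \<longleftrightarrow> (\<forall>\<phi>. ml_sig \<phi> \<subseteq> \<sigma> \<longrightarrow> (msat R m \<phi> \<longleftrightarrow> msat R n \<phi>))"

lemma teq_sym: "teq R \<sigma> m n \<Longrightarrow> teq R \<sigma> n m"
  by (auto simp: teq_def)

lemma not_teq: "\<not> teq R \<sigma> m n \<Longrightarrow> \<exists>\<phi>. ml_sig \<phi> \<subseteq> \<sigma> \<and> msat R m \<phi> \<and> \<not> msat R n \<phi>"
  unfolding teq_def by (metis ml.set(3) msat_simps(2))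

text \<open>The Hennessy-Milner argument. If \<open>y\<close> were distinguished from each of the
  finitely many successors of \<open>w\<close>, a conjunction \<phi> of the distinguishing formulas
  would make \<open>MBox (MNeg \<phi>)\<close> true at \<open>w\<close> and false at
  \<open>x\<close>.\<close>

lemma teq_zig:
  assumes t: "teq R \<sigma> (U, x) (V, w)" and xy: "(x, y) \<in> R" and fin: "finite R"
  shows "\<exists>v. (w, v) \<in> R \<and> teq R \<sigma> (U, y) (V, v)"
proof (rule ccontr)
  assume neg: "\<not> ?thesis"
  have "finite {v. (w, v) \<in> R}" using finite_subset[OF _ finite_imageI[OF fin, of snd], of "{v. (w, v) \<in> R}"] by force
  then have "finite (Pair V ` {v. (w, v) \<in> R})" by simp
  then obtain \<phi> where \<phi>: "ml_sig \<phi> \<subseteq> \<sigma>" "msat R (U, y) \<phi>" "\<forall>m \<in> Pair V ` {v. (w, v) \<in> R}. \<not> msat R m \<phi>"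
    using separate_conj[of "Pair V ` {v. (w, v) \<in> R}" \<sigma> R "(U, y)"] neg not_teq by blast
  have "\<not> msat R (U, x) (MBox (MNeg \<phi>))" using \<phi>(2) xy by (auto simp: msat_def)
  moreover have "msat R (V, w) (MBox (MNeg \<phi>))" using \<phi>(3) by (auto simp: msat_def)
  ultimately show False using t \<phi>(1) by (auto simp: teq_def)
qed

section \<open>Irredundant roots and homogeneity\<close>

locale rooted =
  fixes J :: nat and R :: "(nat \<times> nat) set" and rts :: "nat set" and L :: "nat ml set"
  assumes R: "R \<subseteq> {..<J} \<times> {..<J}" and rts: "rts \<subseteq> {..<J}"
    and L: "L = {\<phi>. \<forall>r \<in> rts. \<forall>V. ml_sat R V r \<phi>}"
    and irredundant: "\<And>r. r \<in> rts \<Longrightarrow> \<exists>\<phi>. \<phi> \<notin> L \<and> (\<forall>r' \<in> rts - {r}. \<forall>V. ml_sat R V r' \<phi>)"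
    and cip: "craig_interpolation_property L"
begin

definition W :: "nat \<Rightarrow> nat set" where
  "W r = R\<^sup>* `` {r}"

text \<open>Membership depends only on the behaviour on the generated part \<open>W r\<close>;
  values outside it are arbitrary.\<close>

definition auts :: "nat \<Rightarrow> (nat \<Rightarrow> nat) set" where
  "auts r = {g. bij_betw g (W r) (W r) \<and> g r = r \<and> (\<forall>x \<in> W r. \<forall>y \<in> W r. (x, y) \<in> R \<longleftrightarrow> (g x, g y) \<in> R)}"

lemma finite_R: "finite R"
  using R finite_subset by blast

lemma root_in_W: "r \<in> W r"
  by (simp add: W_def)

lemma W_step: "x \<in> W r \<Longrightarrow> (x, y) \<in> R \<Longrightarrow> y \<in> W r"
  by (auto simp: W_def)

lemma W_sub: "r \<in> rts \<Longrightarrow> W r \<subseteq> {..<J}"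
proof
  fix x assume "r \<in> rts" "x \<in> W r"
  then have "(r, x) \<in> R\<^sup>*" "r < J" using rts by (auto simp: W_def)
  then show "x \<in> {..<J}" by (induction rule: rtrancl_induct) (use R in auto)
qed

lemma W_induct [consumes 1, case_names root step]:
  assumes "x \<in> W r" "P r" "\<And>x y. x \<in> W r \<Longrightarrow> P x \<Longrightarrow> (x, y) \<in> R \<Longrightarrow> P y"
  shows "P x"
proof -
  have "(r, x) \<in> R\<^sup>*" using assms(1) by (simp add: W_def)
  then show ?thesis
  proof (induction rule: rtrancl_induct)
    case base
    show ?case by (rule assms(2))
  next
    case (step y z)
    then show ?case using assms(3)[of y z] by (simp add: W_def)
  qed
qed

lemma finite_W: "r \<in> rts \<Longrightarrow> finite (W r)"
  using W_sub finite_subset by blast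

lemma id_auts: "id \<in> auts r"
  by (auto simp: auts_def)

lemma auts_sat:
  assumes "g \<in> auts r" "\<And>p x. p \<in> ml_sig \<phi> \<Longrightarrow> x \<in> W r \<Longrightarrow> x \<in> U p \<longleftrightarrow> g x \<in> V p"
  shows "ml_sat R U r \<phi> \<longleftrightarrow> ml_sat R V r \<phi>"
proof -
  have g: "bij_betw g (W r) (W r)" "g r = r" "\<And>x y. x \<in> W r \<Longrightarrow> y \<in> W r \<Longrightarrow> (x, y) \<in> R \<longleftrightarrow> (g x, g y) \<in> R"
    using assms(1) by (auto simp: auts_def)
  have "ml_sat R U r \<phi> \<longleftrightarrow> ml_sat R V (g r) \<phi>"
  proof (rule ml_sat_pmorphism[of "W r" R g R "ml_sig \<phi>"])
    show "y \<in> W r \<and> (g x, g y) \<in> R" if "x \<in> W r" "(x, y) \<in> R" for x y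
      using that g(3)[of x y] W_step by blast
    show "\<exists>y. (x, y) \<in> R \<and> g y = z" if "x \<in> W r" "(g x, z) \<in> R" for x z
    proof -
      have "g x \<in> W r" using g(1) that by (auto simp: bij_betw_def)
      then have "z \<in> W r" using that W_step by blast
      then obtain y where "y \<in> W r" "g y = z" using g(1) unfolding bij_betw_def by (metis imageE)
      then show ?thesis using g(3)[of x y] that by blast
    qed
  qed (use assms root_in_W in auto)
  then show ?thesis using g(2) by simp
qed

lemma sat_cong_W:
  assumes "\<And>p x. p \<in> ml_sig \<phi> \<Longrightarrow> x \<in> W r \<Longrightarrow> x \<in> U p \<longleftrightarrow> x \<in> V p"
  shows "ml_sat R U r \<phi> \<longleftrightarrow> ml_sat R V r \<phi>"
  using auts_sat[OF id_auts, of \<phi> r U V] assms by simp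

text \<open>Irredundancy of \<open>r'\<close> supplies a formula that is refuted at
  \<open>r'\<close> but valid at every other root. A p-morphism from a different root onto
  \<open>r'\<close> would carry its validity over to \<open>r'\<close>.\<close>

lemma pmorphism_roots:
  assumes "r \<in> rts" "r' \<in> rts" "f r = r'"
    and fwd: "\<And>x y. x \<in> W r \<Longrightarrow> (x, y) \<in> R \<Longrightarrow> (f x, f y) \<in> R"
    and bwd: "\<And>x z. x \<in> W r \<Longrightarrow> (f x, z) \<in> R \<Longrightarrow> \<exists>y. (x, y) \<in> R \<and> f y = z"
  shows "r = r'"
proof (rule ccontr)
  assume "r \<noteq> r'"
  obtain \<phi> where \<phi>: "\<phi> \<notin> L" "\<And>r'' V. r'' \<in> rts - {r'} \<Longrightarrow> ml_sat R V r'' \<phi>"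
    using irredundant[OF assms(2)] by blast
  have "ml_sat R V r' \<phi>" for V
    using ml_sat_pmorphism[of "W r" R f R UNIV "\<lambda>p. {x. f x \<in> V p}" V r \<phi>] fwd bwd W_step root_in_W
      \<phi>(2)[of r] assms \<open>r \<noteq> r'\<close> by auto
  then have "\<phi> \<in> L" unfolding L using \<phi>(2) by blast
  then show False using \<phi>(1) by blast
qed

text \<open>Normalised valuations. For finite \<sigma> there are only finitely many of them, and
  \<open>cut\<close> brings any valuation into this form without changing the truth of
  \<sigma>-formulas at a root; this is what makes finite separation applicable.\<close>

definition vals :: "nat set \<Rightarrow> (nat \<Rightarrow> nat set) set" where
  "vals \<sigma> = {V. \<forall>p. (p \<in> \<sigma> \<longrightarrow> V p \<in> Pow {..<J}) \<and> (p \<notin> \<sigma> \<longrightarrow> V p = {})}"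

definition cut :: "nat set \<Rightarrow> (nat \<Rightarrow> nat set) \<Rightarrow> nat \<Rightarrow> nat set" where
  "cut \<sigma> V p = (if p \<in> \<sigma> then V p \<inter> {..<J} else {})"

lemma finite_vals: "finite \<sigma> \<Longrightarrow> finite (vals \<sigma>)"
  unfolding vals_def by (rule finite_set_of_finite_funs) auto

lemma cut_vals: "cut \<sigma> V \<in> vals \<sigma>"
  by (auto simp: cut_def vals_def)

lemma cut_sat: "r \<in> rts \<Longrightarrow> ml_sig \<phi> \<subseteq> \<sigma> \<Longrightarrow> msat R (cut \<sigma> V, r) \<phi> \<longleftrightarrow> msat R (V, r) \<phi>"
  unfolding msat_def fst_conv snd_conv by (rule sat_cong_W) (use W_sub in \<open>auto simp: cut_def\<close>)

text \<open>Only finitely many normalised models differ from \<open>(V, r)\<close> on \<sigma>; a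
  conjunction of formulas that exclude them one by one is a characteristic formula of the
  \<sigma>-theory of \<open>(V, r)\<close>.\<close>

lemma pin:
  assumes "finite \<sigma>" "r \<in> rts"
  shows "\<exists>D. ml_sig D \<subseteq> \<sigma> \<and> msat R (V, r) D \<and>
    (\<forall>r' \<in> rts. \<forall>V'. msat R (V', r') D \<longrightarrow> teq R \<sigma> (V, r) (V', r'))"
proof -
  let ?N = "{m \<in> vals \<sigma> \<times> rts. \<not> teq R \<sigma> (V, r) m}"
  have "finite (vals \<sigma> \<times> rts)" using finite_vals[OF assms(1)] rts finite_subset by blast
  then have "finite ?N" by simp
  then obtain D where D: "ml_sig D \<subseteq> \<sigma>" "msat R (V, r) D" "\<And>m. m \<in> ?N \<Longrightarrow> \<not> msat R m D"
    using separate_conj[of ?N \<sigma> R "(V, r)"] not_teq by blast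
  have "teq R \<sigma> (V, r) (V', r')" if "r' \<in> rts" "msat R (V', r') D" for r' V'
  proof -
    have "msat R (cut \<sigma> V', r') D" using that cut_sat D(1) by blast
    then have "teq R \<sigma> (V, r) (cut \<sigma> V', r')" using D(3)[of "(cut \<sigma> V', r')"] that cut_vals by blast
    then show ?thesis using cut_sat that(1) by (auto simp: teq_def)
  qed
  then show ?thesis using D by blast
qed

text \<open>The atoms \<open>b + w\<close> name the worlds \<open>w\<close>.\<close>

definition nm :: "nat set \<Rightarrow> nat \<Rightarrow> (nat \<Rightarrow> nat set) \<Rightarrow> nat \<Rightarrow> nat set" where
  "nm \<sigma> b U p = (if p \<in> \<sigma> then U p else {p - b})"

text \<open>Relate a world of the second model to those worlds of the named model that have the same
  theory. Names make the partner unique, and \<open>teq_zig\<close> in both directions gives back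
  and forth steps, so the relation is the graph of a p-morphism onto \<open>W r\<close>.\<close>

lemma named_pmorphism:
  assumes b: "\<sigma> \<subseteq> {..<b}" and r: "r \<in> rts" "r' \<in> rts"
    and t: "teq R (\<sigma> \<union> {b..<b + J}) (nm \<sigma> b U, r) (V, r')"
  obtains f where "f r' = r" "f ` W r' = W r" "\<And>p x. p \<in> \<sigma> \<Longrightarrow> x \<in> W r' \<Longrightarrow> x \<in> V p \<longleftrightarrow> f x \<in> U p"
    "\<And>x y. x \<in> W r' \<Longrightarrow> (x, y) \<in> R \<Longrightarrow> (f x, f y) \<in> R"
    "\<And>x z. x \<in> W r' \<Longrightarrow> (f x, z) \<in> R \<Longrightarrow> \<exists>y. (x, y) \<in> R \<and> f y = z"
proof -
  let ?\<sigma> = "\<sigma> \<union> {b..<b + J}"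
  define Z where "Z x w \<longleftrightarrow> w \<in> W r \<and> teq R ?\<sigma> (nm \<sigma> b U, w) (V, x)" for x w
  have unique: "w = w'" if "Z x w" "Z x w'" for x w w'
  proof -
    have "w < J" using that W_sub r by (auto simp: Z_def)
    then have s: "ml_sig (MVar (b + w)) \<subseteq> ?\<sigma>" by simp
    have "b + w \<notin> \<sigma>" using b by auto
    then have nb: "nm \<sigma> b U (b + w) = {w}" by (simp add: nm_def)
    then have "msat R (nm \<sigma> b U, w) (MVar (b + w))" by (simp add: msat_def)
    then have "msat R (V, x) (MVar (b + w))" using that(1) s unfolding Z_def teq_def by blast
    then have "msat R (nm \<sigma> b U, w') (MVar (b + w))" using that(2) s unfolding Z_def teq_def by blast
    then show ?thesis using nb by (simp add: msat_def)
  qed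
  have zag: "\<exists>v. (w, v) \<in> R \<and> Z y v" if "Z x w" "(x, y) \<in> R" for x y w
    using teq_zig[OF teq_sym, of R ?\<sigma> "nm \<sigma> b U" w V x y] that finite_R W_step teq_sym
    unfolding Z_def by blast
  have zig: "\<exists>y. (x, y) \<in> R \<and> Z y v" if "Z x w" "(w, v) \<in> R" for x v w
    using teq_zig[of R ?\<sigma> "nm \<sigma> b U" w V x v] that finite_R W_step unfolding Z_def by blast
  have root: "Z r' r" using t root_in_W by (simp add: Z_def)
  have total: "\<exists>w. Z x w" if "x \<in> W r'" for x
    using that by (induction rule: W_induct) (use root zag in blast)+
  define f where "f x = (THE w. Z x w)" for x
  have f: "f x = w" if "Z x w" for x w
    unfolding f_def using that unique by blast
  have fZ: "Z x (f x)" if "x \<in> W r'" for x using total[OF that] f by blast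
  have onto: "\<exists>x \<in> W r'. Z x w" if "w \<in> W r" for w
    using that by (induction rule: W_induct) (use root root_in_W zig W_step in blast)+
  show thesis
  proof
    show "f r' = r" by (rule f[OF root])
    show "f ` W r' = W r"
    proof
      show "f ` W r' \<subseteq> W r" using fZ by (auto simp: Z_def)
      show "W r \<subseteq> f ` W r'" using onto f by blast
    qed
    show "x \<in> V p \<longleftrightarrow> f x \<in> U p" if "p \<in> \<sigma>" "x \<in> W r'" for p x
    proof -
      have "msat R (nm \<sigma> b U, f x) (MVar p) \<longleftrightarrow> msat R (V, x) (MVar p)"
        using fZ[OF that(2)] that(1) by (auto simp: Z_def teq_def)
      then show ?thesis using that(1) by (simp add: msat_def nm_def)
    qed
    show "(f x, f y) \<in> R" if "x \<in> W r'" "(x, y) \<in> R" for x y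
      using zag[OF fZ] that f by blast
    show "\<exists>y. (x, y) \<in> R \<and> f y = z" if "x \<in> W r'" "(f x, z) \<in> R" for x z
      using zig[OF fZ] that f by blast
  qed
qed

text \<open>A map of a finite set onto itself is injective; given injectivity, the back condition
  turns into reflection of edges.\<close>

lemma endo_auts:
  assumes "r \<in> rts" "f r = r" "f ` W r = W r"
    and fwd: "\<And>x y. x \<in> W r \<Longrightarrow> (x, y) \<in> R \<Longrightarrow> (f x, f y) \<in> R"
    and bwd: "\<And>x z. x \<in> W r \<Longrightarrow> (f x, z) \<in> R \<Longrightarrow> \<exists>y. (x, y) \<in> R \<and> f y = z"
  shows "f \<in> auts r"
proof -
  have inj: "inj_on f (W r)" using finite_W[OF assms(1)] assms(3) by (intro eq_card_imp_inj_on) auto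
  have "(x, y) \<in> R" if xy: "x \<in> W r" "y \<in> W r" "(f x, f y) \<in> R" for x y
  proof -
    obtain y' where y': "(x, y') \<in> R" "f y' = f y" using bwd xy by blast
    then have "y' \<in> W r" using xy W_step by blast
    then show ?thesis using y' inj xy by (metis inj_onD)
  qed
  then show ?thesis using inj assms by (auto simp: auts_def bij_betw_def)
qed

lemma homogeneous:
  assumes fin: "finite \<sigma>" and r: "r \<in> rts" "r' \<in> rts"
    and sub: "\<And>\<phi>. ml_sig \<phi> \<subseteq> \<sigma> \<Longrightarrow> msat R (U, r) \<phi> \<Longrightarrow> msat R (U', r') \<phi>"
  shows "r = r' \<and> (\<exists>g \<in> auts r. \<forall>p \<in> \<sigma>. \<forall>x \<in> W r. g x \<in> U p \<longleftrightarrow> x \<in> U' p)"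
proof -
  obtain k where k: "\<sigma> \<subseteq> {..<k}" using finite_nat_bounded[OF fin] by blast
  \<comment> \<open>The names of the two models form disjoint blocks \<open>k..<k + J\<close> and
    \<open>k + J..<k + 2 * J\<close> above \<sigma>, so the two descriptions share atoms from
    \<sigma> only.\<close>
  let ?b = "k + J"
  have b: "\<sigma> \<subseteq> {..<?b}" using k by auto
  let ?\<sigma>1 = "\<sigma> \<union> {k..<k + J}" and ?\<sigma>2 = "\<sigma> \<union> {?b..<?b + J}"
  let ?U1 = "nm \<sigma> k U" and ?U2 = "nm \<sigma> ?b U'"
  have "finite ?\<sigma>1" "finite ?\<sigma>2" using fin by auto
  then obtain D1 D2 where D1: "ml_sig D1 \<subseteq> ?\<sigma>1" "msat R (?U1, r) D1"
      "\<And>r'' V. r'' \<in> rts \<Longrightarrow> msat R (V, r'') D1 \<Longrightarrow> teq R ?\<sigma>1 (?U1, r) (V, r'')"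
    and D2: "ml_sig D2 \<subseteq> ?\<sigma>2" "msat R (?U2, r') D2"
      "\<And>r'' V. r'' \<in> rts \<Longrightarrow> msat R (V, r'') D2 \<Longrightarrow> teq R ?\<sigma>2 (?U2, r') (V, r'')"
    using pin[of ?\<sigma>1 r ?U1] pin[of ?\<sigma>2 r' ?U2] r by metis
  \<comment> \<open>An interpolant would be a \<sigma>-formula true in the model with valuation
    \<open>U\<close> and false in the one with \<open>U'\<close>, contrary to
    \<open>sub\<close>.\<close>
  have "MImp D1 (MNeg D2) \<notin> L"
  proof
    assume "MImp D1 (MNeg D2) \<in> L"
    then obtain \<chi> where \<chi>: "ml_craig_interpolant L D1 (MNeg D2) \<chi>"
      using cip unfolding craig_interpolation_property_def by blast
    have sig: "ml_sig \<chi> \<subseteq> \<sigma>" using \<chi> D1(1) D2(1) by (fastforce simp: ml_craig_interpolant_def)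
    have nm: "ml_sat R (nm \<sigma> b V) x \<chi> \<longleftrightarrow> ml_sat R V x \<chi>" for b V x
      using sig by (intro ml_sat_cong) (auto simp: nm_def)
    have "ml_sat R ?U1 r (MImp D1 \<chi>)" "ml_sat R ?U2 r' (MImp \<chi> (MNeg D2))"
      using \<chi> r unfolding ml_craig_interpolant_def L by blast+
    then have "ml_sat R U r \<chi>" "\<not> ml_sat R U' r' \<chi>"
      using D1(2) D2(2) by (auto simp: MImp_def msat_def nm)
    then show False using sub[OF sig] by (simp add: msat_def)
  qed
  then obtain r'' V where r'': "r'' \<in> rts" and V: "msat R (V, r'') D1" "msat R (V, r'') D2"
    unfolding L by (auto simp: MImp_def msat_def)
  obtain f1 where f1: "f1 r'' = r" "f1 ` W r'' = W r" "\<And>p x. p \<in> \<sigma> \<Longrightarrow> x \<in> W r'' \<Longrightarrow> x \<in> V p \<longleftrightarrow> f1 x \<in> U p"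
    "\<And>x y. x \<in> W r'' \<Longrightarrow> (x, y) \<in> R \<Longrightarrow> (f1 x, f1 y) \<in> R"
    "\<And>x z. x \<in> W r'' \<Longrightarrow> (f1 x, z) \<in> R \<Longrightarrow> \<exists>y. (x, y) \<in> R \<and> f1 y = z"
    using named_pmorphism[OF k r(1) r'' D1(3)[OF r'' V(1)]] by blast
  obtain f2 where f2: "f2 r'' = r'" "f2 ` W r'' = W r'" "\<And>p x. p \<in> \<sigma> \<Longrightarrow> x \<in> W r'' \<Longrightarrow> x \<in> V p \<longleftrightarrow> f2 x \<in> U' p"
    "\<And>x y. x \<in> W r'' \<Longrightarrow> (x, y) \<in> R \<Longrightarrow> (f2 x, f2 y) \<in> R"
    "\<And>x z. x \<in> W r'' \<Longrightarrow> (f2 x, z) \<in> R \<Longrightarrow> \<exists>y. (x, y) \<in> R \<and> f2 y = z"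
    using named_pmorphism[OF b r(2) r'' D2(3)[OF r'' V(2)]] by blast
  \<comment> \<open>Both p-morphisms start at the root \<open>r''\<close> of the common model, so
    irredundancy identifies all three roots.\<close>
  have eq: "r'' = r" "r'' = r'"
    using pmorphism_roots[OF r'' r(1) f1(1,4,5)] pmorphism_roots[OF r'' r(2) f2(1,4,5)] by auto
  have a1: "f1 \<in> auts r" using endo_auts[OF r(1), of f1] f1 eq by auto
  have a2: "f2 \<in> auts r" using endo_auts[OF r(1), of f2] f2 eq by auto
  \<comment> \<open>Since \<open>f2\<close> carries the common model to \<open>U'\<close> and
    \<open>f1\<close> carries it to \<open>U\<close>, inverting \<open>f2\<close> and applying
    \<open>f1\<close> compares \<open>U'\<close> with \<open>U\<close>.\<close>
  define h where "h = inv_into (W r) f2"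
  have b1: "bij_betw f1 (W r) (W r)" and b2: "bij_betw f2 (W r) (W r)" using a1 a2 by (auto simp: auts_def)
  have h: "bij_betw h (W r) (W r)" "\<And>x. x \<in> W r \<Longrightarrow> f2 (h x) = x" "\<And>x. x \<in> W r \<Longrightarrow> h x \<in> W r"
    unfolding h_def using bij_betw_inv_into[OF b2] bij_betw_inv_into_right[OF b2]
      bij_betwE[OF bij_betw_inv_into[OF b2]] by blast+
  have "f2 r = r" using a2 by (simp add: auts_def)
  then have hr: "h r = r" unfolding h_def using bij_betw_inv_into_left[OF b2 root_in_W] by simp
  have "f1 \<circ> h \<in> auts r"
    unfolding auts_def mem_Collect_eq
  proof (intro conjI ballI)
    show "bij_betw (f1 \<circ> h) (W r) (W r)" using h(1) b1 by (rule bij_betw_trans)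
    show "(f1 \<circ> h) r = r" using hr f1(1) eq by simp
    fix x y assume xy: "x \<in> W r" "y \<in> W r"
    have "(h x, h y) \<in> R \<longleftrightarrow> (f2 (h x), f2 (h y)) \<in> R" using a2 h(3) xy unfolding auts_def by blast
    then have "(x, y) \<in> R \<longleftrightarrow> (h x, h y) \<in> R" using h(2) xy by simp
    also have "\<dots> \<longleftrightarrow> (f1 (h x), f1 (h y)) \<in> R" using a1 h xy unfolding auts_def by blast
    finally show "(x, y) \<in> R \<longleftrightarrow> ((f1 \<circ> h) x, (f1 \<circ> h) y) \<in> R" by simp
  qed
  moreover have "(f1 \<circ> h) x \<in> U p \<longleftrightarrow> x \<in> U' p" if "p \<in> \<sigma>" "x \<in> W r" for p x
    using f1(3)[OF that(1), of "h x"] f2(3)[OF that(1), of "h x"] h that eq by simp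
  ultimately show ?thesis using eq by blast
qed

text \<open>By homogeneity a model with property \<open>Q\<close> and one without it are separated
  by a formula, even if they sit at different roots, and finitely many normalised models are
  involved. The atoms below \<open>k\<close> are placeholders, to be replaced by actual atoms
  later.\<close>

lemma definable:
  fixes Q :: "nat \<Rightarrow> (nat \<Rightarrow> nat set) \<Rightarrow> bool"
  assumes inv: "\<And>r g U U'. r \<in> rts \<Longrightarrow> g \<in> auts r \<Longrightarrow> (\<And>l x. l < k \<Longrightarrow> x \<in> W r \<Longrightarrow> g x \<in> U l \<longleftrightarrow> x \<in> U' l) \<Longrightarrow>
    Q r U \<Longrightarrow> Q r U'"
  shows "\<exists>\<theta>. ml_sig \<theta> \<subseteq> {..<k} \<and> (\<forall>r \<in> rts. \<forall>U. ml_sat R U r \<theta> \<longleftrightarrow> Q r U)"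
proof -
  let ?\<sigma> = "{..<k}"
  let ?F = "vals ?\<sigma> \<times> rts"
  let ?M = "{m \<in> ?F. Q (snd m) (fst m)}" and ?N = "{m \<in> ?F. \<not> Q (snd m) (fst m)}"
  have fin: "finite ?F" using finite_vals rts finite_subset by blast
  have "\<exists>\<phi>. ml_sig \<phi> \<subseteq> ?\<sigma> \<and> msat R m \<phi> \<and> \<not> msat R n \<phi>" if "m \<in> ?M" "n \<in> ?N" for m n
  proof (rule ccontr)
    assume "\<not> ?thesis"
    then have "snd m = snd n \<and> (\<exists>g \<in> auts (snd m). \<forall>p \<in> ?\<sigma>. \<forall>x \<in> W (snd m). g x \<in> fst m p \<longleftrightarrow> x \<in> fst n p)"
      using that by (intro homogeneous) auto
    then obtain g where g: "snd m = snd n" "g \<in> auts (snd m)"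
      "\<And>p x. p < k \<Longrightarrow> x \<in> W (snd m) \<Longrightarrow> g x \<in> fst m p \<longleftrightarrow> x \<in> fst n p" by auto
    have "Q (snd m) (fst n)" by (rule inv[OF _ g(2,3)]) (use that in auto)
    then show False using that g(1) by auto
  qed
  then have "\<exists>\<phi>. ml_sig \<phi> \<subseteq> ?\<sigma> \<and> msat R m \<phi> \<and> (\<forall>n \<in> ?N. \<not> msat R n \<phi>)" if "m \<in> ?M" for m
    using separate_conj[of ?N ?\<sigma> R m] fin that by simp
  then obtain \<theta> where \<theta>: "ml_sig \<theta> \<subseteq> ?\<sigma>" "\<forall>m \<in> ?M. msat R m \<theta>" "\<forall>n \<in> ?N. \<not> msat R n \<theta>"
    using separate_disj[of ?M ?\<sigma> R ?N] fin by auto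
  have "ml_sat R U r \<theta> \<longleftrightarrow> Q r U" if r: "r \<in> rts" for r U
  proof -
    have "Q r U \<longleftrightarrow> Q r (cut ?\<sigma> U)"
      using inv[OF r id_auts, of U "cut ?\<sigma> U"] inv[OF r id_auts, of "cut ?\<sigma> U" U] W_sub[OF r]
      by (auto simp: cut_def)
    also have "\<dots> \<longleftrightarrow> msat R (cut ?\<sigma> U, r) \<theta>" using \<theta>(2,3) cut_vals r by fastforce
    also have "\<dots> \<longleftrightarrow> ml_sat R U r \<theta>" using cut_sat[OF r \<theta>(1)] by (simp add: msat_def)
    finally show ?thesis by blast
  qed
  then show ?thesis using \<theta>(1) by blast
qed

end

section \<open>From tabular logics to irredundant roots of one frame\<close>

lemma tabular_union:
  fixes L :: "nat ml set"
  assumes "tabular L"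
  shows "\<exists>J R rts. R \<subseteq> {..<J} \<times> {..<J} \<and> rts \<subseteq> {..<J::nat} \<and> L = {\<phi>. \<forall>r \<in> rts. \<forall>V. ml_sat R V r \<phi>}"
proof -
  obtain \<F> :: "nat pframe set" where \<F>: "finite \<F>" "\<And>F. F \<in> \<F> \<Longrightarrow> pointed_frame F \<and> finite (fst F)" "L = Log \<F>"
    using assms unfolding tabular_def by blast
  \<comment> \<open>The disjoint union: a world is tagged with the pointed frame it comes from. The
    bijection \<open>b\<close> numbers the tagged worlds by an initial segment of the natural
    numbers.\<close>
  define S where "S = (SIGMA F:\<F>. fst F)"
  have "finite S" using \<F> by (auto simp: S_def)
  then obtain b where b: "bij_betw b {0..<card S} S" using ex_bij_betw_nat_finite by blast
  define J where "J = card S"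
  have bS: "b x \<in> S" if "x < J" for x using b that by (auto simp: J_def bij_betw_def)
  have binj: "x = y" if "x < J" "y < J" "b x = b y" for x y
    using b that by (auto simp: J_def bij_betw_def inj_on_def)
  have bsurj: "\<exists>x < J. b x = z" if "z \<in> S" for z
  proof -
    have "z \<in> b ` {0..<card S}" using b that by (simp add: bij_betw_def)
    then show ?thesis by (auto simp: J_def)
  qed
  define R where "R = {(x, y). x < J \<and> y < J \<and> fst (b x) = fst (b y) \<and> (snd (b x), snd (b y)) \<in> fst (snd (fst (b x)))}"
  define rts where "rts = {x. x < J \<and> snd (b x) = snd (snd (fst (b x)))}"
  have pm: "ml_sat R U x \<phi> \<longleftrightarrow> ml_sat (fst (snd F)) V (snd (b x)) \<phi>"
    if F: "F \<in> \<F>" and x: "x < J" "fst (b x) = F"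
      and val: "\<And>p y. y < J \<Longrightarrow> fst (b y) = F \<Longrightarrow> y \<in> U p \<longleftrightarrow> snd (b y) \<in> V p" for F U V x \<phi>
  proof (rule ml_sat_pmorphism[of "{y. y < J \<and> fst (b y) = F}" R "snd \<circ> b" _ UNIV, simplified comp_def])
    show "y' \<in> {y. y < J \<and> fst (b y) = F} \<and> (snd (b y), snd (b y')) \<in> fst (snd F)"
      if "y \<in> {y. y < J \<and> fst (b y) = F}" "(y, y') \<in> R" for y y'
      using that by (auto simp: R_def)
    show "\<exists>y'. (y, y') \<in> R \<and> snd (b y') = z"
      if y: "y \<in> {y. y < J \<and> fst (b y) = F}" "(snd (b y), z) \<in> fst (snd F)" for y z
    proof -
      have "z \<in> fst F" using \<F>(2)[OF F] y(2) by (auto simp: pointed_frame_def split: prod.splits)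
      then obtain y' where "y' < J" "b y' = (F, z)" using bsurj[of "(F, z)"] F by (auto simp: S_def)
      then show ?thesis using y by (intro exI[of _ y']) (auto simp: R_def)
    qed
  qed (use x val in auto)
  have "L = {\<phi>. \<forall>r \<in> rts. \<forall>V. ml_sat R V r \<phi>}"
  proof (intro equalityI subsetI)
    fix \<phi> assume \<phi>: "\<phi> \<in> L"
    have "ml_sat R V r \<phi>" if r: "r \<in> rts" for r V
    proof -
      obtain F w where bF: "b r = (F, w)" by fastforce
      have r': "r < J" "w = snd (snd F)" using r bF by (auto simp: rts_def)
      have F: "F \<in> \<F>" using bS[OF r'(1)] bF by (auto simp: S_def)
      define V' where "V' p = {v. \<exists>y < J. b y = (F, v) \<and> y \<in> V p}" for p
      have "V' p \<subseteq> fst F" for p using bS by (force simp: V'_def S_def)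
      then have sat: "ml_sat (fst (snd F)) V' w \<phi>"
        using \<phi> F r' unfolding \<F>(3) Log_def by (cases F) fastforce
      have val: "y \<in> V p \<longleftrightarrow> snd (b y) \<in> V' p" if "y < J" "fst (b y) = F" for p y
      proof -
        have byF: "b y = (F, snd (b y))" using that by (simp add: prod_eq_iff)
        show ?thesis
        proof
          assume "y \<in> V p"
          then show "snd (b y) \<in> V' p" using byF that unfolding V'_def by blast
        next
          assume "snd (b y) \<in> V' p"
          then obtain z where z: "z < J" "b z = (F, snd (b y))" "z \<in> V p" unfolding V'_def by blast
          then have "z = y" using binj[OF z(1) that(1) trans[OF z(2) byF[symmetric]]] by blast
          then show "y \<in> V p" using z(3) by blast
        qed
      qed
      have "fst (b r) = F" "snd (b r) = w" using bF by simp_all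
      with pm[OF F r'(1) \<open>fst (b r) = F\<close>, of V V' \<phi>, OF val] sat show ?thesis by simp
    qed
    then show "\<phi> \<in> {\<phi>. \<forall>r \<in> rts. \<forall>V. ml_sat R V r \<phi>}" by blast
  next
    fix \<phi> :: "nat ml" assume "\<phi> \<in> {\<phi>. \<forall>r \<in> rts. \<forall>V. ml_sat R V r \<phi>}"
    then have \<phi>: "\<And>r V. r \<in> rts \<Longrightarrow> ml_sat R V r \<phi>" by blast
    have "ml_sat R' V w \<phi>" if F: "(W, R', w) \<in> \<F>" for W R' w V
    proof -
      have "w \<in> W" using \<F>(2)[OF F] by (auto simp: pointed_frame_def)
      then obtain r where r: "r < J" "b r = ((W, R', w), w)" using bsurj[of "((W, R', w), w)"] F by (auto simp: S_def)
      then have "r \<in> rts" by (simp add: rts_def)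
      then have "ml_sat R (\<lambda>p. {y. snd (b y) \<in> V p}) r \<phi>" by (rule \<phi>)
      then show ?thesis using pm[OF F r(1), of "\<lambda>p. {y. snd (b y) \<in> V p}" V \<phi>] r(2) by simp
    qed
    then show "\<phi> \<in> L" unfolding \<F>(3) Log_def by auto
  qed
  then show ?thesis by (intro exI[of _ J] exI[of _ R] exI[of _ rts]) (auto simp: R_def rts_def)
qed

text \<open>A set of roots of least cardinality among those that determine the logic is irredundant:
  a root without a formula of its own could be removed.\<close>

lemma tabular_rooted:
  assumes "tabular L" "craig_interpolation_property L"
  shows "\<exists>J R rts. rooted J R rts L"
proof -
  obtain J :: nat and R rts0 where R: "R \<subseteq> {..<J} \<times> {..<J}" and rts0: "rts0 \<subseteq> {..<J}"
    and L: "L = {\<phi>. \<forall>r \<in> rts0. \<forall>V. ml_sat R V r \<phi>}"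
    using tabular_union[OF assms(1)] by blast
  let ?P = "\<lambda>X. X \<subseteq> {..<J} \<and> L = {\<phi>. \<forall>r \<in> X. \<forall>V. ml_sat R V r \<phi>}"
  obtain rts where rts: "?P rts" "\<And>X. ?P X \<Longrightarrow> card rts \<le> card X"
    using ex_has_least_nat[of ?P rts0 card] rts0 L by blast
  have "\<exists>\<phi>. \<phi> \<notin> L \<and> (\<forall>r' \<in> rts - {r}. \<forall>V. ml_sat R V r' \<phi>)" if r: "r \<in> rts" for r
  proof (rule ccontr)
    assume "\<not> ?thesis"
    then have "?P (rts - {r})" using rts(1) by blast
    then have "card rts \<le> card (rts - {r})" by (rule rts(2))
    moreover have "finite rts" using rts(1) finite_subset by blast
    ultimately show False using card_Diff1_less[of rts r] r by simp
  qed
  then have "rooted J R rts L" using R rts(1) assms(2) by unfold_locales auto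
  then show ?thesis by blast
qed

section \<open>From propositional to modal formulas\<close>

text \<open>The propositional variable \<open>vv j p\<close> stands for \<open>p\<close> at world \<open>j\<close>, or for a
  root selector if \<open>j\<close> is beyond the worlds; its code is \<open>6\<^sup>j 7\<close> followed by the code of \<open>p\<close>.\<close>

definition vv :: "nat \<Rightarrow> nat \<Rightarrow> nat" where
  "vv j p = 2 ^ j * (2 * p + 1)"

text \<open>The inverse of \<open>vv\<close>. Every positive number is \<open>vv j p\<close> for
  exactly one pair, so 0 alone decodes to \<open>None\<close>.\<close>

fun dec :: "nat \<Rightarrow> (nat \<times> nat) option" where
  "dec n = (if n = 0 then None else if odd n then Some (0, n div 2)
     else map_option (\<lambda>(j, p). (Suc j, p)) (dec (n div 2)))"

declare dec.simps [simp del]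

lemma dec_0: "dec 0 = None"
  and dec_odd: "dec (2 * p + 1) = Some (0, p)"
  and dec_even: "0 < n \<Longrightarrow> dec (2 * n) = map_option (\<lambda>(j, p). (Suc j, p)) (dec n)"
  by (subst dec.simps; simp)+

lemma dec_vv: "dec (vv j p) = Some (j, p)"
proof (induction j)
  case 0
  then show ?case using dec_odd by (simp add: vv_def)
next
  case (Suc j)
  have "0 < vv j p" by (simp add: vv_def)
  then show ?case using dec_even[of "vv j p"] Suc by (simp add: vv_def mult.assoc)
qed

lemma dec_SomeD: "dec n = Some (j, p) \<Longrightarrow> n = vv j p"
proof (induction n arbitrary: j rule: less_induct)
  case (less n)
  show ?case
  proof (cases "n = 0 \<or> odd n")
    case True
    then show ?thesis using less.prems dec_odd[of "n div 2"] by (auto simp: dec_0 vv_def elim!: oddE)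
  next
    case False
    then obtain j' where "dec (n div 2) = Some (j', p)" "j = Suc j'"
      using less.prems by (auto simp: dec.simps[of n])
    then show ?thesis using less.IH[of "n div 2" j'] False by (auto simp: vv_def)
  qed
qed

lemma vv_inj [simp]: "vv j p = vv j' p' \<longleftrightarrow> j = j' \<and> p = p'"
  using dec_vv by (metis option.inject prod.inject)

lemma binary_0: "binary 0 = []"
  and binary_odd: "binary (2 * p + 1) = 7 # binary p"
  and binary_even: "0 < n \<Longrightarrow> binary (2 * n) = 6 # binary n"
  by (subst binary.simps; simp)+

text \<open>The reason for the choice of \<open>vv\<close>: passing between an atom and its copy at
  world \<open>j\<close> only adds or strips \<open>j + 1\<close> digits at the front of the
  code.\<close>

lemma binary_vv: "binary (vv j p) = replicate j 6 @ 7 # binary p"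
proof (induction j)
  case 0
  then show ?case using binary_odd by (simp add: vv_def)
next
  case (Suc j)
  have "0 < vv j p" by (simp add: vv_def)
  then show ?case using binary_even[of "vv j p"] Suc by (simp add: vv_def mult.assoc)
qed

lemma set_binary: "set (binary n) \<subseteq> {6, 7}"
proof (induction n rule: binary.induct)
  case (1 n)
  then show ?case by (subst binary.simps) auto
qed

text \<open>Acts on codes as a case distinction over \<open>dec\<close> does on numbers, unrolled to
  a fixed depth; the parameter \<open>j\<close> counts the sixes removed so far, and
  \<open>z\<close> is the default for undecodable or too large indices.\<close>

primrec disp :: "nat \<Rightarrow> nat \<Rightarrow> (nat \<Rightarrow> word \<Rightarrow> word) \<Rightarrow> word \<Rightarrow> word \<Rightarrow> word" where
  "disp 0 j f z d = z"
| "disp (Suc n) j f z d =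
    (if hd0 d = 6 then disp n (Suc j) f z (tl d) else if hd0 d = 7 then f j (tl d) else z)"

lemma disp_binary:
  "disp N j0 f z (binary n) =
    (case dec n of None \<Rightarrow> z | Some (j, p) \<Rightarrow> if j < N then f (j0 + j) (binary p) else z)"
proof (induction N arbitrary: n j0)
  case 0
  then show ?case by (simp split: option.splits)
next
  case (Suc N)
  consider "n = 0" | p where "n = 2 * p + 1" | k where "n = 2 * k" "0 < k"
    by (metis Suc_eq_plus1 gr0I mult_is_0 oddE evenE)
  then show ?case
  proof cases
    case 3
    then show ?thesis using Suc[of "Suc j0" k] binary_even dec_even
      by (auto split: option.splits)
  qed (use dec_0 dec_odd binary_0 binary_odd in simp_all)
qed

context
  fixes G :: nat
  assumes G: "0 < G"
begin

lemma PT_disp: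
  assumes "PT G xs z" "\<And>j y. PT G xs y \<Longrightarrow> PT G xs (\<lambda>e. f j (y e) e)"
  shows "PT G xs d \<Longrightarrow> PT G xs (\<lambda>e. disp N j (\<lambda>j q. f j q e) (z e) (d e))"
proof (induction N arbitrary: j d)
  case (Suc N)
  show ?case unfolding disp.simps
    by (intro PT_if Suc PT_tl assms)
qed (simp add: assms)

text \<open>Collecting the arguments in one list gives functions of different arities the same
  environment type, as needed for a recursion that adds an argument at each level.\<close>

lemma PT_uni:
  assumes "PT G (map (\<lambda>i e. e ! i) [0..<n]) F" "length ys = n" "\<And>y. y \<in> set ys \<Longrightarrow> PT G xs y"
  shows "PT G xs (\<lambda>e. F (map (\<lambda>y. y e) ys))"
proof -
  let ?\<pi> = "\<lambda>e. map (\<lambda>y. y e) ys"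
  have "PT G (map (\<lambda>x. x \<circ> ?\<pi>) (map (\<lambda>i e. e ! i) [0..<n])) (F \<circ> ?\<pi>)"
    by (rule PT_reindex[OF assms(1)])
  moreover have "map (\<lambda>x. x \<circ> ?\<pi>) (map (\<lambda>i e. e ! i) [0..<n]) = ys"
    by (rule nth_equalityI) (use assms(2) in \<open>auto simp: comp_def\<close>)
  ultimately have "PT G ys (\<lambda>e. F (?\<pi> e))" by (simp add: comp_def)
  then show ?thesis by (rule PT_comp) (rule assms(3))
qed

end

section \<open>Rewriting codes token by token\<close>

definition dig :: "nat \<Rightarrow> bool" where
  "dig a \<longleftrightarrow> a = 6 \<or> a = 7"

lemma dig_simps [simp]: "\<not> dig (Suc 0)" "\<not> dig 1" "\<not> dig 2" "\<not> dig 3" "\<not> dig 4" "\<not> dig 5" "dig 6" "dig 7"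
  by (simp_all add: dig_def)

text \<open>An atom is handled at its letter 5, where the digits of the index are read ahead; the
  suffixes that start at those digits emit nothing. Thus \<open>sfx\<close> treats every token
  exactly once.\<close>

definition tok :: "(word \<Rightarrow> word) \<Rightarrow> (nat \<Rightarrow> word) \<Rightarrow> word \<Rightarrow> word" where
  "tok h out v = (if hd0 v = 5 then h (takeWhile dig (tl v)) else if dig (hd0 v) then [] else out (hd0 v))"

lemma tok_simps [simp]:
  "tok h out (5 # v) = h (takeWhile dig v)" "tok h out (6 # v) = []" "tok h out (7 # v) = []"
  "a \<noteq> 5 \<Longrightarrow> \<not> dig a \<Longrightarrow> tok h out (a # v) = out a"
  by (simp_all add: tok_def dig_def)

primrec cmap :: "(word \<Rightarrow> word) \<Rightarrow> (nat \<Rightarrow> word) \<Rightarrow> nat pl \<Rightarrow> word" where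
  "cmap h out PTop = out 1"
| "cmap h out (PVar n) = h (binary n)"
| "cmap h out (PNeg \<alpha>) = out 2 @ cmap h out \<alpha>"
| "cmap h out (PAnd \<alpha> \<beta>) = out 3 @ cmap h out \<alpha> @ cmap h out \<beta>"

lemma hd0_append: "hd0 (v @ w) = (if v = [] then hd0 w else hd0 v)"
  by (cases v) auto

lemma hd0_pl_code: "\<not> dig (hd0 (pl_code \<alpha> @ rest))"
  by (cases \<alpha>) (auto simp: dig_def)

lemma takeWhile_dig: "\<not> dig (hd0 rest) \<Longrightarrow> takeWhile dig (binary n @ rest) = binary n"
proof -
  assume "\<not> dig (hd0 rest)"
  then have "takeWhile dig rest = []" by (cases rest) auto
  moreover have "\<forall>a \<in> set (binary n). dig a" using set_binary by (auto simp: dig_def)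
  ultimately show ?thesis by (simp add: takeWhile_append2)
qed

lemma sfx_tok_digits: "\<forall>a \<in> set d. dig a \<Longrightarrow> sfx (tok h out) (d @ rest) = sfx (tok h out) rest"
  by (induction d) (auto simp: dig_def)

text \<open>The condition on \<open>rest\<close> prevents a final atom of the formula from absorbing
  foreign digits into its index.\<close>

lemma sfx_tok: "\<not> dig (hd0 rest) \<Longrightarrow> sfx (tok h out) (pl_code \<alpha> @ rest) = cmap h out \<alpha> @ sfx (tok h out) rest"
proof (induction \<alpha> arbitrary: rest)
  case (PVar n)
  then show ?case using set_binary[of n] sfx_tok_digits[of "binary n" h out rest]
    by (auto simp: takeWhile_dig) (auto simp: dig_def)
next
  case (PAnd \<alpha> \<beta>)
  then show ?case by (simp add: hd0_pl_code)
qed auto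

primrec pvars :: "nat pl \<Rightarrow> nat list" where
  "pvars PTop = []"
| "pvars (PVar n) = [n]"
| "pvars (PNeg \<alpha>) = pvars \<alpha>"
| "pvars (PAnd \<alpha> \<beta>) = pvars \<alpha> @ pvars \<beta>"

lemma set_pvars: "set (pvars \<alpha>) = pl_sig \<alpha>"
  by (induction \<alpha>) auto

lemma cmap_pvars: "cmap h (\<lambda>_. []) \<alpha> = concat (map (\<lambda>n. h (binary n)) (pvars \<alpha>))"
  by (induction \<alpha>) auto

primrec instw :: "word list \<Rightarrow> nat ml \<Rightarrow> word" where
  "instw qs MTop = [1]"
| "instw qs (MVar l) = 5 # qs ! l"
| "instw qs (MNeg \<phi>) = 2 # instw qs \<phi>"
| "instw qs (MAnd \<phi> \<psi>) = 3 # instw qs \<phi> @ instw qs \<psi>"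
| "instw qs (MBox \<phi>) = 4 # instw qs \<phi>"

text \<open>The formula is a template whose atoms are positions in \<open>ps\<close>. Templates
  belong to the frame and only the atoms put into them come from the input, so \<open>instw\<close>
  needs a program of fixed shape.\<close>

definition inst :: "nat list \<Rightarrow> nat ml \<Rightarrow> nat ml" where
  "inst ps = ml_subst (\<lambda>l. MVar (ps ! l))"

lemma instw_binary: "ml_sig \<phi> \<subseteq> {..<length ps} \<Longrightarrow> instw (map binary ps) \<phi> = ml_code (inst ps \<phi>)"
  by (induction \<phi>) (auto simp: inst_def)

lemma sig_inst: "ml_sig \<phi> \<subseteq> {..<length ps} \<Longrightarrow> ml_sig (inst ps \<phi>) \<subseteq> set ps"
  by (induction \<phi>) (auto simp: inst_def)

lemma sat_inst: "ml_sat R V x (inst ps \<phi>) \<longleftrightarrow> ml_sat R (\<lambda>l. V (ps ! l)) x \<phi>"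
  by (simp add: inst_def ml_sat_subst)

lemma PT_instw:
  assumes "7 < G" "ml_sig \<phi> \<subseteq> {..<length ys}" "\<And>y. y \<in> set ys \<Longrightarrow> PT G xs y"
  shows "PT G xs (\<lambda>e. instw (map (\<lambda>y. y e) ys) \<phi>)"
  using assms(2)
proof (induction \<phi>)
  case (MVar l)
  then show ?case using assms by (auto intro!: PT_cons)
next
  case (MAnd \<phi> \<psi>)
  then show ?case using assms(1) by (auto intro!: PT_cons PT_append)
qed (use assms(1) in \<open>auto intro!: PT_cons PT_const\<close>)

definition MOr :: "nat ml \<Rightarrow> nat ml \<Rightarrow> nat ml" where
  "MOr \<phi> \<psi> = MNeg (MAnd (MNeg \<phi>) (MNeg \<psi>))"

lemma MOr_simps [simp]:
  "ml_sat R V x (MOr \<phi> \<psi>) \<longleftrightarrow> ml_sat R V x \<phi> \<or> ml_sat R V x \<psi>"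
  "ml_sig (MOr \<phi> \<psi>) = ml_sig \<phi> \<union> ml_sig \<psi>"
  "ml_code (MOr \<phi> \<psi>) = [2, 3, 2] @ ml_code \<phi> @ 2 # ml_code \<psi>"
  by (simp_all add: MOr_def)

lemma sat_foldr_MAnd: "ml_sat R V x (foldr MAnd \<phi>s \<psi>) \<longleftrightarrow> (\<forall>\<phi> \<in> set \<phi>s. ml_sat R V x \<phi>) \<and> ml_sat R V x \<psi>"
  by (induction \<phi>s) auto

lemma sat_foldr_MOr: "ml_sat R V x (foldr MOr \<phi>s \<psi>) \<longleftrightarrow> (\<exists>\<phi> \<in> set \<phi>s. ml_sat R V x \<phi>) \<or> ml_sat R V x \<psi>"
  by (induction \<phi>s) auto

lemma sig_foldr: "ml_sig (foldr MAnd \<phi>s \<psi>) = (\<Union>\<phi> \<in> set \<phi>s. ml_sig \<phi>) \<union> ml_sig \<psi>"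
  "ml_sig (foldr MOr \<phi>s \<psi>) = (\<Union>\<phi> \<in> set \<phi>s. ml_sig \<phi>) \<union> ml_sig \<psi>"
  by (induction \<phi>s) auto

lemma code_foldr:
  "ml_code (foldr MAnd \<phi>s \<psi>) = concat (map (\<lambda>\<phi>. 3 # ml_code \<phi>) \<phi>s) @ ml_code \<psi>"
  "ml_code (foldr MOr \<phi>s \<psi>) = concat (map (\<lambda>\<phi>. [2, 3, 2] @ ml_code \<phi> @ [2]) \<phi>s) @ ml_code \<psi>"
  by (induction \<phi>s) auto

section \<open>Canonical copies of a model\<close>

locale rooted_list = rooted J R "set rs" L for J R rs L +
  assumes rs: "distinct rs"
begin

lemma auts_comp: "g \<in> auts r \<Longrightarrow> h \<in> auts r \<Longrightarrow> g \<circ> h \<in> auts r"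
  by (auto simp: auts_def intro: bij_betw_trans dest: bij_betwE)

lemma auts_W: "g \<in> auts r \<Longrightarrow> x \<in> W r \<Longrightarrow> g x \<in> W r"
  by (auto simp: auts_def dest: bij_betwE)

lemma auts_inverse:
  assumes "g \<in> auts r"
  obtains h where "h \<in> auts r" "\<And>x. x \<in> W r \<Longrightarrow> g (h x) = x"
proof
  have b: "bij_betw g (W r) (W r)" "g r = r" and e: "\<And>x y. x \<in> W r \<Longrightarrow> y \<in> W r \<Longrightarrow> (x, y) \<in> R \<longleftrightarrow> (g x, g y) \<in> R"
    using assms by (auto simp: auts_def)
  let ?h = "inv_into (W r) g"
  show gh: "g (?h x) = x" if "x \<in> W r" for x using bij_betw_inv_into_right[OF b(1) that] .
  have bh: "bij_betw ?h (W r) (W r)" by (rule bij_betw_inv_into[OF b(1)])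
  have "?h r = r" using bij_betw_inv_into_left[OF b(1) root_in_W] b(2) by simp
  moreover have "(x, y) \<in> R \<longleftrightarrow> (?h x, ?h y) \<in> R" if "x \<in> W r" "y \<in> W r" for x y
    using e[of "?h x" "?h y"] bij_betwE[OF bh] gh that by simp
  ultimately show "?h \<in> auts r" using bh by (simp add: auts_def)
qed

text \<open>If \<open>sep k r U\<close> holds for every atom put at position \<open>k\<close>, then all automorphisms that bring the first
  \<open>k\<close> sets into canonical form bring the other atoms into the same form; this form is what the modal
  formulas below read off.\<close>

definition sep :: "nat \<Rightarrow> nat \<Rightarrow> (nat \<Rightarrow> nat set) \<Rightarrow> bool" where
  "sep k r U \<longleftrightarrow> (\<forall>x \<in> W r. \<forall>y \<in> W r. (\<forall>l < k. x \<in> U l \<longleftrightarrow> y \<in> U l) \<longrightarrow> (x \<in> U k \<longleftrightarrow> y \<in> U k))"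

definition iso :: "nat \<Rightarrow> nat \<Rightarrow> (nat \<Rightarrow> nat set) \<Rightarrow> (nat \<Rightarrow> nat) \<Rightarrow> (nat \<Rightarrow> nat set) \<Rightarrow> bool" where
  "iso k r U g U' \<longleftrightarrow> g \<in> auts r \<and> (\<forall>l < k. \<forall>x \<in> W r. g x \<in> U l \<longleftrightarrow> x \<in> U' l)"

definition canon :: "nat \<Rightarrow> nat \<Rightarrow> (nat \<Rightarrow> nat set) \<Rightarrow> nat \<Rightarrow> nat set" where
  "canon k r U = (SOME U'. \<exists>g. iso k r U g U')"

text \<open>The map \<open>g\<close> into the canonical form is not unique. Under \<open>sep\<close>
  all such maps give the same answer, which allows \<open>sat_bod\<close> to replace the existential
  quantifier by one fixed \<open>g\<close>.\<close>

definition canon_at :: "nat \<Rightarrow> nat \<Rightarrow> nat \<Rightarrow> (nat \<Rightarrow> nat set) \<Rightarrow> bool" where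
  "canon_at k w r U \<longleftrightarrow> w \<in> W r \<and> (\<exists>g. iso k r U g (canon k r U) \<and> g w \<in> U k)"

lemma iso_canon: "\<exists>g. iso k r U g (canon k r U)"
  unfolding canon_def by (rule someI[of _ U]) (use id_auts in \<open>auto simp: iso_def intro!: exI[of _ id]\<close>)

lemma iso_pre:
  assumes "iso k r U h U'" "iso k r U g U0"
  obtains g' where "iso k r U' g' U0" "\<And>x. x \<in> W r \<Longrightarrow> h (g' x) = g x" 
proof -
  have h: "h \<in> auts r" "\<And>l x. l < k \<Longrightarrow> x \<in> W r \<Longrightarrow> h x \<in> U l \<longleftrightarrow> x \<in> U' l"
    and g: "g \<in> auts r" "\<And>l x. l < k \<Longrightarrow> x \<in> W r \<Longrightarrow> g x \<in> U l \<longleftrightarrow> x \<in> U0 l"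
    using assms by (auto simp: iso_def)
  obtain h' where h': "h' \<in> auts r" "\<And>x. x \<in> W r \<Longrightarrow> h (h' x) = x" using auts_inverse[OF h(1)] by blast
  have "h (h' (g x)) = g x" if "x \<in> W r" for x using h'(2) auts_W[OF g(1) that] by blast
  moreover have "iso k r U' (h' \<circ> g) U0"
    unfolding iso_def
  proof (intro conjI allI impI ballI)
    show "h' \<circ> g \<in> auts r" by (rule auts_comp[OF h'(1) g(1)])
    fix l x assume "l < k" "x \<in> W r"
    then show "(h' \<circ> g) x \<in> U' l \<longleftrightarrow> x \<in> U0 l"
      using h(2)[of l "h' (g x)"] h'(2) g auts_W h'(1) by auto
  qed
  ultimately show thesis using that[of "h' \<circ> g"] by simp
qed

lemma iso_post: "iso k r U h U' \<Longrightarrow> iso k r U' g U0 \<Longrightarrow> iso k r U (h \<circ> g) U0"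
  using auts_comp auts_W by (auto simp: iso_def)

text \<open>Isomorphic models have the same set of candidates for the canonical form, and the choice
  operator depends on this set only.\<close>

lemma canon_iso:
  assumes "iso k r U h U'"
  shows "canon k r U = canon k r U'"
proof -
  have "(\<exists>g. iso k r U g U0) \<longleftrightarrow> (\<exists>g. iso k r U' g U0)" for U0
  proof
    assume "\<exists>g. iso k r U g U0"
    then obtain g where g: "iso k r U g U0" by blast
    show "\<exists>g. iso k r U' g U0" using iso_pre[OF assms g] by blast
  next
    assume "\<exists>g. iso k r U' g U0"
    then show "\<exists>g. iso k r U g U0" using iso_post[OF assms] by blast
  qed
  then show ?thesis unfolding canon_def by simp
qed

lemma fsep_ex: "\<exists>\<theta>. ml_sig \<theta> \<subseteq> {..<Suc k} \<and> (\<forall>r \<in> set rs. \<forall>U. ml_sat R U r \<theta> \<longleftrightarrow> sep k r U)"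
proof (rule definable)
  fix r g U U' assume a: "g \<in> auts r" "\<And>l x. l < Suc k \<Longrightarrow> x \<in> W r \<Longrightarrow> g x \<in> U l \<longleftrightarrow> x \<in> U' l" "sep k r U"
  show "sep k r U'"
    unfolding sep_def
  proof (intro ballI impI)
    fix x y assume xy: "x \<in> W r" "y \<in> W r" "\<forall>l < k. x \<in> U' l \<longleftrightarrow> y \<in> U' l"
    have "g x \<in> W r" "g y \<in> W r" "\<forall>l < k. g x \<in> U l \<longleftrightarrow> g y \<in> U l"
      using a(2) xy auts_W[OF a(1)] by auto
    then have "g x \<in> U k \<longleftrightarrow> g y \<in> U k" using a(3) unfolding sep_def by blast
    then show "x \<in> U' k \<longleftrightarrow> y \<in> U' k" using a(2)[of k x] a(2)[of k y] xy by simp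
  qed
qed

lemma fcan_ex: "\<exists>\<theta>. ml_sig \<theta> \<subseteq> {..<Suc k} \<and> (\<forall>r \<in> set rs. \<forall>U. ml_sat R U r \<theta> \<longleftrightarrow> canon_at k w r U)"
proof (rule definable)
  fix r h U U' assume h: "h \<in> auts r" "\<And>l x. l < Suc k \<Longrightarrow> x \<in> W r \<Longrightarrow> h x \<in> U l \<longleftrightarrow> x \<in> U' l" "canon_at k w r U"
  have i: "iso k r U h U'" using h by (auto simp: iso_def)
  obtain g where g: "iso k r U g (canon k r U)" "g w \<in> U k" and w: "w \<in> W r" using h(3) by (auto simp: canon_at_def)
  obtain g' where g': "iso k r U' g' (canon k r U)" "\<And>x. x \<in> W r \<Longrightarrow> h (g' x) = g x"
    using iso_pre[OF i g(1)] by blast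
  have "g' w \<in> U' k" using h(2)[of k "g' w"] g'(2)[OF w] g(2) auts_W g'(1) w by (auto simp: iso_def)
  then show "canon_at k w r U'" using g'(1) w canon_iso[OF i] by (auto simp: canon_at_def)
qed

lemma fsel_ex: "\<exists>\<theta>. ml_sig \<theta> \<subseteq> {..<0::nat} \<and> (\<forall>r \<in> set rs. \<forall>U. ml_sat R U r \<theta> \<longleftrightarrow> r = rs ! i)"
  by (rule definable[where Q = "\<lambda>r U. r = rs ! i"]) simp

section \<open>The backward translation\<close>

definition "fsep k = (SOME \<theta>. ml_sig \<theta> \<subseteq> {..<Suc k} \<and> (\<forall>r \<in> set rs. \<forall>U. ml_sat R U r \<theta> \<longleftrightarrow> sep k r U))"
definition "fcan k w = (SOME \<theta>. ml_sig \<theta> \<subseteq> {..<Suc k} \<and> (\<forall>r \<in> set rs. \<forall>U. ml_sat R U r \<theta> \<longleftrightarrow> canon_at k w r U))"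
definition "fsel i = (SOME \<theta>. ml_sig \<theta> \<subseteq> {..<0::nat} \<and> (\<forall>r \<in> set rs. \<forall>U. ml_sat R U r \<theta> \<longleftrightarrow> r = rs ! i))"

lemmas fsep = someI_ex[OF fsep_ex, folded fsep_def]
lemmas fcan = someI_ex[OF fcan_ex, folded fcan_def]
lemmas fsel = someI_ex[OF fsel_ex, folded fsel_def]

text \<open>The modal reading of a propositional variable relative to a list \<open>P\<close> of
  guessed atoms. A variable that denotes neither a world copy nor a selector reads as true, in
  agreement with \<open>asg\<close>.\<close>

definition sv :: "nat list \<Rightarrow> nat \<Rightarrow> nat ml" where
  "sv P n = (case dec n of None \<Rightarrow> MTop | Some (j, q) \<Rightarrow>
     if j < J + length rs then (if j < J then inst (P @ [q]) (fcan (length P) j) else inst [] (fsel (j - J))) else MTop)"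

primrec ren :: "nat list \<Rightarrow> nat pl \<Rightarrow> nat ml" where
  "ren P PTop = MTop"
| "ren P (PVar n) = sv P n"
| "ren P (PNeg \<alpha>) = MNeg (ren P \<alpha>)"
| "ren P (PAnd \<alpha> \<beta>) = MAnd (ren P \<alpha>) (ren P \<beta>)"

definition occn :: "nat \<Rightarrow> nat list" where
  "occn n = (case dec n of None \<Rightarrow> [] | Some (j, q) \<Rightarrow> if j < J then [q] else [])"

definition occ :: "nat pl \<Rightarrow> nat list" where
  "occ \<chi> = concat (map occn (pvars \<chi>))"

text \<open>The conjuncts from \<open>fsep\<close> say that \<open>P\<close> separates all that the
  occurring atoms separate. Only then do the readings of the individual variables fit together into
  one automorphic copy of the model.\<close>

definition bod :: "nat list \<Rightarrow> nat pl \<Rightarrow> nat ml" where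
  "bod P \<chi> = foldr MAnd (map (\<lambda>q. inst (P @ [q]) (fsep (length P))) (occ \<chi>)) (ren P \<chi>)"

primrec tup :: "nat \<Rightarrow> nat list \<Rightarrow> nat pl \<Rightarrow> nat ml" where
  "tup 0 P \<chi> = bod P \<chi>"
| "tup (Suc n) P \<chi> = foldr MOr (map (\<lambda>q. tup n (P @ [q]) \<chi>) (occ \<chi>)) (bod P \<chi>)"

text \<open>One guessed atom for each pair of worlds to be separated makes \<open>J * J\<close>
  guesses enough. The disjunction over all guesses is polynomial because \<open>J\<close> is
  fixed.\<close>

definition rt :: "nat pl \<Rightarrow> nat ml" where
  "rt = tup (J * J) []"

lemma set_occ: "q \<in> set (occ \<chi>) \<longleftrightarrow> (\<exists>j < J. vv j q \<in> pl_sig \<chi>)"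
proof -
  have "q \<in> set (occn n) \<longleftrightarrow> (\<exists>j < J. n = vv j q)" for n
    by (auto simp: occn_def dec_vv dest: dec_SomeD dec_SomeD[OF sym] split: option.splits)
  then show ?thesis by (auto simp: occ_def set_pvars)
qed

lemma sig_ren: "ml_sig (ren P \<chi>) \<subseteq> set P \<union> set (occ \<chi>)"
proof (induction \<chi>)
  case (PVar n)
  show ?case
  proof (cases "dec n")
    case (Some jq)
    obtain j q where jq: "dec n = Some (j, q)" using Some by (cases jq) simp
    have "ml_sig (inst (P @ [q]) (fcan (length P) j)) \<subseteq> set (P @ [q])"
      using fcan[of "length P" j] by (intro sig_inst) simp
    moreover have "ml_sig (inst [] (fsel (j - J))) \<subseteq> set []"
      using fsel[of "j - J"] by (intro sig_inst) simp
    ultimately show ?thesis using jq dec_SomeD[OF jq] by (auto simp: sv_def occ_def occn_def)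
  qed (simp add: sv_def)
qed (auto simp: occ_def)

lemma sig_bod: "ml_sig (bod P \<chi>) \<subseteq> set P \<union> set (occ \<chi>)"
proof -
  have "ml_sig (inst (P @ [q]) (fsep (length P))) \<subseteq> set (P @ [q])" for q
    using fsep[of "length P"] by (intro sig_inst) simp
  then show ?thesis using sig_ren[of P \<chi>] unfolding bod_def sig_foldr by auto
qed

lemma sig_tup: "ml_sig (tup n P \<chi>) \<subseteq> set P \<union> set (occ \<chi>)"
proof (induction n arbitrary: P)
  case (Suc n)
  have "ml_sig (tup n (P @ [q]) \<chi>) \<subseteq> set P \<union> set (occ \<chi>)" if "q \<in> set (occ \<chi>)" for q
    using Suc[of "P @ [q]"] that by auto
  then show ?case using sig_bod[of P \<chi>] by (auto simp: sig_foldr)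
qed (simp add: sig_bod)

lemma sig_rt: "ml_sig (rt \<chi>) \<subseteq> {q. \<exists>j < J. vv j q \<in> pl_sig \<chi>}"
  using sig_tup[of "J * J" "[]" \<chi>] set_occ[of _ \<chi>] by (auto simp: rt_def)

definition asg :: "nat \<Rightarrow> (nat \<Rightarrow> nat set) \<Rightarrow> nat \<Rightarrow> bool" where
  "asg i V n \<longleftrightarrow> (case dec n of None \<Rightarrow> True | Some (j, q) \<Rightarrow>
     if j < J + length rs then (if j < J then j \<in> V q else j = J + i) else True)"

definition pull :: "nat \<Rightarrow> (nat \<Rightarrow> nat) \<Rightarrow> (nat \<Rightarrow> nat set) \<Rightarrow> nat \<Rightarrow> nat set" where
  "pull r g V p = {x \<in> W r. g x \<in> V p}"

lemma sat_tup: "ml_sat R V r (tup n P \<chi>) \<longleftrightarrow>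
    (\<exists>Q. set Q \<subseteq> set (occ \<chi>) \<and> length Q \<le> n \<and> ml_sat R V r (bod (P @ Q) \<chi>))"
proof (induction n arbitrary: P)
  case (Suc n)
  have "ml_sat R V r (tup (Suc n) P \<chi>) \<longleftrightarrow> (\<exists>q \<in> set (occ \<chi>). \<exists>Q. set Q \<subseteq> set (occ \<chi>) \<and> length Q \<le> n \<and>
      ml_sat R V r (bod (P @ q # Q) \<chi>)) \<or> ml_sat R V r (bod P \<chi>)"
    using Suc by (simp add: sat_foldr_MOr)
  also have "\<dots> \<longleftrightarrow> (\<exists>Q. set Q \<subseteq> set (occ \<chi>) \<and> length Q \<le> Suc n \<and> ml_sat R V r (bod (P @ Q) \<chi>))"
    (is "?l \<longleftrightarrow> ?r")
  proof
    assume ?l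
    then show ?r
    proof
      assume "\<exists>q \<in> set (occ \<chi>). \<exists>Q. set Q \<subseteq> set (occ \<chi>) \<and> length Q \<le> n \<and> ml_sat R V r (bod (P @ q # Q) \<chi>)"
      then obtain q Q where "q \<in> set (occ \<chi>)" "set Q \<subseteq> set (occ \<chi>)" "length Q \<le> n" "ml_sat R V r (bod (P @ q # Q) \<chi>)"
        by blast
      then show ?r by (intro exI[of _ "q # Q"]) simp
    next
      assume "ml_sat R V r (bod P \<chi>)"
      then show ?r by (intro exI[of _ "[]"]) simp
    qed
  next
    assume ?r
    then obtain Q where Q: "set Q \<subseteq> set (occ \<chi>)" "length Q \<le> Suc n" "ml_sat R V r (bod (P @ Q) \<chi>)" by blast
    then show ?l by (cases Q) auto
  qed
  finally show ?case .
qed simp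

text \<open>A single \<open>g\<close>, chosen from the atoms in \<open>P\<close> alone, serves all
  occurring atoms \<open>q\<close>, because the canonical form ignores the set at position
  \<open>length P\<close>.\<close>

lemma sat_bod:
  assumes "i < length rs"
  shows "\<exists>g \<in> auts (rs ! i). ml_sat R V (rs ! i) (bod P \<chi>) \<longleftrightarrow>
    (\<forall>q \<in> set (occ \<chi>). sep (length P) (rs ! i) (\<lambda>l. V ((P @ [q]) ! l))) \<and> pl_sat (asg i (pull (rs ! i) g V)) \<chi>"
proof -
  let ?r = "rs ! i" and ?k = "length P"
  let ?U = "\<lambda>q l. V ((P @ [q]) ! l)"
  have r: "?r \<in> set rs" using assms by simp
  obtain g where g: "iso ?k ?r (\<lambda>l. V (P ! l)) g (canon ?k ?r (\<lambda>l. V (P ! l)))" using iso_canon by blast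
  have gq: "iso ?k ?r (?U q) g (canon ?k ?r (?U q))" for q
  proof -
    have "iso ?k ?r (?U q) id (\<lambda>l. V (P ! l))" using id_auts by (auto simp: iso_def nth_append)
    then have "canon ?k ?r (?U q) = canon ?k ?r (\<lambda>l. V (P ! l))" by (rule canon_iso)
    then show ?thesis using g by (auto simp: iso_def nth_append)
  qed
  have ga: "g \<in> auts ?r" using g by (simp add: iso_def)
  \<comment> \<open>Two maps into the canonical form send \<open>w\<close> to worlds that agree on
    all atoms in \<open>P\<close>, and \<open>sep\<close> forces these worlds to agree on
    \<open>q\<close>.\<close>
  have can: "canon_at ?k w ?r (?U q) \<longleftrightarrow> w \<in> pull ?r g V q" if s: "sep ?k ?r (?U q)" for w q
  proof
    assume "canon_at ?k w ?r (?U q)"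
    then obtain g' where g': "iso ?k ?r (?U q) g' (canon ?k ?r (?U q))" "g' w \<in> ?U q ?k" and w: "w \<in> W ?r"
      by (auto simp: canon_at_def)
    have "g w \<in> W ?r" "g' w \<in> W ?r" using auts_W w ga g'(1) by (auto simp: iso_def)
    moreover have "\<forall>l < ?k. g w \<in> ?U q l \<longleftrightarrow> g' w \<in> ?U q l" using gq[of q] g'(1) w by (auto simp: iso_def)
    ultimately have "g w \<in> ?U q ?k" using s g'(2) unfolding sep_def by blast
    then show "w \<in> pull ?r g V q" using w by (simp add: pull_def)
  next
    assume "w \<in> pull ?r g V q"
    then show "canon_at ?k w ?r (?U q)" using gq[of q] by (auto simp: canon_at_def pull_def)
  qed
  have sep: "ml_sat R V ?r (inst (P @ [q]) (fsep ?k)) \<longleftrightarrow> sep ?k ?r (?U q)" for q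
    using fsep r by (simp add: sat_inst)
  have ren: "ml_sat R V ?r (ren P \<alpha>) \<longleftrightarrow> pl_sat (asg i (pull ?r g V)) \<alpha>"
    if "\<forall>q \<in> set (occ \<alpha>). sep ?k ?r (?U q)" for \<alpha>
    using that
  proof (induction \<alpha>)
    case (PVar n)
    show ?case
    proof (cases "dec n")
      case (Some jq)
      obtain j q where jq: "dec n = Some (j, q)" using Some by (cases jq) simp
      consider "j < J" | "J \<le> j" "j < J + length rs" | "J + length rs \<le> j" by linarith
      then show ?thesis
      proof cases
        case 1
        then have "sep ?k ?r (?U q)" using PVar jq by (auto simp: occ_def occn_def)
        then show ?thesis using 1 jq can[of q j] fcan[of ?k j] r by (simp add: sv_def asg_def sat_inst)
      next
        case 2
        then have "ml_sat R V ?r (sv P n) \<longleftrightarrow> ?r = rs ! (j - J)"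
          using jq fsel[of "j - J"] r by (simp add: sv_def sat_inst)
        \<comment> \<open>Roots are listed without repetition, so a root determines its
          selector.\<close>
        also have "\<dots> \<longleftrightarrow> j = J + i" using 2 rs assms nth_eq_iff_index_eq[of rs i "j - J"] by auto
        finally show ?thesis using 2 jq by (simp add: asg_def)
      qed (use jq in \<open>simp add: sv_def asg_def\<close>)
    qed (simp add: sv_def asg_def)
  qed (auto simp: occ_def)
  show ?thesis
    using ga sep ren[of \<chi>] unfolding bod_def sat_foldr_MAnd by (intro bexI[of _ g]) auto
qed

lemma rt_sound:
  assumes "i < length rs" "ml_sat R V (rs ! i) (rt \<chi>)"
  shows "\<exists>g \<in> auts (rs ! i). pl_sat (asg i (pull (rs ! i) g V)) \<chi>"
  using assms sat_bod[OF assms(1)] unfolding rt_def sat_tup by blast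

text \<open>For each pair of worlds that some occurring atom separates, guess one such atom. This
  list has at most \<open>J * J\<close> members, satisfies the separation conditions, and yields
  some automorphic copy, for which \<chi> is true by assumption.\<close>

lemma rt_complete:
  assumes i: "i < length rs" and g: "\<And>g. g \<in> auts (rs ! i) \<Longrightarrow> pl_sat (asg i (pull (rs ! i) g V)) \<chi>"
  shows "ml_sat R V (rs ! i) (rt \<chi>)"
proof -
  let ?r = "rs ! i"
  have r: "?r \<in> set rs" using i by simp
  let ?X = "{(x, y) \<in> W ?r \<times> W ?r. \<exists>q \<in> set (occ \<chi>). \<not> (x \<in> V q \<longleftrightarrow> y \<in> V q)}"
  have sub: "?X \<subseteq> {..<J} \<times> {..<J}" using W_sub[OF r] by auto
  then have fin: "finite ?X" using finite_subset by blast
  have "card ?X \<le> card ({..<J} \<times> {..<J})" by (rule card_mono[OF _ sub]) simp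
  then have card: "card ?X \<le> J * J" by simp
  obtain zs where zs: "set zs = ?X" "distinct zs" using finite_distinct_list[OF fin] by blast
  define c where "c z = (SOME q. q \<in> set (occ \<chi>) \<and> \<not> (fst z \<in> V q \<longleftrightarrow> snd z \<in> V q))" for z
  have c: "c z \<in> set (occ \<chi>) \<and> \<not> (fst z \<in> V (c z) \<longleftrightarrow> snd z \<in> V (c z))" if "z \<in> ?X" for z
  proof -
    have "\<exists>q. q \<in> set (occ \<chi>) \<and> \<not> (fst z \<in> V q \<longleftrightarrow> snd z \<in> V q)" using that by auto
    then show ?thesis unfolding c_def by (rule someI_ex)
  qed
  let ?P = "map c zs"
  have "sep (length ?P) ?r (\<lambda>l. V ((?P @ [q]) ! l))" if q: "q \<in> set (occ \<chi>)" for q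
    unfolding sep_def
  proof (intro ballI impI)
    fix x y assume xy: "x \<in> W ?r" "y \<in> W ?r" and eq: "\<forall>l < length ?P. x \<in> V ((?P @ [q]) ! l) \<longleftrightarrow> y \<in> V ((?P @ [q]) ! l)"
    have "x \<in> V q \<longleftrightarrow> y \<in> V q"
    proof (rule ccontr)
      assume "\<not> ?thesis"
      then have z: "(x, y) \<in> ?X" using xy q by blast
      then obtain l where "l < length zs" "zs ! l = (x, y)" using zs(1) by (metis in_set_conv_nth)
      then have "x \<in> V (c (x, y)) \<longleftrightarrow> y \<in> V (c (x, y))" using eq[rule_format, of l] by (simp add: nth_append)
      then show False using c[OF z] by simp
    qed
    then show "x \<in> V ((?P @ [q]) ! length ?P) \<longleftrightarrow> y \<in> V ((?P @ [q]) ! length ?P)" by (simp add: nth_append)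
  qed
  then have "ml_sat R V ?r (bod ?P \<chi>)" using sat_bod[OF i, of V ?P \<chi>] g by blast
  moreover have "set ?P \<subseteq> set (occ \<chi>)" using c zs(1) by auto
  moreover have "length ?P \<le> J * J" using card zs distinct_card by fastforce
  ultimately show ?thesis unfolding rt_def sat_tup by (intro exI[of _ ?P]) simp
qed

end

section \<open>Polynomial-time computation of the backward translation\<close>

definition occw :: "nat \<Rightarrow> (word \<Rightarrow> word) \<Rightarrow> word \<Rightarrow> word" where
  "occw J F = disp J 0 (\<lambda>_. F) []"

context
  fixes G :: nat
  assumes G: "7 < G"
begin

lemma alphabet_pos: "0 < G"
  using G by simp

lemma PT_sfx_tok:
  assumes w: "PT G xs w"
    and h: "\<And>y. PT G (map (\<lambda>y z. y (fst z)) xs @ [snd]) y \<Longrightarrow>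
      PT G (map (\<lambda>y z. y (fst z)) xs @ [snd]) (\<lambda>z. h (fst z) (y z))"
    and out: "\<And>a. a < G \<Longrightarrow> valid G (out a)"
  shows "PT G xs (\<lambda>e. sfx (tok (h e) out) (w e))"
proof (rule PT_sfx[OF alphabet_pos w])
  let ?xs = "map (\<lambda>y z. y (fst z)) xs @ [snd]"
  have v: "PT G ?xs snd" by (rule PT_var) simp
  have 1: "PT G ?xs (\<lambda>z. h (fst z) (takeWhile dig (tl (snd z))))"
    by (rule h) (intro PT_takeWhile PT_tl v alphabet_pos)
  have 2: "PT G ?xs (\<lambda>z. out (hd0 (snd z)))"
    by (rule PT_case[OF v alphabet_pos]) (rule PT_const[OF out])
  have "PT G ?xs (\<lambda>z. if hd0 (snd z) = 5 then h (fst z) (takeWhile dig (tl (snd z)))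
      else if hd0 (snd z) = 6 then [] else if hd0 (snd z) = 7 then [] else out (hd0 (snd z)))"
    by (intro PT_if v 1 2 PT_const valid_Nil)
  moreover have "(\<lambda>z. if hd0 (snd z) = 5 then h (fst z) (takeWhile dig (tl (snd z)))
      else if hd0 (snd z) = 6 then [] else if hd0 (snd z) = 7 then [] else out (hd0 (snd z)))
    = (\<lambda>z. tok (h (fst z)) out (snd z))"
    by (auto simp: tok_def dig_def fun_eq_iff)
  ultimately show "PT G ?xs (\<lambda>z. tok (h (fst z)) out (snd z))" by simp
qed

lemma PT_occw:
  assumes "\<And>y. PT G xs y \<Longrightarrow> PT G xs (\<lambda>e. F e (y e))" "PT G xs d"
  shows "PT G xs (\<lambda>e. occw J (F e) (d e))"
  unfolding occw_def using PT_disp[of G xs "\<lambda>_. []" "\<lambda>_ q e. F e q" d J 0] assms alphabet_pos by (simp add: PT_const)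

end

context rooted_list
begin

definition svw :: "word list \<Rightarrow> word \<Rightarrow> word" where
  "svw ps = disp (J + length rs) 0
    (\<lambda>j q. if j < J then instw (ps @ [q]) (fcan (length ps) j) else instw [] (fsel (j - J))) [1]"

definition letter :: "nat \<Rightarrow> word" where
  "letter a = (if a = 0 then [] else [a])"

definition bodw :: "word list \<Rightarrow> word \<Rightarrow> word" where
  "bodw ps w = sfx (tok (occw J (\<lambda>q. 3 # instw (ps @ [q]) (fsep (length ps)))) (\<lambda>_. [])) w @ sfx (tok (svw ps) letter) w"

primrec tupw :: "nat \<Rightarrow> word list \<Rightarrow> word \<Rightarrow> word" where
  "tupw 0 ps w = bodw ps w"
| "tupw (Suc n) ps w = sfx (tok (occw J (\<lambda>q. [2, 3, 2] @ tupw n (ps @ [q]) w @ [2])) (\<lambda>_. [])) w @ bodw ps w"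

lemma svw_binary: "svw (map binary P) (binary n) = ml_code (sv P n)"
proof -
  have "instw (map binary P @ [binary q]) (fcan (length P) j) = ml_code (inst (P @ [q]) (fcan (length P) j))" for q j
    using instw_binary[of "fcan (length P) j" "P @ [q]"] fcan[of "length P" j] by simp
  moreover have "instw [] (fsel i) = ml_code (inst [] (fsel i))" for i
    using instw_binary[of "fsel i" "[]"] fsel[of i] by simp
  ultimately show ?thesis by (auto simp: svw_def sv_def disp_binary split: option.splits)
qed

lemma occw_binary: "occw J F (binary n) = concat (map (\<lambda>q. F (binary q)) (occn n))"
  by (auto simp: occw_def occn_def disp_binary split: option.splits)

lemma sfx_occw: "sfx (tok (occw J F) (\<lambda>_. [])) (pl_code \<chi>) = concat (map (\<lambda>q. F (binary q)) (occ \<chi>))"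
proof -
  have "concat (map (\<lambda>n. concat (map (\<lambda>q. F (binary q)) (occn n))) ns) =
      concat (map (\<lambda>q. F (binary q)) (concat (map occn ns)))" for ns
    by (induction ns) auto
  then show ?thesis using sfx_tok[of "[]" "occw J F" "\<lambda>_. []" \<chi>]
    by (simp add: dig_def cmap_pvars occw_binary occ_def)
qed

lemma sfx_svw: "sfx (tok (svw (map binary P)) letter) (pl_code \<chi>) = ml_code (ren P \<chi>)"
proof -
  have "cmap (svw (map binary P)) letter \<chi> = ml_code (ren P \<chi>)"
    by (induction \<chi>) (auto simp: svw_binary letter_def)
  then show ?thesis using sfx_tok[of "[]" "svw (map binary P)" letter \<chi>] by (simp add: dig_def)
qed

lemma bodw_code: "bodw (map binary P) (pl_code \<chi>) = ml_code (bod P \<chi>)"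
proof -
  have "instw (map binary P @ [binary q]) (fsep (length P)) = ml_code (inst (P @ [q]) (fsep (length P)))" for q
    using instw_binary[of "fsep (length P)" "P @ [q]"] fsep[of "length P"] by simp
  then show ?thesis by (simp add: bodw_def sfx_occw sfx_svw bod_def code_foldr comp_def)
qed

lemma tupw_code: "tupw n (map binary P) (pl_code \<chi>) = ml_code (tup n P \<chi>)"
proof (induction n arbitrary: P)
  case (Suc n)
  have "tupw n (map binary P @ [binary q]) (pl_code \<chi>) = ml_code (tup n (P @ [q]) \<chi>)" for q
    using Suc[of "P @ [q]"] by simp
  then show ?case by (simp add: sfx_occw bodw_code code_foldr comp_def)
qed (simp add: bodw_code)

lemma PT_bodw:
  assumes G: "7 < G" and w: "PT G xs w" and ps: "\<And>p. p \<in> set ps \<Longrightarrow> PT G xs p"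
  shows "PT G xs (\<lambda>e. bodw (map (\<lambda>p. p e) ps) (w e))"
proof -
  let ?xs = "map (\<lambda>y z. y (fst z)) xs @ [snd]"
  have G0: "0 < G" using G by simp
  have inst: "PT G ?xs (\<lambda>z. instw (map (\<lambda>p. p (fst z)) ps @ [y z]) \<theta>)"
    if y: "PT G ?xs y" and \<theta>: "ml_sig \<theta> \<subseteq> {..<Suc (length ps)}" for y \<theta>
  proof -
    have "PT G ?xs u" if "u \<in> set (map (\<lambda>p z. p (fst z)) ps @ [y])" for u
      using that y PT_lift[OF ps] by auto
    then have "PT G ?xs (\<lambda>z. instw (map (\<lambda>u. u z) (map (\<lambda>p z. p (fst z)) ps @ [y])) \<theta>)"
      using \<theta> by (intro PT_instw[OF G]) simp_all
    then show ?thesis by (simp add: comp_def)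
  qed
  have i0: "PT G ?xs (\<lambda>z. instw [] (fsel j))" for j
    using PT_instw[OF G, of "fsel j" "[]" ?xs] fsel[of j] by simp
  have 1: "PT G ?xs (\<lambda>z. 3 # instw (map (\<lambda>p. p (fst z)) ps @ [y z]) (fsep (length ps)))" if "PT G ?xs y" for y
    using inst[OF that] fsep[of "length ps"] G by (intro PT_cons) auto
  have "PT G ?xs (\<lambda>z. if j < J then instw (map (\<lambda>p. p (fst z)) ps @ [y z]) (fcan (length ps) j) else instw [] (fsel (j - J)))"
    if "PT G ?xs y" for y j
    using inst[OF that] fcan[of "length ps" j] i0 by (cases "j < J") auto
  then have 2: "PT G ?xs (\<lambda>z. svw (map (\<lambda>p. p (fst z)) ps) (y z))" if "PT G ?xs y" for y
    using that PT_disp[of G ?xs "\<lambda>_. [1]" "\<lambda>j q z. if j < J then instw (map (\<lambda>p. p (fst z)) ps @ [q]) (fcan (length ps) j)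
        else instw [] (fsel (j - J))" y "J + length rs" 0] G by (simp add: svw_def PT_const cong: if_cong)
  show ?thesis
    unfolding bodw_def length_map
    by (intro PT_append[OF G0] PT_sfx_tok[OF G w] PT_occw[OF G] 1 2) (use G in \<open>auto simp: letter_def\<close>)
qed

text \<open>The recursion runs over the fixed nesting depth \<open>n\<close>, not over the input.
  Each level is a loop over the variables of the formula at position 0 and passes one more guessed
  atom to the next level; hence \<open>k\<close> is arbitrary in the induction.\<close>

lemma PT_tupw:
  assumes G: "7 < G"
  shows "PT G (map (\<lambda>i e. e ! i) [0..<Suc k]) (\<lambda>e. tupw n (map (\<lambda>i. e ! Suc i) [0..<k]) (e ! 0))"
proof (induction n arbitrary: k)
  case 0
  let ?xs = "map (\<lambda>i e. e ! i) [0..<Suc k] :: (word list \<Rightarrow> word) list"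
  have v: "PT G ?xs (\<lambda>e. e ! i)" if "i < Suc k" for i
    using that by (intro PT_var) (auto simp del: upt_Suc)
  have "PT G ?xs (\<lambda>e. bodw (map (\<lambda>p. p e) (map (\<lambda>i e. e ! Suc i) [0..<k])) (e ! 0))"
    by (rule PT_bodw[OF G]) (use v in auto)
  then show ?case by (simp add: comp_def del: upt_Suc)
next
  case (Suc n)
  let ?xs = "map (\<lambda>i e. e ! i) [0..<Suc k] :: (word list \<Rightarrow> word) list"
  let ?ys = "map (\<lambda>y z. y (fst z)) ?xs @ [snd]"
  have v: "PT G ?xs (\<lambda>e. e ! i)" if "i < Suc k" for i
    using that by (intro PT_var) (auto simp del: upt_Suc)
  have v': "PT G ?ys (\<lambda>z. fst z ! i)" if "i < Suc k" for i
    using PT_lift[OF v[OF that]] .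
  have b: "PT G ?xs (\<lambda>e. bodw (map (\<lambda>p. p e) (map (\<lambda>i e. e ! Suc i) [0..<k])) (e ! 0))"
    by (rule PT_bodw[OF G]) (use v in auto)
  have rec: "PT G ?ys (\<lambda>z. tupw n (map (\<lambda>i. fst z ! Suc i) [0..<k] @ [y z]) (fst z ! 0))" if y: "PT G ?ys y" for y
  proof -
    let ?zs = "(\<lambda>z. fst z ! 0) # map (\<lambda>i z. fst z ! Suc i) [0..<k] @ [y]"
    have "PT G ?ys (\<lambda>z. (\<lambda>e. tupw n (map (\<lambda>i. e ! Suc i) [0..<Suc k]) (e ! 0)) (map (\<lambda>u. u z) ?zs))"
      by (rule PT_uni[OF _ Suc.IH]) (use G v' y in auto)
    moreover have "map (\<lambda>i. map (\<lambda>u. u z) ?zs ! Suc i) [0..<Suc k] = map (\<lambda>i. fst z ! Suc i) [0..<k] @ [y z]" for z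
      by (rule nth_equalityI) (auto simp: nth_append less_Suc_eq simp del: upt_Suc)
    ultimately show ?thesis by (simp add: comp_def del: upt_Suc)
  qed
  have G0: "0 < G" using G by simp
  have "PT G ?xs (\<lambda>e. sfx (tok (occw J (\<lambda>q. [2, 3, 2] @ tupw n (map (\<lambda>i. e ! Suc i) [0..<k] @ [q]) (e ! 0) @ [2]))
      (\<lambda>_. [])) (e ! 0) @ bodw (map (\<lambda>p. p e) (map (\<lambda>i e. e ! Suc i) [0..<k])) (e ! 0))"
    by (intro PT_append[OF G0] PT_sfx_tok[OF G] PT_occw[OF G] rec b v PT_const) (use G in auto)
  then show ?case by (simp add: comp_def del: upt_Suc)
qed

lemma valid_pl_code: "7 < G \<Longrightarrow> valid G (pl_code \<chi>)"
proof (induction \<chi>)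
  case (PVar n)
  then show ?case using set_binary[of n] by (auto simp: valid_def)
qed auto

lemma polytime_rt: "polytime pl_code ml_code rt"
proof (rule polytimeI[of 8])
  have "PT 8 [pl_code] (\<lambda>\<chi>. (\<lambda>e. tupw (J * J) (map (\<lambda>i. e ! Suc i) [0..<0]) (e ! 0)) (map (\<lambda>y. y \<chi>) [pl_code]))"
    by (rule PT_uni[OF _ PT_tupw]) (auto intro: PT_var)
  then show "PT 8 [pl_code] (\<lambda>\<chi>. ml_code (rt \<chi>))"
    using tupw_code[of "J * J" "[]"] by (simp add: rt_def)
qed (auto intro: valid_pl_code)

end

section \<open>From modal to propositional formulas\<close>

definition idig :: "nat \<Rightarrow> bool" where
  "idig a \<longleftrightarrow> a = 16 \<or> a = 17"

text \<open>A parser reading from right to left; \<open>acc\<close> holds the terms found so far,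
  each closed by 8. Unary operators and digits go to the front, 13 merges the two leading terms by
  deleting a separator, 15 completes an atom from the digits in front, and any other nonzero letter
  is a term by itself.\<close>

definition forest_step :: "nat \<Rightarrow> word \<Rightarrow> word" where
  "forest_step a acc =
    (if a = 12 \<or> a = 14 \<or> a = 16 \<or> a = 17 then a # acc
     else if a = 13 then 13 # takeWhile (\<lambda>b. b \<noteq> 8) acc @ tl (dropWhile (\<lambda>b. b \<noteq> 8) acc)
     else if a = 15 then 15 # takeWhile idig acc @ 8 # dropWhile idig acc
     else if a = 0 then [] else a # 8 # acc)"

text \<open>Inserts the separator 8 after each of the complete terms that make up the word.\<close>

definition forest :: "word \<Rightarrow> word" where
  "forest w = foldr forest_step w []"

definition first :: "word \<Rightarrow> word" where
  "first w = takeWhile (\<lambda>b. b \<noteq> 8) (forest w)"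

lemma forest_Nil [simp]: "forest [] = []"
  and forest_Cons: "forest (a # w) = forest_step a (forest w)"
  by (simp_all add: forest_def)

lemma idig_hd0_forest: "idig (hd0 (forest w)) \<longleftrightarrow> idig (hd0 w)"
  by (cases w) (auto simp: forest_Cons forest_step_def)

text \<open>The fold tries suffixes in order of increasing length and stops growing once
  \<open>P\<close> holds; if none qualifies, the whole word remains.\<close>

definition shortest :: "(word \<Rightarrow> bool) \<Rightarrow> word \<Rightarrow> word" where
  "shortest P w = foldr (\<lambda>a acc. if P acc then acc else a # acc) w []"

lemma shortest_suffix: "\<exists>pre. w = pre @ shortest P w"
proof (induction w)
  case (Cons a w)
  then obtain pre where pre: "w = pre @ shortest P w" by blast
  show ?case
  proof (cases "P (shortest P w)")
    case True
    then have "shortest P (a # w) = shortest P w" by (simp add: shortest_def)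
    then show ?thesis using pre by (intro exI[of _ "a # pre"]) simp
  next
    case False
    then have "shortest P (a # w) = a # shortest P w" by (simp add: shortest_def)
    moreover have "shortest P w = w" using False by (induction w) (auto simp: shortest_def split: if_splits)
    ultimately show ?thesis by simp
  qed
qed (simp add: shortest_def)

lemma shortest_sat: "P (shortest P w) \<or> shortest P w = w"
  by (induction w) (auto simp: shortest_def)

lemma shortest_minimal: "shortest P w = pre @ v \<Longrightarrow> pre \<noteq> [] \<Longrightarrow> \<not> P v"
proof (induction w arbitrary: pre)
  case Nil
  then show ?case by (simp add: shortest_def)
next
  case (Cons a w)
  show ?case
  proof (cases "P (shortest P w)")
    case True
    then show ?thesis using Cons by (simp add: shortest_def)
  next
    case False
    then have w: "shortest P w = w" using shortest_sat by blast
    then have "a # w = pre @ v" using Cons.prems False by (simp add: shortest_def)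
    then obtain pre' where "pre = a # pre'" "w = pre' @ v" using Cons.prems(2) by (cases pre) auto
    then show ?thesis using Cons.IH[of pre'] w False by (cases "pre' = []") auto
  qed
qed

text \<open>A length comparison in unary: something remains of two copies of the leading term after
  dropping \<open>length t\<close> letters exactly if that term is longer than half of
  \<open>t\<close>. Codes contain no 0, so \<open>hd0\<close> detects this. Suffixes that start
  inside an index are excluded.\<close>

definition half :: "word \<Rightarrow> word \<Rightarrow> bool" where
  "half t u \<longleftrightarrow> \<not> idig (hd0 u) \<and> hd0 (drop (length t) (first u @ first u)) \<noteq> 0"

text \<open>In \<open>xml\<close>, \<open>Inl\<close> marks atoms of the input and
  \<open>Inr\<close> constants for sets of worlds. In \<open>mix\<close>, \<open>Inl\<close> marks
  final variables, and \<open>Inr (w, t)\<close> is a pending task that stands for the truth of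
  \<open>t\<close> at \<open>w\<close>.\<close>

type_synonym xml = "(nat + nat) ml"
type_synonym mix = "(nat + nat \<times> xml) pl"

definition POr :: "'a pl \<Rightarrow> 'a pl \<Rightarrow> 'a pl" where
  "POr \<alpha> \<beta> = PNeg (PAnd (PNeg \<alpha>) (PNeg \<beta>))"

definition orM :: "'a pl list \<Rightarrow> 'a pl" where
  "orM ms = foldr POr ms (PNeg PTop)"

definition andM :: "'a pl list \<Rightarrow> 'a pl" where
  "andM ms = foldr PAnd ms PTop"

definition orw :: "word list \<Rightarrow> word" where
  "orw ws = foldr (\<lambda>x y. [2, 3, 2] @ x @ 2 # y) ws [2, 1]"

definition andw :: "word list \<Rightarrow> word" where
  "andw ws = foldr (\<lambda>x y. 3 # x @ y) ws [1]"

lemma orM_sat: "pl_sat v (orM ms) \<longleftrightarrow> (\<exists>m \<in> set ms. pl_sat v m)"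
  by (induction ms) (auto simp: orM_def POr_def)

lemma andM_sat: "pl_sat v (andM ms) \<longleftrightarrow> (\<forall>m \<in> set ms. pl_sat v m)"
  by (induction ms) (auto simp: andM_def)

lemma orM_sig: "pl_sig (orM ms) = (\<Union>m \<in> set ms. pl_sig m)"
  by (induction ms) (auto simp: orM_def POr_def)

lemma andM_sig: "pl_sig (andM ms) = (\<Union>m \<in> set ms. pl_sig m)"
  by (induction ms) (auto simp: andM_def)

definition litw :: "bool \<Rightarrow> word \<Rightarrow> word" where
  "litw b x = (if b then x else 2 # x)"

definition litM :: "bool \<Rightarrow> 'a pl \<Rightarrow> 'a pl" where
  "litM b m = (if b then m else PNeg m)"

section \<open>Terms with set constants and their contexts\<close>

context rooted_list
begin

text \<open>The constants \<open>Inr c\<close> with \<open>c < 2 ^ J\<close> denote all sets of worlds.\<close>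

definition cs :: "nat \<Rightarrow> nat set" where
  "cs = (SOME h. bij_betw h {0..<2 ^ J} (Pow {..<J}))"

definition cst :: "nat set \<Rightarrow> nat" where
  "cst X = (SOME c. c < 2 ^ J \<and> cs c = X \<inter> {..<J})"

lemma cs: "bij_betw cs {0..<2 ^ J} (Pow {..<J})"
proof -
  have "\<exists>h. bij_betw h {0..<card (Pow {..<J})} (Pow {..<J::nat})" by (rule ex_bij_betw_nat_finite) simp
  then have "\<exists>h. bij_betw h {0..<2 ^ J :: nat} (Pow {..<J})" by (simp add: card_Pow)
  then show ?thesis unfolding cs_def by (rule someI_ex)
qed

lemma cst: "cst X < 2 ^ J" "cs (cst X) = X \<inter> {..<J}"
proof -
  have "X \<inter> {..<J} \<in> cs ` {0..<2 ^ J}" using cs by (auto simp: bij_betw_def)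
  then have "\<exists>c. c < 2 ^ J \<and> cs c = X \<inter> {..<J}" by auto
  from someI_ex[OF this] show "cst X < 2 ^ J" "cs (cst X) = X \<inter> {..<J}" unfolding cst_def by auto
qed

definition val :: "(nat \<Rightarrow> bool) \<Rightarrow> nat \<Rightarrow> nat set" where
  "val v p = {w. w < J \<and> v (vv w p)}"

definition xsat :: "(nat \<Rightarrow> bool) \<Rightarrow> nat \<Rightarrow> xml \<Rightarrow> bool" where
  "xsat v w t \<longleftrightarrow> ml_sat R (case_sum (val v) cs) w t"

lemma xsat_simps [simp]:
  "xsat v w MTop" "xsat v w (MVar (Inl p)) \<longleftrightarrow> w < J \<and> v (vv w p)" "xsat v w (MVar (Inr c)) \<longleftrightarrow> w \<in> cs c"
  "xsat v w (MNeg t) \<longleftrightarrow> \<not> xsat v w t" "xsat v w (MAnd s t) \<longleftrightarrow> xsat v w s \<and> xsat v w t"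
  "xsat v w (MBox t) \<longleftrightarrow> (\<forall>u. (w, u) \<in> R \<longrightarrow> xsat v u t)"
  by (simp_all add: xsat_def val_def)

text \<open>A term occurs in words as part of the task to express its truth at a world \<open>w\<close>: the letter
  \<open>20 + w\<close> followed by the code of the term. The code uses the letters of the modal formulas shifted by 10,
  so that it cannot be confused with the surrounding propositional formula, and \<open>20 + J + c\<close> for a constant.\<close>

primrec xcode :: "xml \<Rightarrow> word" where
  "xcode MTop = [11]"
| "xcode (MVar x) = (case x of Inl p \<Rightarrow> 15 # map (\<lambda>a. a + 10) (binary p) | Inr c \<Rightarrow> [20 + J + c])"
| "xcode (MNeg t) = 12 # xcode t"
| "xcode (MAnd s t) = 13 # xcode s @ xcode t"
| "xcode (MBox t) = 14 # xcode t"

lemma xcode_nonempty [simp]: "xcode t \<noteq> []" "0 < length (xcode t)"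
  by (cases t; simp split: sum.split)+

lemma idig_xcode [simp]: "\<not> idig (hd0 (xcode t))" "\<not> idig (hd0 (xcode t @ w))"
  by (cases t; auto simp: idig_def split: sum.split)+

lemma set_ibinary: "\<forall>a \<in> set (map (\<lambda>a. a + 10) (binary p)). idig a"
  using set_binary[of p] by (auto simp: idig_def)

lemma sep_notin_xcode: "8 \<notin> set (xcode t)"
proof (induction t)
  case (MVar x)
  then show ?case using set_binary by (auto split: sum.split)
qed auto

lemma half_xcode:
  assumes "\<not> idig (hd0 u)" "first u = xcode s"
  shows "half t u \<longleftrightarrow> length t < 2 * length (xcode s)"
proof -
  have "0 \<notin> set (xcode s @ xcode s)"
  proof -
    have "0 \<notin> set (xcode s)"
    proof (induction s)
      case (MVar x)
      then show ?case using set_binary by (auto split: sum.split)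
    qed auto
    then show ?thesis by simp
  qed
  then have "hd0 (drop n (xcode s @ xcode s)) \<noteq> 0 \<longleftrightarrow> n < length (xcode s @ xcode s)" for n
    by (metis Cons_nth_drop_Suc drop_eq_Nil hd0_simps linorder_not_less nth_mem)
  then show ?thesis using assms by (simp add: half_def mult_2)
qed

lemma forest_digits: "\<forall>a \<in> set d. idig a \<Longrightarrow> forest (d @ w) = d @ forest w"
  by (induction d) (auto simp: forest_Cons forest_step_def idig_def)

lemma takeWhile_idig:
  assumes "\<forall>a \<in> set d. idig a" "\<not> idig (hd0 w)"
  shows "takeWhile idig (d @ w) = d" "dropWhile idig (d @ w) = w"
proof -
  have "takeWhile idig w = []" "dropWhile idig w = w" using assms(2) by (cases w; simp)+
  then show "takeWhile idig (d @ w) = d" "dropWhile idig (d @ w) = w" using assms(1) by auto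
qed

lemma takeWhile_sep: "takeWhile (\<lambda>b. b \<noteq> 8) (xcode t @ 8 # w) = xcode t"
  "dropWhile (\<lambda>b. b \<noteq> 8) (xcode t @ 8 # w) = 8 # w"
proof -
  have "\<forall>a \<in> set (xcode t). a \<noteq> 8" using sep_notin_xcode by metis
  then show "takeWhile (\<lambda>b. b \<noteq> 8) (xcode t @ 8 # w) = xcode t"
    "dropWhile (\<lambda>b. b \<noteq> 8) (xcode t @ 8 # w) = 8 # w"
    by (simp_all add: takeWhile_append2 dropWhile_append2)
qed

lemma forest_xcode: "\<not> idig (hd0 w) \<Longrightarrow> forest (xcode t @ w) = xcode t @ 8 # forest w"
proof (induction t arbitrary: w)
  case (MVar x)
  show ?case
  proof (cases x)
    case (Inl p)
    have "\<not> idig (hd0 (forest w))" using MVar idig_hd0_forest by blast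
    then show ?thesis using Inl takeWhile_idig[OF set_ibinary, of "forest w" p] forest_digits[OF set_ibinary, of p w]
      by (simp add: forest_Cons forest_step_def)
  qed (simp add: forest_Cons forest_step_def)
next
  case (MAnd s t)
  then have "forest (xcode s @ xcode t @ w) = xcode s @ 8 # xcode t @ 8 # forest w" by simp
  then show ?case using takeWhile_sep by (simp add: forest_Cons forest_step_def)
qed (auto simp: forest_Cons forest_step_def)

lemma first_xcode: "\<not> idig (hd0 w) \<Longrightarrow> first (xcode t @ w) = xcode t"
  by (simp add: first_def forest_xcode takeWhile_sep)

text \<open>\<open>C\<close> is a one-hole context with \<open>s\<close> in the hole of
  \<open>t\<close>. The hole may lie under boxes, so \<open>s'\<close> has to agree with
  \<open>s\<close> at all worlds. The condition on \<open>post\<close> keeps an index at the end of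
  the plugged term from being continued.\<close>

definition plug :: "xml \<Rightarrow> (xml \<Rightarrow> xml) \<Rightarrow> word \<Rightarrow> xml \<Rightarrow> word \<Rightarrow> bool" where
  "plug t C pre s post \<longleftrightarrow> C s = t \<and> \<not> idig (hd0 post) \<and> (\<forall>s'. xcode (C s') = pre @ xcode s' @ post) \<and>
    (\<forall>s'. ml_sig (C s') \<subseteq> ml_sig t \<union> ml_sig s') \<and> ml_sig s \<subseteq> ml_sig t \<and>
    (\<forall>v s'. (\<forall>w < J. xsat v w s' \<longleftrightarrow> xsat v w s) \<longrightarrow> (\<forall>w < J. xsat v w (C s') \<longleftrightarrow> xsat v w t))"

lemma plug_id: "plug t (\<lambda>s. s) [] t []"
  by (auto simp: plug_def idig_def)

lemma plug_MNeg: "plug t C pre s post \<Longrightarrow> plug (MNeg t) (\<lambda>s. MNeg (C s)) (12 # pre) s post"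
  by (auto simp: plug_def)

lemma plug_MBox: "plug t C pre s post \<Longrightarrow> plug (MBox t) (\<lambda>s. MBox (C s)) (14 # pre) s post"
proof -
  assume p: "plug t C pre s post"
  have RJ: "u < J" if "(w, u) \<in> R" for w u using R that by auto
  have "xsat v w (MBox (C s')) \<longleftrightarrow> xsat v w (MBox t)"
    if "\<forall>w < J. xsat v w s' \<longleftrightarrow> xsat v w s" for v s' w
    using p that RJ[of w] unfolding plug_def xsat_simps by blast
  then show ?thesis using p unfolding plug_def by simp
qed

lemma plug_MAnd1: "plug t C pre s post \<Longrightarrow> plug (MAnd t t') (\<lambda>s. MAnd (C s) t') (13 # pre) s (post @ xcode t')"
  by (auto simp: plug_def hd0_append)

lemma plug_MAnd2: "plug t C pre s post \<Longrightarrow> plug (MAnd t' t) (\<lambda>s. MAnd t' (C s)) (13 # xcode t' @ pre) s post"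
  by (auto simp: plug_def)

lemma plug_whole: "xcode t = v \<Longrightarrow> \<exists>C s post. v = xcode s @ post \<and> plug t C [] s post"
  using plug_id[of t] by (metis append_Nil2)

text \<open>In prefix notation a suffix that does not start inside an index begins with a complete
  subterm; the rest of the code is its context.\<close>

lemma suffix_plug:
  "xcode t = pre @ v \<Longrightarrow> v \<noteq> [] \<Longrightarrow> \<not> idig (hd0 v) \<Longrightarrow> \<exists>C s post. v = xcode s @ post \<and> plug t C pre s post"
proof (induction t arbitrary: pre v)
  case MTop
  then have "pre = []" by (cases pre) auto
  then show ?case using MTop plug_whole[of MTop v] by simp
next
  case (MVar x)
  show ?case
  proof (cases pre)
    case Nil
    then show ?thesis using MVar.prems(1) plug_whole[of "MVar x" v] by simp
  next
    case (Cons a pre')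
    show ?thesis
    proof (cases x)
      case (Inl p)
      then have "map (\<lambda>a. a + 10) (binary p) = pre' @ v" using MVar Cons by simp
      then have "idig (hd v)" using set_ibinary[of p] MVar.prems(2) by auto
      then show ?thesis using MVar.prems by (cases v) auto
    qed (use MVar Cons in simp)
  qed
next
  case (MNeg t)
  show ?case
  proof (cases pre)
    case Nil
    then show ?thesis using MNeg.prems(1) plug_whole[of "MNeg t" v] by simp
  next
    case (Cons a pre')
    then have "xcode t = pre' @ v" "a = 12" using MNeg.prems by auto
    then show ?thesis using MNeg.IH[of pre' v] MNeg.prems plug_MNeg Cons by blast
  qed
next
  case (MBox t)
  show ?case
  proof (cases pre)
    case Nil
    then show ?thesis using MBox.prems(1) plug_whole[of "MBox t" v] by simp
  next
    case (Cons a pre')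
    then have "xcode t = pre' @ v" "a = 14" using MBox.prems by auto
    then show ?thesis using MBox.IH[of pre' v] MBox.prems plug_MBox Cons by blast
  qed
next
  case (MAnd t1 t2)
  show ?case
  proof (cases pre)
    case Nil
    then show ?thesis using MAnd.prems(1) plug_whole[of "MAnd t1 t2" v] by simp
  next
    case (Cons a pre')
    then have a: "a = 13" and eq: "xcode t1 @ xcode t2 = pre' @ v" using MAnd.prems by auto
    then consider us where "xcode t1 @ us = pre'" "xcode t2 = us @ v"
      | us where "us \<noteq> []" "xcode t1 = pre' @ us" "us @ xcode t2 = v"
      unfolding append_eq_append_conv2 by fastforce
    then show ?thesis
    proof cases
      case 1
      then show ?thesis using MAnd.IH(2)[of us v] MAnd.prems plug_MAnd2 Cons a by blast
    next
      case 2
      then have "\<not> idig (hd0 us)" using MAnd.prems(3) by (cases us) auto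
      then obtain C s post where "us = xcode s @ post" "plug t1 C pre' s post" using MAnd.IH(1)[of pre' us] 2 by blast
      then show ?thesis using plug_MAnd1[of t1 C pre' s post t2] 2 Cons a by (metis append.assoc)
    qed
  qed
qed

text \<open>The shortest suffix whose leading term \<open>s\<close> exceeds half of \<open>t\<close>
  is chosen. The immediate subterms of \<open>s\<close> lead shorter suffixes and so are at most
  half of \<open>t\<close>; the context is small because \<open>s\<close> is large.\<close>

lemma halving:
  obtains C pre s post where "shortest (half (xcode t)) (xcode t) = xcode s @ post" "plug t C pre s post"
    "length (xcode t) < 2 * length (xcode s)"
    "\<And>s1. s = MNeg s1 \<or> s = MBox s1 \<Longrightarrow> 2 * length (xcode s1) \<le> length (xcode t)"
    "\<And>s1 s2. s = MAnd s1 s2 \<Longrightarrow> 2 * length (xcode s1) \<le> length (xcode t) \<and> 2 * length (xcode s2) \<le> length (xcode t)"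
proof -
  let ?t = "xcode t" and ?u = "shortest (half (xcode t)) (xcode t)"
  have ft: "first ?t = ?t" using first_xcode[of "[]" t] by (simp add: idig_def)
  have "half ?t ?t" using half_xcode[OF _ ft] by simp
  then have h: "half ?t ?u" using shortest_sat[of "half ?t" ?t] by metis
  then have "?u \<noteq> []" by (auto simp: half_def first_def)
  obtain pre where pre: "?t = pre @ ?u" using shortest_suffix by blast
  obtain C s post where s: "?u = xcode s @ post" "plug t C pre s post"
    using suffix_plug[OF pre \<open>?u \<noteq> []\<close>] h by (auto simp: half_def)
  have post: "\<not> idig (hd0 post)" using s by (simp add: plug_def)
  have len: "length ?t < 2 * length (xcode s)" using h half_xcode[OF _ first_xcode[OF post, of s]] s(1) by simp
  have sub: "2 * length (xcode s') \<le> length ?t" if "?u = a # d @ xcode s' @ q" "\<not> idig (hd0 q)" for s' a d q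
  proof -
    have "\<not> half ?t (xcode s' @ q)" using shortest_minimal[of "half ?t" ?t "a # d" "xcode s' @ q"] that(1) by simp
    then show ?thesis using half_xcode[OF _ first_xcode[OF that(2), of s']] by simp
  qed
  show thesis
  proof (rule that[OF s len])
    show "2 * length (xcode s1) \<le> length ?t" if "s = MNeg s1 \<or> s = MBox s1" for s1
      using sub[of _ "[]" s1 post] that s(1) post by auto
    show "2 * length (xcode s1) \<le> length ?t \<and> 2 * length (xcode s2) \<le> length ?t" if "s = MAnd s1 s2" for s1 s2
      using sub[of _ "[]" s1 "xcode s2 @ post"] sub[of _ "xcode s1" s2 post] that s(1) post by auto
  qed
qed

section \<open>Partially translated formulas and their potential\<close>

primrec mcode :: "mix \<Rightarrow> word" where
  "mcode PTop = [1]"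
| "mcode (PVar x) = (case x of Inl n \<Rightarrow> 5 # binary n | Inr (w, t) \<Rightarrow> (20 + w) # xcode t)"
| "mcode (PNeg m) = 2 # mcode m"
| "mcode (PAnd m m') = 3 # mcode m @ mcode m'"

definition mixsat :: "(nat \<Rightarrow> bool) \<Rightarrow> mix \<Rightarrow> bool" where
  "mixsat v = pl_sat (case_sum v (\<lambda>(w, t). xsat v w t))"

lemma mcode_orM: "mcode (orM ms) = orw (map mcode ms)"
  by (induction ms) (auto simp: orM_def orw_def POr_def)

lemma mcode_andM: "mcode (andM ms) = andw (map mcode ms)"
  by (induction ms) (auto simp: andM_def andw_def)

lemma mcode_litM: "mcode (litM b m) = litw b (mcode m)"
  by (simp add: litM_def litw_def)

definition is_const :: "xml \<Rightarrow> bool" where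
  "is_const t \<longleftrightarrow> (\<exists>c. t = MVar (Inr c))"

text \<open>Bounds the number of rounds until a task has disappeared. Length alone would not
  decrease: a one-letter term such as \<open>MTop\<close> gives rise to a constant, again one letter
  long; hence the smaller value for constants.\<close>

definition rank :: "xml \<Rightarrow> nat" where
  "rank t = (if is_const t then 1 else length (xcode t) + 1)"

text \<open>A task of size \<open>n\<close> is replaced by a formula whose length is at most \<open>branching\<close> times that of a task
  of size about \<open>n / 2\<close>; the potential \<open>pot_coeff * (n - 1) ^ pot_deg + pot_base\<close> pays for this.\<close>

definition branching :: nat where
  "branching = 2 ^ J * 2 ^ J * (6 * J + 9) + 2"

definition pot_base :: nat where
  "pot_base = branching * (J + 3) + 3"

definition pot_deg :: nat where
  "pot_deg = 2 * branching"

definition pot_coeff :: nat where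
  "pot_coeff = 2 * branching * (pot_base + J + 5)"

text \<open>Measured by the length minus one. Plugging a one-letter constant for \<open>s\<close>
  into a term of length \<open>n\<close> leaves \<open>n - length s\<close> in this measure, at most
  half of \<open>n - 1\<close> if \<open>s\<close> is longer than half of the term.\<close>

definition tpot :: "xml \<Rightarrow> nat" where
  "tpot t = (if is_const t then 3 else pot_coeff * (length (xcode t) - 1) ^ pot_deg + pot_base)"

primrec pot :: "mix \<Rightarrow> nat" where
  "pot PTop = 1"
| "pot (PVar x) = (case x of Inl n \<Rightarrow> 1 + length (binary n) | Inr (w, t) \<Rightarrow> tpot t)"
| "pot (PNeg m) = 1 + pot m"
| "pot (PAnd m m') = 1 + pot m + pot m'"

lemma branching_pos: "0 < branching"
  by (simp add: branching_def)

text \<open>Halving the argument repays the factor \<open>2 * branching\<close>, because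
  \<open>2 ^ pot_deg\<close> exceeds it; this consumes half of
  \<open>pot_coeff * e ^ pot_deg\<close>. The coefficient is chosen so that the other half pays for
  the additive terms.\<close>

lemma pot_step:
  assumes "1 \<le> e"
  shows "branching * (pot_coeff * (e div 2) ^ pot_deg + pot_base + e + J + 3) \<le> pot_coeff * e ^ pot_deg + pot_base"
proof -
  let ?B = branching and ?A = pot_coeff and ?D = pot_deg and ?F = pot_base
  have "?B * 2 < 2 ^ ?D" using less_exp[of ?D] by (simp add: pot_deg_def mult.commute)
  then have "?B * 2 * (e div 2) ^ ?D \<le> 2 ^ ?D * (e div 2) ^ ?D" by (intro mult_right_mono) auto
  also have "\<dots> = (2 * (e div 2)) ^ ?D" by (simp add: power_mult_distrib)
  also have "\<dots> \<le> e ^ ?D" by (rule power_mono) auto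
  finally have "?A * (?B * 2 * (e div 2) ^ ?D) \<le> ?A * e ^ ?D" by (rule mult_left_mono) simp
  then have 1: "2 * (?B * (?A * (e div 2) ^ ?D)) \<le> ?A * e ^ ?D" by (simp add: algebra_simps)
  have "?F + e + J + 3 \<le> (?F + J + 5) * e"
  proof -
    have "?F + J + 4 \<le> (?F + J + 4) * e" using assms by simp
    then show ?thesis by (simp add: algebra_simps)
  qed
  then have "2 * ?B * (?F + e + J + 3) \<le> 2 * ?B * ((?F + J + 5) * e)" by (rule mult_left_mono) simp
  also have "\<dots> = ?A * e" by (simp add: pot_coeff_def algebra_simps)
  also have "\<dots> \<le> ?A * e ^ ?D"
    using assms branching_pos by (intro mult_left_mono self_le_power) (auto simp: pot_deg_def)
  finally have 2: "2 * (?B * (?F + e + J + 3)) \<le> ?A * e ^ ?D" by (simp add: algebra_simps)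
  have "?B * (?A * (e div 2) ^ ?D + ?F + e + J + 3) = ?B * (?A * (e div 2) ^ ?D) + ?B * (?F + e + J + 3)"
    by (simp add: algebra_simps)
  then show ?thesis using 1 2 by linarith
qed

lemma length_tpot: "length (xcode t) + 1 \<le> tpot t"
proof (cases "is_const t")
  case False
  let ?e = "length (xcode t) - 1"
  have "?e \<le> pot_coeff * ?e ^ pot_deg"
  proof (cases "?e = 0")
    case False
    then have "?e \<le> ?e ^ pot_deg" using branching_pos by (intro self_le_power) (auto simp: pot_deg_def)
    also have "\<dots> \<le> pot_coeff * ?e ^ pot_deg" using branching_pos by (simp add: pot_coeff_def)
    finally show ?thesis .
  qed simp
  then show ?thesis using False xcode_nonempty(2)[of t] by (simp add: tpot_def pot_base_def)
qed (auto simp: is_const_def tpot_def)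

lemma length_mcode: "length (mcode m) \<le> pot m"
proof (induction m)
  case (PVar x)
  then show ?case using length_tpot by (auto split: sum.split prod.split)
qed auto

text \<open>The invariant of the rounds: variables stay in \<open>S\<close>, and pending tasks have
  rank at most \<open>N\<close>. Ranks are positive, so \<open>N = 0\<close> means that no task is
  left.\<close>

definition good :: "nat set \<Rightarrow> nat \<Rightarrow> mix \<Rightarrow> bool" where
  "good S N m \<longleftrightarrow> (\<forall>n. Inl n \<in> pl_sig m \<longrightarrow> n \<in> S) \<and>
    (\<forall>w t. Inr (w, t) \<in> pl_sig m \<longrightarrow> w < J \<and> rank t \<le> N \<and> (\<forall>p. Inl p \<in> ml_sig t \<longrightarrow> (\<forall>j < J. vv j p \<in> S)))"

lemma good_simps [simp]:
  "good S N PTop" "good S N (PNeg m) \<longleftrightarrow> good S N m" "good S N (PAnd m m') \<longleftrightarrow> good S N m \<and> good S N m'"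
  "good S N (PVar (Inl n)) \<longleftrightarrow> n \<in> S"
  "good S N (PVar (Inr (w, t))) \<longleftrightarrow> w < J \<and> rank t \<le> N \<and> (\<forall>p. Inl p \<in> ml_sig t \<longrightarrow> (\<forall>j < J. vv j p \<in> S))"
  by (auto simp: good_def)

lemma good_orM: "good S N (orM ms) \<longleftrightarrow> (\<forall>m \<in> set ms. good S N m)"
  unfolding good_def orM_sig by blast

lemma good_andM: "good S N (andM ms) \<longleftrightarrow> (\<forall>m \<in> set ms. good S N m)"
  unfolding good_def andM_sig by blast

lemma pot_orM: "(\<And>m. m \<in> set ms \<Longrightarrow> pot m \<le> X) \<Longrightarrow> pot (orM ms) \<le> length ms * (X + 4) + 2"
proof (induction ms)
  case (Cons m ms)
  then have "pot (orM ms) \<le> length ms * (X + 4) + 2" "pot m \<le> X" by auto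
  then show ?case by (simp add: orM_def POr_def)
qed (simp add: orM_def)

lemma pot_andM: "(\<And>m. m \<in> set ms \<Longrightarrow> pot m \<le> X) \<Longrightarrow> pot (andM ms) \<le> length ms * (X + 1) + 1"
proof (induction ms)
  case (Cons m ms)
  then have "pot (andM ms) \<le> length ms * (X + 1) + 1" "pot m \<le> X" by auto
  then show ?case by (simp add: andM_def)
qed (simp add: andM_def)

section \<open>Case distinctions over truth sets\<close>

definition eqM :: "nat \<Rightarrow> (nat \<Rightarrow> mix) \<Rightarrow> mix" where
  "eqM c f = andM (map (\<lambda>w. litM (w \<in> cs c) (f w)) [0..<J])"

definition eqw :: "nat \<Rightarrow> (nat \<Rightarrow> word) \<Rightarrow> word" where
  "eqw c f = andw (map (\<lambda>w. litw (w \<in> cs c) (f w)) [0..<J])"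

definition unM :: "(nat \<Rightarrow> mix) \<Rightarrow> (nat \<Rightarrow> mix) \<Rightarrow> mix" where
  "unM f g = orM (map (\<lambda>c. PAnd (eqM c f) (g c)) [0..<2 ^ J])"

definition unw :: "(nat \<Rightarrow> word) \<Rightarrow> (nat \<Rightarrow> word) \<Rightarrow> word" where
  "unw f g = orw (map (\<lambda>c. 3 # eqw c f @ g c) [0..<2 ^ J])"

definition binM :: "(nat \<Rightarrow> mix) \<Rightarrow> (nat \<Rightarrow> mix) \<Rightarrow> (nat \<Rightarrow> nat \<Rightarrow> mix) \<Rightarrow> mix" where
  "binM f f' g = orM (map (\<lambda>(c, d). PAnd (eqM c f) (PAnd (eqM d f') (g c d))) (List.product [0..<2 ^ J] [0..<2 ^ J]))"

definition binw :: "(nat \<Rightarrow> word) \<Rightarrow> (nat \<Rightarrow> word) \<Rightarrow> (nat \<Rightarrow> nat \<Rightarrow> word) \<Rightarrow> word" where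
  "binw f f' g = orw (map (\<lambda>(c, d). 3 # eqw c f @ 3 # eqw d f' @ g c d) (List.product [0..<2 ^ J] [0..<2 ^ J]))"

lemma mcode_eqM: "mcode (eqM c f) = eqw c (\<lambda>w. mcode (f w))"
  by (simp add: eqM_def eqw_def mcode_andM comp_def mcode_litM)

lemma mcode_unM: "mcode (unM f g) = unw (\<lambda>w. mcode (f w)) (\<lambda>c. mcode (g c))"
  by (simp add: unM_def unw_def mcode_orM comp_def mcode_eqM)

lemma mcode_binM: "mcode (binM f f' g) = binw (\<lambda>w. mcode (f w)) (\<lambda>w. mcode (f' w)) (\<lambda>c d. mcode (g c d))"
  by (simp add: binM_def binw_def mcode_orM comp_def mcode_eqM split_def)

lemma mixsat_eqM: "mixsat v (eqM c f) \<longleftrightarrow> (\<forall>w < J. mixsat v (f w) \<longleftrightarrow> w \<in> cs c)"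
  unfolding eqM_def mixsat_def andM_sat set_map ball_simps by (auto simp: litM_def)

lemma good_eqM: "(\<And>w. w < J \<Longrightarrow> good S N (f w)) \<Longrightarrow> good S N (eqM c f)"
  by (auto simp: eqM_def good_andM litM_def)

lemma pot_eqM: "(\<And>w. w < J \<Longrightarrow> pot (f w) \<le> X) \<Longrightarrow> pot (eqM c f) \<le> J * (X + 2) + 1"
  unfolding eqM_def using pot_andM[of "map (\<lambda>w. litM (w \<in> cs c) (f w)) [0..<J]" "X + 1"]
  by (fastforce simp: litM_def)

lemma const_matches: "\<exists>c < 2 ^ J. \<forall>w < J. P w \<longleftrightarrow> w \<in> cs c"
  using cst[of "{w. P w}"] by (intro exI[of _ "cst {w. P w}"]) auto

text \<open>Some constant denotes the actual truth set described by \<open>f\<close>, and a disjunct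
  whose guess matches it has the value \<open>Z\<close>; all other disjuncts are false.\<close>

lemma mixsat_unM:
  assumes "\<And>c. c < 2 ^ J \<Longrightarrow> (\<forall>w < J. mixsat v (f w) \<longleftrightarrow> w \<in> cs c) \<Longrightarrow> mixsat v (g c) \<longleftrightarrow> Z"
  shows "mixsat v (unM f g) \<longleftrightarrow> Z"
proof -
  have "mixsat v (unM f g) \<longleftrightarrow> (\<exists>c < 2 ^ J. mixsat v (eqM c f) \<and> mixsat v (g c))"
    by (auto simp: unM_def mixsat_def orM_sat)
  then show ?thesis using assms const_matches[of "\<lambda>w. mixsat v (f w)"] unfolding mixsat_eqM by blast
qed

lemma mixsat_binM:
  assumes "\<And>c d. c < 2 ^ J \<Longrightarrow> d < 2 ^ J \<Longrightarrow> (\<forall>w < J. mixsat v (f w) \<longleftrightarrow> w \<in> cs c) \<Longrightarrow>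
    (\<forall>w < J. mixsat v (f' w) \<longleftrightarrow> w \<in> cs d) \<Longrightarrow> mixsat v (g c d) \<longleftrightarrow> Z"
  shows "mixsat v (binM f f' g) \<longleftrightarrow> Z"
proof -
  have "mixsat v (binM f f' g) \<longleftrightarrow> (\<exists>c < 2 ^ J. \<exists>d < 2 ^ J. mixsat v (eqM c f) \<and> mixsat v (eqM d f') \<and> mixsat v (g c d))"
    by (fastforce simp: binM_def mixsat_def orM_sat)
  then show ?thesis using assms const_matches[of "\<lambda>w. mixsat v (f w)"] const_matches[of "\<lambda>w. mixsat v (f' w)"]
    unfolding mixsat_eqM by blast
qed

lemma pot_unM:
  assumes "\<And>w. w < J \<Longrightarrow> pot (f w) \<le> X" "\<And>c. c < 2 ^ J \<Longrightarrow> pot (g c) \<le> X" "1 \<le> X"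
  shows "pot (unM f g) \<le> branching * X"
proof -
  have "pot (PAnd (eqM c f) (g c)) \<le> 1 + (J * (X + 2) + 1) + X" if "c < 2 ^ J" for c
    using pot_eqM[of f X c] assms that by fastforce
  then have "pot (unM f g) \<le> 2 ^ J * (1 + (J * (X + 2) + 1) + X + 4) + 2"
    unfolding unM_def using pot_orM[of "map (\<lambda>c. PAnd (eqM c f) (g c)) [0..<2 ^ J]" "1 + (J * (X + 2) + 1) + X"] by fastforce
  also have "\<dots> \<le> 2 ^ J * ((6 * J + 9) * X) + 2 * X"
  proof (intro add_mono mult_left_mono)
    show "1 + (J * (X + 2) + 1) + X + 4 \<le> (6 * J + 9) * X" using assms(3) by (cases X) (simp_all add: algebra_simps)
  qed (use assms(3) in auto)
  also have "\<dots> \<le> 2 ^ J * 2 ^ J * ((6 * J + 9) * X) + 2 * X" by (intro add_mono mult_right_mono) simp_all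
  also have "\<dots> = branching * X"
    by (simp add: branching_def algebra_simps)
  finally show ?thesis .
qed

text \<open>The origin of \<open>branching\<close>: there are \<open>2 ^ J * 2 ^ J\<close>
  disjuncts, each with \<open>2 * J\<close> literals and one remaining task, all of potential at
  most \<open>X\<close>, apart from connectives.\<close>

lemma pot_binM:
  assumes "\<And>w. w < J \<Longrightarrow> pot (f w) \<le> X" "\<And>w. w < J \<Longrightarrow> pot (f' w) \<le> X"
    "\<And>c d. c < 2 ^ J \<Longrightarrow> d < 2 ^ J \<Longrightarrow> pot (g c d) \<le> X" "1 \<le> X"
  shows "pot (binM f f' g) \<le> branching * X"
proof -
  have "pot (PAnd (eqM c f) (PAnd (eqM d f') (g c d))) \<le> 2 + 2 * (J * (X + 2) + 1) + X" if "c < 2 ^ J" "d < 2 ^ J" for c d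
    using pot_eqM[of f X c] pot_eqM[of f' X d] assms(1,2) assms(3)[OF that] by fastforce
  then have "pot (binM f f' g) \<le> 2 ^ J * 2 ^ J * (2 + 2 * (J * (X + 2) + 1) + X + 4) + 2"
    unfolding binM_def
    using pot_orM[of "map (\<lambda>(c, d). PAnd (eqM c f) (PAnd (eqM d f') (g c d))) (List.product [0..<2 ^ J] [0..<2 ^ J])"
        "2 + 2 * (J * (X + 2) + 1) + X"]
    by fastforce
  also have "\<dots> \<le> 2 ^ J * 2 ^ J * ((6 * J + 9) * X) + 2 * X"
  proof (intro add_mono mult_left_mono)
    show "2 + 2 * (J * (X + 2) + 1) + X + 4 \<le> (6 * J + 9) * X" using assms(4) by (cases X) (simp_all add: algebra_simps)
  qed (use assms(4) in auto)
  also have "\<dots> = branching * X"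
    by (simp add: branching_def algebra_simps)
  finally show ?thesis .
qed

end

section \<open>Expansion of one task\<close>

definition unshift :: "word \<Rightarrow> word" where
  "unshift = sfx (\<lambda>v. if hd0 v = 16 then [6] else if hd0 v = 17 then [7] else [])"

lemma unshift_binary: "unshift (map (\<lambda>a. a + 10) (binary p)) = binary p"
proof -
  have "set d \<subseteq> {6, 7} \<Longrightarrow> unshift (map (\<lambda>a. a + 10) d) = d" for d
    by (induction d) (auto simp: unshift_def)
  then show ?thesis using set_binary by blast
qed

context rooted_list
begin

text \<open>No task is created for \<open>s\<close> itself, which may be as long as the whole term.
  Instead the truth sets of its immediate subterms are guessed, and the constant for the resulting
  truth set of \<open>s\<close> is plugged into the context.\<close>

definition exs :: "nat \<Rightarrow> word \<Rightarrow> word \<Rightarrow> word \<Rightarrow> word" where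
  "exs w pre s post =
    (if hd0 s = 11 then (20 + w) # pre @ (20 + J + cst UNIV) # post
     else if hd0 s = 12 then
       unw (\<lambda>j. (20 + j) # tl s) (\<lambda>c. (20 + w) # pre @ (20 + J + cst (- cs c)) # post)
     else if hd0 s = 13 then
       binw (\<lambda>j. (20 + j) # first (tl s)) (\<lambda>j. (20 + j) # drop (length (first (tl s))) (tl s))
         (\<lambda>c d. (20 + w) # pre @ (20 + J + cst (cs c \<inter> cs d)) # post)
     else if hd0 s = 14 then
       unw (\<lambda>j. (20 + j) # tl s) (\<lambda>c. (20 + w) # pre @ (20 + J + cst {x. \<forall>y. (x, y) \<in> R \<longrightarrow> y \<in> cs c}) # post)
     else if hd0 s = 15 then
       unw (\<lambda>j. 5 # replicate j 6 @ 7 # unshift (tl s)) (\<lambda>c. (20 + w) # pre @ (20 + J + c) # post)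
     else litw (w \<in> cs (hd0 s - (20 + J))) [1])"

definition exw :: "nat \<Rightarrow> word \<Rightarrow> word" where
  "exw w t = (let u = shortest (half t) t in
     exs w (take (length t - length u) t) (first u) (drop (length (first u)) u))"

lemma mixsat_simps [simp]:
  "mixsat v PTop" "mixsat v (PNeg m) \<longleftrightarrow> \<not> mixsat v m" "mixsat v (PAnd m m') \<longleftrightarrow> mixsat v m \<and> mixsat v m'"
  "mixsat v (PVar (Inl n)) \<longleftrightarrow> v n" "mixsat v (PVar (Inr (w, t))) \<longleftrightarrow> xsat v w t"
  by (simp_all add: mixsat_def)

lemma good_unM:
  assumes "\<And>w. w < J \<Longrightarrow> good S N (f w)" "\<And>c. c < 2 ^ J \<Longrightarrow> good S N (g c)"
  shows "good S N (unM f g)"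
  using assms good_eqM[of S N f] by (auto simp: unM_def good_orM)

lemma good_binM:
  assumes "\<And>w. w < J \<Longrightarrow> good S N (f w)" "\<And>w. w < J \<Longrightarrow> good S N (f' w)"
    "\<And>c d. c < 2 ^ J \<Longrightarrow> d < 2 ^ J \<Longrightarrow> good S N (g c d)"
  shows "good S N (binM f f' g)"
  using assms good_eqM[of S N f] good_eqM[of S N f'] by (auto simp: binM_def good_orM)

text \<open>New tasks arise only from the immediate subterms of \<open>s\<close> and from the
  context with a constant plugged in. All of them have about half the size, so a common bound
  \<open>X\<close> holds for their potentials and \<open>branching * X\<close> for the
  replacement.\<close>

lemma expand:
  assumes w: "w < J" and S: "\<And>p j. Inl p \<in> ml_sig t \<Longrightarrow> j < J \<Longrightarrow> vv j p \<in> S" and rk: "rank t \<le> Suc N"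
  shows "\<exists>m. exw w (xcode t) = mcode m \<and> good S N m \<and> pot m \<le> tpot t \<and> (\<forall>v. mixsat v m \<longleftrightarrow> xsat v w t)"
proof -
  obtain C pre s post where sh: "shortest (half (xcode t)) (xcode t) = xcode s @ post" and pl: "plug t C pre s post"
    and len: "length (xcode t) < 2 * length (xcode s)"
    and c1: "\<And>s1. s = MNeg s1 \<or> s = MBox s1 \<Longrightarrow> 2 * length (xcode s1) \<le> length (xcode t)"
    and c2: "\<And>s1 s2. s = MAnd s1 s2 \<Longrightarrow> 2 * length (xcode s1) \<le> length (xcode t) \<and> 2 * length (xcode s2) \<le> length (xcode t)"
    by (rule halving[of t]) (rule that)
  have Ccode: "xcode (C s') = pre @ xcode s' @ post" and Csig: "ml_sig (C s') \<subseteq> ml_sig t \<union> ml_sig s'" for s'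
    using pl by (auto simp: plug_def)
  have ssig: "ml_sig s \<subseteq> ml_sig t" and post: "\<not> idig (hd0 post)" using pl by (auto simp: plug_def)
  have Csem: "xsat v w (C s') \<longleftrightarrow> xsat v w t" if "\<And>j. j < J \<Longrightarrow> xsat v j s' \<longleftrightarrow> xsat v j s" for v s'
    using pl w that unfolding plug_def by blast
  have tcode: "xcode t = pre @ xcode s @ post" using Ccode[of s] pl by (simp add: plug_def)
  have ex: "exw w (xcode t) = exs w pre (xcode s) post"
    unfolding exw_def sh Let_def using first_xcode[OF post, of s] tcode by simp
  show ?thesis
  proof (cases "is_const t")
    case True
    then obtain c where t: "t = MVar (Inr c)" by (auto simp: is_const_def)
    have "pre @ xcode s @ post = [20 + J + c]" using tcode t by simp
    then have "xcode s = [20 + J + c]" using xcode_nonempty(1)[of s] by (auto simp: append_eq_Cons_conv)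
    then have "exs w pre (xcode s) post = litw (w \<in> cs c) [1]" by (simp add: exs_def)
    then show ?thesis using ex t
      by (intro exI[of _ "litM (w \<in> cs c) PTop"]) (auto simp: litw_def litM_def tpot_def is_const_def)
  next
    case False
    define n where "n = length (xcode t)"
    define e where "e = n - 1"
    \<comment> \<open>For \<open>e = 0\<close> all parts are constants or copies of an atom with
      empty index. Otherwise the summands \<open>e + J + 3\<close> cover the variables
      \<open>vv j p\<close>, whose index code is \<open>j + 1\<close> digits longer than that of
      \<open>p\<close>.\<close>
    define X where "X = (if e = 0 then J + 3 else pot_coeff * (e div 2) ^ pot_deg + pot_base + e + J + 3)"
    have n: "n = e + 1" using xcode_nonempty(2)[of t] by (simp add: n_def e_def)
    have X: "1 \<le> X" "J + 1 + e \<le> X" by (auto simp: X_def)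
    have BX: "branching * X \<le> tpot t"
    proof (cases "e = 0")
      case True
      then show ?thesis using False by (simp add: X_def tpot_def pot_base_def)
    next
      case e: False
      then show ?thesis using False pot_step[of e] by (simp add: X_def tpot_def e_def n_def)
    qed
    have tpot_le: "tpot t' \<le> X" if "e \<noteq> 0" "length (xcode t') - 1 \<le> e div 2" for t'
    proof -
      have "(length (xcode t') - 1) ^ pot_deg \<le> (e div 2) ^ pot_deg" using that(2) by (rule power_mono) simp
      then have "pot_coeff * (length (xcode t') - 1) ^ pot_deg \<le> pot_coeff * (e div 2) ^ pot_deg" by (rule mult_left_mono) simp
      moreover have "X = pot_coeff * (e div 2) ^ pot_deg + pot_base + e + J + 3" using that(1) by (simp add: X_def)
      moreover have "tpot t' = 3 \<or> tpot t' = pot_coeff * (length (xcode t') - 1) ^ pot_deg + pot_base"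
        by (simp add: tpot_def)
      ultimately show ?thesis by linarith
    qed
    have N: "rank t = n + 1" "n \<le> N" using False rk by (auto simp: rank_def n_def)
    have nlen: "n = length pre + length (xcode s) + length post" using tcode by (simp add: n_def)
    have one: "is_const t'" if "xcode t' = [20 + J + c]" for t' c
      using that by (cases t') (auto simp: is_const_def split: sum.splits)
    let ?T = "\<lambda>c. PVar (Inr (w, C (MVar (Inr c)))) :: mix"
    have Tcode: "(20 + w) # pre @ (20 + J + c) # post = mcode (?T c)" for c by (simp add: Ccode)
    have T: "good S N (?T c) \<and> pot (?T c) \<le> X" for c
    proof -
      let ?t = "C (MVar (Inr c))"
      have l: "length (xcode ?t) = n - length (xcode s) + 1" using nlen by (simp add: Ccode)
      have sig: "Inl p \<in> ml_sig ?t \<Longrightarrow> j < J \<Longrightarrow> vv j p \<in> S" for p j using Csig[of "MVar (Inr c)"] S by auto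
      have "rank ?t \<le> N \<and> tpot ?t \<le> X"
      proof (cases "is_const ?t")
        case True
        then show ?thesis using N n by (auto simp: rank_def tpot_def X_def)
      next
        case nc: False
        \<comment> \<open>In a one-letter term the hole is everything, and plugging would leave a
          bare constant.\<close>
        have "n \<noteq> 1"
        proof
          assume "n = 1"
          then have "length pre = 0" "length post = 0" using nlen xcode_nonempty(2)[of s] by linarith+
          then have "pre = []" "post = []" by simp_all
          then show False using nc one[of ?t c] Ccode by simp
        qed
        then have e: "e \<noteq> 0" using n by simp
        have "length (xcode ?t) - 1 \<le> e div 2" using l len n by (simp add: n_def)
        then have "tpot ?t \<le> X" by (rule tpot_le[OF e])
        moreover have "length (xcode ?t) < n" using l len n e by (simp add: n_def)
        ultimately show ?thesis using nc N(2) by (simp add: rank_def)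
      qed
      then show ?thesis using sig w by simp
    qed
    have Tsem: "mixsat v (?T c) \<longleftrightarrow> xsat v w t" if "\<And>j. j < J \<Longrightarrow> j \<in> cs c \<longleftrightarrow> xsat v j s" for v c
      using Csem[of v "MVar (Inr c)"] that by simp
    have sub: "good S N (PVar (Inr (j, s1))) \<and> pot (PVar (Inr (j, s1))) \<le> X"
      if s1: "2 * length (xcode s1) \<le> length (xcode t)" "ml_sig s1 \<subseteq> ml_sig t" "j < J" for s1 j
    proof -
      have e: "e \<noteq> 0" using s1(1) n xcode_nonempty(2)[of s1] unfolding n_def by linarith
      have "length (xcode s1) - 1 \<le> e div 2" using s1(1) n by (simp add: n_def)
      then have "tpot s1 \<le> X" by (rule tpot_le[OF e])
      moreover have "length (xcode s1) < n" using s1(1) n xcode_nonempty(2)[of s1] unfolding n_def by linarith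
      ultimately show ?thesis using N(2) S s1 by (auto simp: rank_def)
    qed
    have fin: ?thesis if "exs w pre (xcode s) post = mcode m" "good S N m" "pot m \<le> branching * X"
      "\<And>v. mixsat v m \<longleftrightarrow> xsat v w t" for m
      using that ex BX by (metis order_trans)
    show ?thesis
    proof (cases s)
      case MTop
      have "X \<le> branching * X" using branching_pos by simp
      then have "pot (?T (cst UNIV)) \<le> branching * X" using T[of "cst UNIV"] order_trans by blast
      moreover have "mixsat v (?T (cst UNIV)) \<longleftrightarrow> xsat v w t" for v
        by (rule Tsem) (simp add: MTop cst)
      moreover have "exs w pre (xcode s) post = mcode (?T (cst UNIV))" unfolding Tcode[symmetric] by (simp add: exs_def MTop)
      ultimately show ?thesis using fin T by blast
    next
      case (MVar x)
      show ?thesis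
      proof (cases x)
        case (Inr c)
        then have s: "xcode s = [20 + J + c]" using MVar by simp
        \<comment> \<open>A single letter that exceeds half of the term is the whole term, which was
          assumed not to be a constant.\<close>
        then have "pre = []" "post = []" using len nlen unfolding n_def by auto
        then have "is_const t" using one[of t c] tcode s by simp
        then show ?thesis using False by simp
      next
        case (Inl p)
        then have s: "xcode s = 15 # map (\<lambda>a. a + 10) (binary p)" using MVar by simp
        let ?m = "unM (\<lambda>j. PVar (Inl (vv j p))) ?T"
        have vS: "vv j p \<in> S" if "j < J" for j using S[of p j] ssig MVar Inl that by auto
        have "length (binary p) \<le> e" using s nlen n by simp
        then have vX: "pot (PVar (Inl (vv j p)) :: mix) \<le> X" if "j < J" for j
          using that X(2) by (simp add: binary_vv)
        show ?thesis
        proof (rule fin[of ?m])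
          show "exs w pre (xcode s) post = mcode ?m"
            unfolding mcode_unM Tcode[symmetric] by (simp add: s exs_def unshift_binary binary_vv)
          show "good S N ?m" using T vS by (intro good_unM) auto
          show "pot ?m \<le> branching * X" using T vX X(1) by (intro pot_unM) auto
          show "mixsat v ?m \<longleftrightarrow> xsat v w t" for v
            by (rule mixsat_unM, rule Tsem) (simp add: MVar Inl)
        qed
      qed
    next
      case (MNeg s1)
      let ?g = "\<lambda>c. ?T (cst (- cs c))"
      let ?m = "unM (\<lambda>j. PVar (Inr (j, s1))) ?g"
      have s1: "2 * length (xcode s1) \<le> length (xcode t)" "ml_sig s1 \<subseteq> ml_sig t" using c1 ssig MNeg by auto
      show ?thesis
      proof (rule fin[of ?m])
        show "exs w pre (xcode s) post = mcode ?m"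
          unfolding mcode_unM Tcode[symmetric] by (simp add: MNeg exs_def)
        show "good S N ?m" using T sub[OF s1] by (intro good_unM) blast+
        show "pot ?m \<le> branching * X" using T sub[OF s1] X(1) by (intro pot_unM) blast+
        show "mixsat v ?m \<longleftrightarrow> xsat v w t" for v
          by (rule mixsat_unM, rule Tsem) (simp add: MNeg cst)
      qed
    next
      case (MBox s1)
      let ?g = "\<lambda>c. ?T (cst {x. \<forall>y. (x, y) \<in> R \<longrightarrow> y \<in> cs c})"
      let ?m = "unM (\<lambda>j. PVar (Inr (j, s1))) ?g"
      have s1: "2 * length (xcode s1) \<le> length (xcode t)" "ml_sig s1 \<subseteq> ml_sig t" using c1 ssig MBox by auto
      have RJ: "y < J" if "(x, y) \<in> R" for x y using that R by auto
      show ?thesis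
      proof (rule fin[of ?m])
        show "exs w pre (xcode s) post = mcode ?m"
          unfolding mcode_unM Tcode[symmetric] by (simp add: MBox exs_def)
        show "good S N ?m" using T sub[OF s1] by (intro good_unM) blast+
        show "pot ?m \<le> branching * X" using T sub[OF s1] X(1) by (intro pot_unM) blast+
        show "mixsat v ?m \<longleftrightarrow> xsat v w t" for v
          by (rule mixsat_unM, rule Tsem) (use RJ in \<open>auto simp: MBox cst\<close>)
      qed
    next
      case (MAnd s1 s2)
      let ?g = "\<lambda>c d. ?T (cst (cs c \<inter> cs d))"
      let ?m = "binM (\<lambda>j. PVar (Inr (j, s1))) (\<lambda>j. PVar (Inr (j, s2))) ?g"
      have s1: "2 * length (xcode s1) \<le> length (xcode t)" "ml_sig s1 \<subseteq> ml_sig t"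
        and s2: "2 * length (xcode s2) \<le> length (xcode t)" "ml_sig s2 \<subseteq> ml_sig t" using c2 ssig MAnd by auto
      have f: "first (xcode s1 @ xcode s2) = xcode s1" by (rule first_xcode) simp
      show ?thesis
      proof (rule fin[of ?m])
        show "exs w pre (xcode s) post = mcode ?m"
          unfolding mcode_binM Tcode[symmetric] by (simp add: MAnd exs_def f)
        show "good S N ?m" using T sub[OF s1] sub[OF s2] by (intro good_binM) blast+
        show "pot ?m \<le> branching * X" using T sub[OF s1] sub[OF s2] X(1) by (intro pot_binM) blast+
        show "mixsat v ?m \<longleftrightarrow> xsat v w t" for v
          by (rule mixsat_binM, rule Tsem) (simp add: MAnd cst)
      qed
    qed
  qed
qed

section \<open>Rounds of simultaneous expansion\<close>

definition internal :: "nat \<Rightarrow> bool" where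
  "internal a \<longleftrightarrow> 11 \<le> a \<and> a \<le> 17 \<or> 20 + J \<le> a"

text \<open>The marker of a task reads its term ahead; the letters of the term then emit nothing,
  and finished parts of the formula are copied.\<close>

definition emit :: "word \<Rightarrow> word" where
  "emit v = (if 20 \<le> hd0 v \<and> hd0 v < 20 + J then exw (hd0 v - 20) (takeWhile internal (tl v))
     else if internal (hd0 v) \<or> hd0 v = 0 then [] else [hd0 v])"

definition round :: "word \<Rightarrow> word" where
  "round = sfx emit"

lemma internal_xcode: "\<forall>a \<in> set (xcode t). internal a"
proof (induction t)
  case (MVar x)
  show ?case using set_binary by (cases x) (fastforce simp: internal_def)+
qed (auto simp: internal_def)

lemma round_internal: "\<forall>a \<in> set d. internal a \<Longrightarrow> round (d @ rest) = round rest"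
  by (induction d) (auto simp: round_def emit_def internal_def)

lemma takeWhile_internal: "\<not> internal (hd0 rest) \<Longrightarrow> takeWhile internal (xcode t @ rest) = xcode t"
proof -
  assume "\<not> internal (hd0 rest)"
  then have "takeWhile internal rest = []" by (cases rest) auto
  then show ?thesis using internal_xcode[of t] by (simp add: takeWhile_append2)
qed

lemma internal_mcode: "good S N m \<Longrightarrow> \<not> internal (hd0 (mcode m @ rest))"
  by (cases m) (auto simp: internal_def split: sum.splits)

lemma round_Cons: "1 \<le> a \<Longrightarrow> a < 11 \<Longrightarrow> round (a # v) = a # round v"
  by (simp add: round_def emit_def internal_def)

text \<open>Tasks do not overlap, so \<open>expand\<close> applies to each of them separately. The
  condition on \<open>rest\<close> makes the lookahead stop exactly at the end of the last
  term.\<close>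

lemma round_mcode:
  "good S (Suc N) m \<Longrightarrow> \<not> internal (hd0 rest) \<Longrightarrow>
    \<exists>m'. round (mcode m @ rest) = mcode m' @ round rest \<and> good S N m' \<and> pot m' \<le> pot m \<and> (\<forall>v. mixsat v m' \<longleftrightarrow> mixsat v m)"
proof (induction m arbitrary: rest)
  case PTop
  show ?case by (rule exI[of _ PTop]) (simp add: round_Cons)
next
  case (PVar x)
  show ?case
  proof (cases x)
    case (Inl n)
    have "set d \<subseteq> {6, 7} \<Longrightarrow> round (d @ rest) = d @ round rest" for d
      by (induction d) (auto simp: round_Cons)
    then have "round (binary n @ rest) = binary n @ round rest" using set_binary by blast
    then show ?thesis using PVar Inl by (intro exI[of _ "PVar x"]) (simp add: round_Cons)
  next
    case (Inr wt)
    obtain w t where x: "x = Inr (w, t)" using Inr by (cases wt) auto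
    then have g: "w < J" "rank t \<le> Suc N" "\<And>p j. Inl p \<in> ml_sig t \<Longrightarrow> j < J \<Longrightarrow> vv j p \<in> S" using PVar by auto
    obtain m' where m': "exw w (xcode t) = mcode m'" "good S N m'" "pot m' \<le> tpot t" "\<forall>v. mixsat v m' \<longleftrightarrow> xsat v w t"
      using expand[of w t S N] g by blast
    have "round ((20 + w) # xcode t @ rest) = emit ((20 + w) # xcode t @ rest) @ round rest"
      using round_internal[OF internal_xcode, of t rest] by (simp add: round_def)
    also have "emit ((20 + w) # xcode t @ rest) = mcode m'"
      using g(1) takeWhile_internal[OF PVar.prems(2)] m'(1) by (simp add: emit_def)
    finally show ?thesis using x m' by (intro exI[of _ m']) simp
  qed
next
  case (PNeg m)
  then obtain m' where "round (mcode m @ rest) = mcode m' @ round rest" "good S N m'" "pot m' \<le> pot m"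
    "\<forall>v. mixsat v m' \<longleftrightarrow> mixsat v m" by fastforce
  then show ?case by (intro exI[of _ "PNeg m'"]) (simp add: round_Cons)
next
  case (PAnd m1 m2)
  obtain m2' where 2: "round (mcode m2 @ rest) = mcode m2' @ round rest" "good S N m2'" "pot m2' \<le> pot m2"
    "\<forall>v. mixsat v m2' \<longleftrightarrow> mixsat v m2" using PAnd.IH(2)[of rest] PAnd.prems by auto
  obtain m1' where 1: "round (mcode m1 @ mcode m2 @ rest) = mcode m1' @ round (mcode m2 @ rest)" "good S N m1'" "pot m1' \<le> pot m1"
    "\<forall>v. mixsat v m1' \<longleftrightarrow> mixsat v m1"
    using PAnd.IH(1)[of "mcode m2 @ rest"] PAnd.prems internal_mcode[of S "Suc N" m2] by auto
  show ?case using 1 2 by (intro exI[of _ "PAnd m1' m2'"]) (simp add: round_Cons)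
qed

section \<open>The forward translation\<close>

definition word0 :: "word \<Rightarrow> word" where
  "word0 w = orw (map (\<lambda>i. 3 # (5 # binary (vv (J + i) 0)) @ (20 + rs ! i) # map (\<lambda>a. a + 10) w) [0..<length rs])"

definition mix0 :: "nat ml \<Rightarrow> mix" where
  "mix0 \<phi> = orM (map (\<lambda>i. PAnd (PVar (Inl (vv (J + i) 0))) (PVar (Inr (rs ! i, map_ml Inl \<phi>)))) [0..<length rs])"

text \<open>The selectors belong to \<open>hat \<sigma>\<close> for every \<sigma>. A propositional
  interpolant may therefore depend on the root even if the two modal formulas share no atom.\<close>

definition hat :: "nat set \<Rightarrow> nat set" where
  "hat \<sigma> = (\<lambda>(j, p). vv j p) ` ({..<J} \<times> \<sigma>) \<union> (\<lambda>i. vv (J + i) 0) ` {..<length rs}"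

lemma xcode_map: "xcode (map_ml Inl \<phi>) = map (\<lambda>a. a + 10) (ml_code \<phi>)"
  by (induction \<phi>) auto

lemma mix0_code: "mcode (mix0 \<phi>) = word0 (ml_code \<phi>)"
  by (simp add: mix0_def word0_def mcode_orM comp_def xcode_map)

lemma rs_less: "i < length rs \<Longrightarrow> rs ! i < J"
  using rts nth_mem by blast

lemma not_const_map: "\<not> is_const (map_ml Inl \<phi>)"
  by (cases \<phi>) (auto simp: is_const_def)

lemma good_mix0: "good (hat (ml_sig \<phi>)) (length (ml_code \<phi>) + 1) (mix0 \<phi>)"
  using rs_less by (auto simp: mix0_def good_orM rank_def not_const_map xcode_map ml.set_map hat_def image_iff)

lemma xsat_map: "xsat v w (map_ml Inl \<phi>) \<longleftrightarrow> ml_sat R (val v) w \<phi>"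
  by (induction \<phi> arbitrary: w) (simp_all add: val_def)

lemma sat_mix0: "mixsat v (mix0 \<phi>) \<longleftrightarrow> (\<exists>i < length rs. v (vv (J + i) 0) \<and> ml_sat R (val v) (rs ! i) \<phi>)"
proof -
  have "mixsat v (mix0 \<phi>) \<longleftrightarrow> (\<exists>i < length rs. mixsat v (PAnd (PVar (Inl (vv (J + i) 0))) (PVar (Inr (rs ! i, map_ml Inl \<phi>)))))"
    unfolding mix0_def mixsat_def orM_sat by fastforce
  then show ?thesis by (simp add: xsat_map)
qed

text \<open>Initial tasks have rank at most one more than the length of the formula, and each round
  lowers the bound by one without increasing the potential.\<close>

lemma rounds:
  assumes "j \<le> length (ml_code \<phi>) + 1"
  shows "\<exists>m. (round ^^ j) (word0 (ml_code \<phi>)) = mcode m \<and> good (hat (ml_sig \<phi>)) (length (ml_code \<phi>) + 1 - j) m \<and>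
    pot m \<le> pot (mix0 \<phi>) \<and> (\<forall>v. mixsat v m \<longleftrightarrow> mixsat v (mix0 \<phi>))"
  using assms
proof (induction j)
  case 0
  then show ?case using good_mix0 by (intro exI[of _ "mix0 \<phi>"]) (simp add: mix0_code)
next
  case (Suc j)
  then obtain m where m: "(round ^^ j) (word0 (ml_code \<phi>)) = mcode m"
    "good (hat (ml_sig \<phi>)) (Suc (length (ml_code \<phi>) + 1 - Suc j)) m" "pot m \<le> pot (mix0 \<phi>)"
    "\<forall>v. mixsat v m \<longleftrightarrow> mixsat v (mix0 \<phi>)" by (auto simp: Suc_diff_le)
  have "round [] = []" by (simp add: round_def)
  then obtain m' where "round (mcode m) = mcode m'" "good (hat (ml_sig \<phi>)) (length (ml_code \<phi>) + 1 - Suc j) m'"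
    "pot m' \<le> pot m" "\<forall>v. mixsat v m' \<longleftrightarrow> mixsat v m"
    using round_mcode[OF m(2), of "[]"] by (auto simp: internal_def)
  then show ?case using m by (intro exI[of _ m']) auto
qed

lemma tr_exists:
  "\<exists>\<alpha>. pl_code \<alpha> = (round ^^ (length (ml_code \<phi>) + 1)) (word0 (ml_code \<phi>)) \<and> pl_sig \<alpha> \<subseteq> hat (ml_sig \<phi>) \<and>
    (\<forall>v. pl_sat v \<alpha> \<longleftrightarrow> (\<exists>i < length rs. v (vv (J + i) 0) \<and> ml_sat R (val v) (rs ! i) \<phi>))"
proof -
  obtain m where m: "(round ^^ (length (ml_code \<phi>) + 1)) (word0 (ml_code \<phi>)) = mcode m"
    "good (hat (ml_sig \<phi>)) 0 m" "\<forall>v. mixsat v m \<longleftrightarrow> mixsat v (mix0 \<phi>)"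
    using rounds[of "length (ml_code \<phi>) + 1" \<phi>] by auto
  \<comment> \<open>Without tasks only left injections remain, and erasing the tag changes neither
    code nor truth.\<close>
  have "pl_code (map_pl projl m) = mcode m \<and> pl_sig (map_pl projl m) \<subseteq> S \<and> (\<forall>v. pl_sat v (map_pl projl m) \<longleftrightarrow> mixsat v m)"
    if "good S 0 m" for S
    using that
  proof (induction m)
    case (PVar x)
    then show ?case by (cases x) (auto simp: rank_def split: if_splits)
  qed auto
  from this[OF m(2)] show ?thesis using m(1,3) sat_mix0 by (intro exI[of _ "map_pl projl m"]) simp
qed

text \<open>Specified through its code: the machine outputs a word, and it is enough to know that
  some formula with this code has the required semantics.\<close>

definition tr :: "nat ml \<Rightarrow> nat pl" where
  "tr \<phi> = (SOME \<alpha>. pl_code \<alpha> = (round ^^ (length (ml_code \<phi>) + 1)) (word0 (ml_code \<phi>)) \<and> pl_sig \<alpha> \<subseteq> hat (ml_sig \<phi>) \<and>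
    (\<forall>v. pl_sat v \<alpha> \<longleftrightarrow> (\<exists>i < length rs. v (vv (J + i) 0) \<and> ml_sat R (val v) (rs ! i) \<phi>)))"

lemma tr: "pl_code (tr \<phi>) = (round ^^ (length (ml_code \<phi>) + 1)) (word0 (ml_code \<phi>))"
  "pl_sig (tr \<phi>) \<subseteq> hat (ml_sig \<phi>)"
  "pl_sat v (tr \<phi>) \<longleftrightarrow> (\<exists>i < length rs. v (vv (J + i) 0) \<and> ml_sat R (val v) (rs ! i) \<phi>)"
  using someI_ex[OF tr_exists, of \<phi>] unfolding tr_def[symmetric] by blast+

end

section \<open>Polynomial-time computation of the forward translation\<close>

context
  fixes G :: nat
  assumes G: "17 < G"
begin

lemma alphabet_bounds: "0 < G" "7 < G"
  using G by simp_all

lemma PT_forest: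
  assumes "PT G xs x"
  shows "PT G xs (\<lambda>e. forest (x e))"
  unfolding forest_def
proof (rule PT_foldr[OF alphabet_bounds(1) assms, where K = 2])
  let ?ys = "map (\<lambda>y z. y (fst z)) xs @ [\<lambda>z. fst (snd z), \<lambda>z. snd (snd z)]"
  have "PT G ?ys (\<lambda>z. forest_step a (fst (snd z)))" if "a < G" for a
  proof -
    consider "a = 12 \<or> a = 14 \<or> a = 16 \<or> a = 17" | "a = 13" | "a = 15" | "a = 0"
      | "a \<notin> {12, 13, 14, 15, 16, 17, 0}" by blast
    then show ?thesis
    proof cases
      case 1
      then show ?thesis using PT_cons[OF PT_acc, of a] that by (auto simp: forest_step_def)
    next
      case 2
      have "PT G ?ys (\<lambda>z. 13 # takeWhile (\<lambda>b. b \<noteq> 8) (fst (snd z)) @ tl (dropWhile (\<lambda>b. b \<noteq> 8) (fst (snd z))))"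
        by (intro PT_cons PT_append PT_tl PT_takeWhile PT_dropWhile PT_acc alphabet_bounds) (use G in auto)
      then show ?thesis using 2 by (simp add: forest_step_def)
    next
      case 3
      have "PT G ?ys (\<lambda>z. 15 # takeWhile idig (fst (snd z)) @ 8 # dropWhile idig (fst (snd z)))"
        by (intro PT_cons PT_append PT_takeWhile PT_dropWhile PT_acc alphabet_bounds) (use G in auto)
      then show ?thesis using 3 by (simp add: forest_step_def)
    next
      case 5
      have "PT G ?ys (\<lambda>z. a # 8 # fst (snd z))" by (intro PT_cons PT_acc) (use G 5 that in auto)
      then show ?thesis using 5 by (simp add: forest_step_def)
    qed (simp add: forest_step_def PT_const)
  qed
  then show "PT G ?ys (\<lambda>z. forest_step (hd0 (snd (snd z))) (fst (snd z)))"
    by (intro PT_case[OF PT_rest alphabet_bounds(1), where f = "\<lambda>a z. forest_step a (fst (snd z))"])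
  show "length (forest_step a c) \<le> length c + 2" for a c
  proof -
    have "length (takeWhile P c) + length (dropWhile P c) = length c" for P
      by (metis length_append takeWhile_dropWhile_id)
    from this[of "\<lambda>b. b \<noteq> 8"] this[of idig] show ?thesis by (auto simp: forest_step_def)
  qed
qed (simp add: PT_const)

lemma PT_first: "PT G xs x \<Longrightarrow> PT G xs (\<lambda>e. first (x e))"
  unfolding first_def by (intro PT_takeWhile PT_forest alphabet_bounds)

lemma PT_shortest_half:
  assumes "PT G xs t"
  shows "PT G xs (\<lambda>e. shortest (half (t e)) (t e))"
proof -
  let ?F = "\<lambda>t a acc. if half t acc then acc else if a = 0 then acc else a # acc"
  let ?ys = "map (\<lambda>y z. y (fst z)) xs @ [\<lambda>z. fst (snd z), \<lambda>z. snd (snd z)]"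
  have 1: "PT G xs (\<lambda>e. foldr (?F (t e)) (t e) [])"
  proof (rule PT_foldr[OF alphabet_bounds(1) assms, where K = 1])
    have t: "PT G ?ys (\<lambda>z. t (fst z))" using PT_lift[OF assms] .
    have d: "PT G ?ys (\<lambda>z. drop (length (t (fst z))) (first (fst (snd z)) @ first (fst (snd z))))"
      by (intro PT_drop_length PT_append PT_first PT_acc t alphabet_bounds)
    have c: "PT G ?ys (\<lambda>z. if hd0 (snd (snd z)) = 0 then fst (snd z) else hd0 (snd (snd z)) # fst (snd z))"
      by (intro PT_cons_hd PT_acc PT_rest alphabet_bounds)
    have "PT G ?ys (\<lambda>z. if hd0 (fst (snd z)) = 16 then
          (if hd0 (snd (snd z)) = 0 then fst (snd z) else hd0 (snd (snd z)) # fst (snd z))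
        else if hd0 (fst (snd z)) = 17 then
          (if hd0 (snd (snd z)) = 0 then fst (snd z) else hd0 (snd (snd z)) # fst (snd z))
        else if hd0 (drop (length (t (fst z))) (first (fst (snd z)) @ first (fst (snd z)))) = 0 then
          (if hd0 (snd (snd z)) = 0 then fst (snd z) else hd0 (snd (snd z)) # fst (snd z))
        else fst (snd z))"
      by (intro PT_if[OF PT_acc c] PT_if[OF d c] PT_acc)
    moreover have "(\<lambda>z. if hd0 (fst (snd z)) = 16 then
          (if hd0 (snd (snd z)) = 0 then fst (snd z) else hd0 (snd (snd z)) # fst (snd z))
        else if hd0 (fst (snd z)) = 17 then
          (if hd0 (snd (snd z)) = 0 then fst (snd z) else hd0 (snd (snd z)) # fst (snd z))
        else if hd0 (drop (length (t (fst z))) (first (fst (snd z)) @ first (fst (snd z)))) = 0 then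
          (if hd0 (snd (snd z)) = 0 then fst (snd z) else hd0 (snd (snd z)) # fst (snd z))
        else fst (snd z)) = (\<lambda>z. ?F (t (fst z)) (hd0 (snd (snd z))) (fst (snd z)))"
      by (simp add: half_def idig_def fun_eq_iff)
    ultimately show "PT G ?ys (\<lambda>z. ?F (t (fst z)) (hd0 (snd (snd z))) (fst (snd z)))" by simp
  qed (auto simp: PT_const)
  have "foldr (?F t) w [] = shortest (half t) w" if "valid G w" for t w
    using that by (induction w) (auto simp: shortest_def)
  then show ?thesis
    by (intro PT_valid_cong[where F = "\<lambda>w e. foldr (?F w) w []", OF alphabet_bounds(1) 1 assms]) simp
qed

lemma PT_orw:
  "(\<And>x. x \<in> set zs \<Longrightarrow> PT G xs (h x)) \<Longrightarrow> PT G xs (\<lambda>e. orw (map (\<lambda>x. h x e) zs))"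
proof (induction zs)
  case Nil
  then show ?case using G by (simp add: orw_def PT_const)
next
  case (Cons z zs)
  have "PT G xs (\<lambda>e. [2, 3, 2] @ h z e @ 2 # orw (map (\<lambda>x. h x e) zs))"
    by (intro PT_append PT_cons PT_const alphabet_bounds Cons) (use G Cons in auto)
  then show ?case by (simp add: orw_def)
qed

lemma PT_andw:
  "(\<And>x. x \<in> set zs \<Longrightarrow> PT G xs (h x)) \<Longrightarrow> PT G xs (\<lambda>e. andw (map (\<lambda>x. h x e) zs))"
proof (induction zs)
  case Nil
  then show ?case using G by (simp add: andw_def PT_const)
next
  case (Cons z zs)
  have "PT G xs (\<lambda>e. 3 # h z e @ andw (map (\<lambda>x. h x e) zs))"
    by (intro PT_append PT_cons alphabet_bounds Cons) (use G Cons in auto)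
  then show ?case by (simp add: andw_def)
qed

lemma PT_litw: "PT G xs h \<Longrightarrow> PT G xs (\<lambda>e. litw b (h e))"
  using PT_cons[of G xs h 2] G by (cases b) (auto simp: litw_def)

lemma PT_unshift:
  assumes "PT G xs x"
  shows "PT G xs (\<lambda>e. unshift (x e))"
  unfolding unshift_def
proof (rule PT_sfx[OF alphabet_bounds(1) assms])
  show "PT G (map (\<lambda>y z. y (fst z)) xs @ [snd]) (\<lambda>z. if hd0 (snd z) = 16 then [6] else if hd0 (snd z) = 17 then [7] else [])"
    by (intro PT_if PT_const PT_var) (use G in auto)
qed

end

lemma set_ml_code: "set (ml_code \<phi>) \<subseteq> {1..7}"
proof (induction \<phi>)
  case (MVar p)
  then show ?case using set_binary[of p] by auto
qed auto

context rooted_list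
begin

text \<open>Plain letters, the separator and the shifted letters lie below 20; above them are
  \<open>J\<close> task markers and \<open>2 ^ J\<close> set constants.\<close>

definition letters :: nat where
  "letters = 20 + J + 2 ^ J"

lemma letters: "17 < letters" "w < J \<Longrightarrow> 20 + w < letters" "c < 2 ^ J \<Longrightarrow> 20 + J + c < letters" "0 < letters"
  by (simp_all add: letters_def)

lemma PT_eqw: "(\<And>j. j < J \<Longrightarrow> PT letters xs (f j)) \<Longrightarrow> PT letters xs (\<lambda>e. eqw c (\<lambda>j. f j e))"
  unfolding eqw_def by (intro PT_andw[OF letters(1)] PT_litw[OF letters(1)]) simp

lemma PT_unw:
  assumes "\<And>j. j < J \<Longrightarrow> PT letters xs (f j)" "\<And>c. c < 2 ^ J \<Longrightarrow> PT letters xs (g c)"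
  shows "PT letters xs (\<lambda>e. unw (\<lambda>j. f j e) (\<lambda>c. g c e))"
  unfolding unw_def
  by (intro PT_orw[OF letters(1)] PT_cons PT_append PT_eqw) (use assms letters in auto)

lemma PT_binw:
  assumes "\<And>j. j < J \<Longrightarrow> PT letters xs (f j)" "\<And>j. j < J \<Longrightarrow> PT letters xs (f' j)"
    "\<And>c d. c < 2 ^ J \<Longrightarrow> d < 2 ^ J \<Longrightarrow> PT letters xs (g c d)"
  shows "PT letters xs (\<lambda>e. binw (\<lambda>j. f j e) (\<lambda>j. f' j e) (\<lambda>c d. g c d e))"
proof -
  have "PT letters xs (\<lambda>e. 3 # eqw (fst cd) (\<lambda>j. f j e) @ 3 # eqw (snd cd) (\<lambda>j. f' j e) @ g (fst cd) (snd cd) e)"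
    if "cd \<in> set (List.product [0..<2 ^ J] [0..<2 ^ J])" for cd
    using that by (intro PT_cons PT_append PT_eqw assms) (use letters in auto)
  from PT_orw[OF letters(1), of "List.product [0..<2 ^ J] [0..<2 ^ J]", OF this]
  show ?thesis unfolding binw_def by (simp add: split_def)
qed

lemma PT_exs:
  assumes w: "w < J" and pre: "PT letters xs pre" and s: "PT letters xs s" and post: "PT letters xs post"
  shows "PT letters xs (\<lambda>e. exs w (pre e) (s e) (post e))"
proof -
  have T: "PT letters xs (\<lambda>e. (20 + w) # pre e @ (20 + J + c) # post e)" if "c < 2 ^ J" for c
    by (intro PT_cons PT_append pre post) (use letters that w in auto)
  have tls: "PT letters xs (\<lambda>e. (20 + j) # tl (s e))" if "j < J" for j
    by (intro PT_cons PT_tl s) (use letters that in auto)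
  have f1: "PT letters xs (\<lambda>e. (20 + j) # first (tl (s e)))" if "j < J" for j
    by (intro PT_cons PT_tl PT_first s) (use letters that in auto)
  have f2: "PT letters xs (\<lambda>e. (20 + j) # drop (length (first (tl (s e)))) (tl (s e)))" if "j < J" for j
    by (intro PT_cons PT_drop_length PT_tl PT_first s) (use letters that in auto)
  have v: "PT letters xs (\<lambda>e. 5 # replicate j 6 @ 7 # unshift (tl (s e)))" for j
    by (intro PT_cons PT_append PT_unshift PT_tl s PT_const) (use letters in \<open>auto simp: valid_def\<close>)
  have l: "PT letters xs (\<lambda>e. litw (w \<in> cs (hd0 (s e) - (20 + J))) [1])"
    by (rule PT_case[OF s letters(4), where f = "\<lambda>a e. litw (w \<in> cs (a - (20 + J))) [1]"])
      (use letters in \<open>intro PT_litw PT_const; simp\<close>)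
  show ?thesis unfolding exs_def
    by (intro PT_if s T tls f1 f2 v l cst PT_unw PT_binw) assumption+
qed

lemma PT_exw: "w < J \<Longrightarrow> PT letters xs t \<Longrightarrow> PT letters xs (\<lambda>e. exw w (t e))"
  unfolding exw_def Let_def
  by (intro PT_exs PT_take_diff PT_first PT_shortest_half PT_drop_length letters)

lemma PT_round:
  assumes "PT letters xs x"
  shows "PT letters xs (\<lambda>e. round (x e))"
  unfolding round_def
proof (rule PT_sfx[OF letters(4) assms])
  let ?ys = "map (\<lambda>y z. y (fst z)) xs @ [snd]"
  have v: "PT letters ?ys snd" by (rule PT_var) simp
  have "PT letters ?ys (\<lambda>z. if 20 \<le> a \<and> a < 20 + J then exw (a - 20) (takeWhile internal (tl (snd z)))
     else if internal a \<or> a = 0 then [] else [a])" if "a < letters" for a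
  proof (cases "20 \<le> a \<and> a < 20 + J")
    case True
    then have "a - 20 < J" by auto
    then have "PT letters ?ys (\<lambda>z. exw (a - 20) (takeWhile internal (tl (snd z))))"
      by (intro PT_exw PT_takeWhile PT_tl v letters)
    then show ?thesis using True by simp
  qed (use that in \<open>auto simp: PT_const\<close>)
  then show "PT letters ?ys (\<lambda>z. emit (snd z))" unfolding emit_def
    by (intro PT_case[OF v letters(4), where f = "\<lambda>a z. if 20 \<le> a \<and> a < 20 + J then exw (a - 20) (takeWhile internal (tl (snd z)))
     else if internal a \<or> a = 0 then [] else [a]"])
qed

lemma PT_word0: "PT letters [ml_code] (\<lambda>\<phi>. word0 (ml_code \<phi>))"
proof -
  \<comment> \<open>Codes of formulas use letters up to 7 only; the bound keeps the shifted letters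
    inside the alphabet in every branch of the case distinction.\<close>
  let ?g = "\<lambda>v. if hd0 v < 8 then [hd0 v + 10] else []"
  have code: "PT letters [ml_code] ml_code" by (rule PT_var) simp
  have "PT letters [ml_code] (\<lambda>\<phi>. sfx ?g (ml_code \<phi>))"
  proof (rule PT_sfx[OF letters(4) code])
    show "PT letters (map (\<lambda>y z. y (fst z)) [ml_code] @ [snd]) (\<lambda>z. ?g (snd z))"
      by (rule PT_case[OF _ letters(4), where f = "\<lambda>a z. if a < 8 then [a + 10] else []"])
        (use letters in \<open>auto intro: PT_var PT_const\<close>)
  qed
  moreover have "set w \<subseteq> {1..7} \<Longrightarrow> sfx ?g w = map (\<lambda>a. a + 10) w" for w
    by (induction w) auto
  ultimately have sh: "PT letters [ml_code] (\<lambda>\<phi>. map (\<lambda>a. a + 10) (ml_code \<phi>))"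
    using set_ml_code by simp
  have b: "valid letters (5 # binary n)" for n
    using set_binary[of n] letters by (auto simp: valid_def)
  have "PT letters [ml_code] (\<lambda>\<phi>. 3 # (5 # binary (vv (J + i) 0)) @ (20 + rs ! i) # map (\<lambda>a. a + 10) (ml_code \<phi>))"
    if "i < length rs" for i
    by (intro PT_cons PT_append PT_const[OF b] sh) (use letters rs_less[OF that] in auto)
  then show ?thesis unfolding word0_def by (intro PT_orw letters) auto
qed

lemma polyb_mix0: "polyb (\<lambda>\<phi>. length (ml_code \<phi>)) (\<lambda>\<phi>. pot (mix0 \<phi>))"
proof -
  define c where "c = (\<Sum>i<length rs. length (binary (vv (J + i) 0)))"
  let ?T = "\<lambda>\<phi>. pot_coeff * length (ml_code \<phi>) ^ pot_deg + pot_base"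
  have "pot (mix0 \<phi>) \<le> length rs * (2 + c + ?T \<phi> + 4) + 2" for \<phi>
  proof -
    have "tpot (map_ml Inl \<phi>) \<le> ?T \<phi>"
      by (auto simp: tpot_def not_const_map xcode_map intro!: mult_left_mono power_mono)
    moreover have "length (binary (vv (J + i) 0)) \<le> c" if "i < length rs" for i
      unfolding c_def using that by (intro member_le_sum) auto
    ultimately have "pot (PAnd (PVar (Inl (vv (J + i) 0))) (PVar (Inr (rs ! i, map_ml Inl \<phi>)))) \<le> 2 + c + ?T \<phi>"
      if "i < length rs" for i
      using that by fastforce
    then show ?thesis unfolding mix0_def
      using pot_orM[of "map (\<lambda>i. PAnd (PVar (Inl (vv (J + i) 0))) (PVar (Inr (rs ! i, map_ml Inl \<phi>)))) [0..<length rs]" "2 + c + ?T \<phi>"]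
      by fastforce
  qed
  moreover have "polyb (\<lambda>\<phi>. length (ml_code \<phi>)) (\<lambda>\<phi>. length rs * (2 + c + ?T \<phi> + 4) + 2)"
    by (intro polyb_intros)
  ultimately show ?thesis by (rule polyb_mono[rotated])
qed

lemma polytime_tr: "polytime ml_code pl_code tr"
proof (rule polytimeI[of letters])
  let ?A = "\<lambda>\<phi> j. (round ^^ j) (word0 (ml_code \<phi>))"
  \<comment> \<open>A clock: only its length, the number of rounds, matters.\<close>
  let ?x = "\<lambda>\<phi>. 1 # ml_code \<phi>"
  let ?ys = "map (\<lambda>y z. y (fst z)) [ml_code] :: (nat ml \<times> word \<times> word \<Rightarrow> word) list"
  have code: "PT letters [ml_code] ml_code" by (rule PT_var) simp
  have "PT letters [ml_code] (\<lambda>\<phi>. ?A \<phi> (length (?x \<phi>)))"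
  proof (rule PT_fold)
    show "PT letters [ml_code] ?x" by (intro PT_cons code) (use letters in auto)
    show "PT letters [ml_code] (\<lambda>\<phi>. ?A \<phi> 0)" using PT_word0 by simp
    show "PT letters (?ys @ [\<lambda>z. fst (snd z), \<lambda>z. snd (snd z)]) (\<lambda>z. round (fst (snd z)))"
      by (intro PT_round PT_acc)
    show "\<exists>z. (\<forall>k<length [ml_code]. (?ys ! k) z = ([ml_code] ! k) \<phi>) \<and> fst (snd z) = ?A \<phi> j \<and>
        snd (snd z) = drop j (?x \<phi>) \<and> round (fst (snd z)) = ?A \<phi> (Suc j)" for \<phi> j
      by (intro exI[of _ "(\<phi>, ?A \<phi> j, drop j (?x \<phi>))"]) simp
    show "polyb (\<lambda>\<phi>. sz [ml_code] \<phi> + length (?x \<phi>) + length (?A \<phi> 0)) (\<lambda>\<phi>. pot (mix0 \<phi>))"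
      by (rule polyb_leI[OF polyb_mix0]) simp
    \<comment> \<open>The potential of the initial formula bounds the word after every round, as the
      fold requires.\<close>
    show "length (?A \<phi> j) \<le> pot (mix0 \<phi>)" if "j \<le> length (?x \<phi>)" for \<phi> j
      using rounds[of j \<phi>] that length_mcode by (metis (no_types, lifting) Suc_eq_plus1 length_Cons order_trans)
  qed simp
  then show "PT letters [ml_code] (\<lambda>\<phi>. pl_code (tr \<phi>))" by (simp add: tr(1))
  show "valid letters (ml_code \<phi>)" for \<phi>
    using set_ml_code[of \<phi>] letters(1) by (fastforce simp: valid_def)
qed (rule letters)

section \<open>Interpolants and strongest implicates\<close>

lemma finite_hat: "finite \<sigma> \<Longrightarrow> finite (hat \<sigma>)"
  by (simp add: hat_def)

lemma hat_mono: "\<sigma> \<subseteq> \<tau> \<Longrightarrow> hat \<sigma> \<subseteq> hat \<tau>"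
  by (auto simp: hat_def)

lemma sig_rt_hat: "pl_sig \<chi> \<subseteq> hat \<sigma> \<Longrightarrow> ml_sig (rt \<chi>) \<subseteq> \<sigma>"
  using sig_rt[of \<chi>] by (fastforce simp: hat_def)

text \<open>The assignment selects root \<open>i\<close> alone, so one disjunct of the translation
  remains, and the pulled back valuation is an isomorphic copy of \<open>V\<close>.\<close>

lemma tr_asg:
  assumes i: "i < length rs" and g: "g \<in> auts (rs ! i)"
  shows "pl_sat (asg i (pull (rs ! i) g V)) (tr \<phi>) \<longleftrightarrow> ml_sat R V (rs ! i) \<phi>"
proof -
  have r: "rs ! i \<in> set rs" using i by simp
  have "val (asg i (pull (rs ! i) g V)) = pull (rs ! i) g V"
    using W_sub[OF r] by (auto simp: val_def asg_def dec_vv pull_def fun_eq_iff)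
  moreover have "asg i U (vv (J + i') 0) \<longleftrightarrow> i' = i" if "i' < length rs" for U i'
    using that by (simp add: asg_def dec_vv)
  ultimately have "pl_sat (asg i (pull (rs ! i) g V)) (tr \<phi>) \<longleftrightarrow> ml_sat R (pull (rs ! i) g V) (rs ! i) \<phi>"
    using i unfolding tr(3) by auto
  also have "\<dots> \<longleftrightarrow> ml_sat R V (rs ! i) \<phi>"
    by (rule auts_sat[OF g]) (simp add: pull_def)
  finally show ?thesis .
qed

lemma L_MImp: "MImp \<phi> \<psi> \<in> L \<longleftrightarrow> (\<forall>i < length rs. \<forall>V. ml_sat R V (rs ! i) \<phi> \<longrightarrow> ml_sat R V (rs ! i) \<psi>)"
  unfolding L by (auto simp: MImp_def all_set_conv_all_nth)

lemma tautology_PImp: "tautology (PImp \<alpha> \<beta>) \<longleftrightarrow> (\<forall>v. pl_sat v \<alpha> \<longrightarrow> pl_sat v \<beta>)"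
  by (auto simp: tautology_def PImp_def)

text \<open>The translation is a disjunction over the roots, and an implication in \<open>L\<close>
  holds disjunct by disjunct, also under assignments that select several roots or none.\<close>

lemma tautology_tr: "MImp \<phi> \<psi> \<in> L \<Longrightarrow> tautology (PImp (tr \<phi>) (tr \<psi>))"
  unfolding L_MImp tautology_PImp tr(3) by blast

text \<open>If \<phi> is true at a root, then its translation, and hence \<chi>, is true for every
  automorphic copy, so \<open>rt_complete\<close> applies. For \<open>rt_lower\<close> the single
  copy provided by \<open>rt_sound\<close> is enough.\<close>

lemma rt_upper: "tautology (PImp (tr \<phi>) \<chi>) \<Longrightarrow> MImp \<phi> (rt \<chi>) \<in> L"
  unfolding L_MImp tautology_PImp using rt_complete tr_asg by blast

lemma rt_lower: "tautology (PImp \<chi> (tr \<psi>)) \<Longrightarrow> MImp (rt \<chi>) \<psi> \<in> L"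
  unfolding L_MImp tautology_PImp using rt_sound tr_asg by blast

text \<open>The signature condition is checked against \<phi> and \<psi> separately, by
  \<open>sig_rt_hat\<close>, which avoids comparing \<open>hat\<close> of an intersection with an
  intersection of hats.\<close>

lemma craig_rt:
  assumes "pl_craig_interpolant (tr \<phi>) (tr \<psi>) \<chi>"
  shows "ml_craig_interpolant L \<phi> \<psi> (rt \<chi>)"
proof -
  have "pl_sig \<chi> \<subseteq> hat (ml_sig \<phi>)" "pl_sig \<chi> \<subseteq> hat (ml_sig \<psi>)"
    using assms tr(2)[of \<phi>] tr(2)[of \<psi>] by (auto simp: pl_craig_interpolant_def)
  then show ?thesis using assms rt_upper rt_lower sig_rt_hat
    unfolding ml_craig_interpolant_def pl_craig_interpolant_def by blast
qed

text \<open>An implicate \<psi> over \<tau> translates into a propositional consequence with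
  variables in \<open>hat \<tau>\<close>, which the uniform interpolant must imply;
  \<open>rt_lower\<close> brings this back to \<open>L\<close>.\<close>

lemma strongest_rt:
  assumes "pl_uniform_interpolant (hat \<tau>) (tr \<phi>) \<chi>"
  shows "strongest_implicate L \<tau> \<phi> (rt \<chi>)"
  unfolding strongest_implicate_def
proof (intro conjI allI impI)
  show "ml_sig (rt \<chi>) \<subseteq> \<tau>" "MImp \<phi> (rt \<chi>) \<in> L"
    using assms sig_rt_hat rt_upper by (auto simp: pl_uniform_interpolant_def)
  fix \<psi> assume \<psi>: "ml_sig \<psi> \<subseteq> \<tau> \<and> MImp \<phi> \<psi> \<in> L"
  then have "pl_sig (tr \<psi>) \<subseteq> hat \<tau>" using tr(2)[of \<psi>] hat_mono by blast
  then have "tautology (PImp \<chi> (tr \<psi>))"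
    using assms \<psi> tautology_tr unfolding pl_uniform_interpolant_def by blast
  then show "MImp (rt \<chi>) \<psi> \<in> L" by (rule rt_lower)
qed

end

theorem theorem2:
  fixes L :: "nat ml set"
  assumes "quasi_normal L"
    and "tabular L"
    and "craig_interpolation_property L"
  shows "\<exists>(hat :: nat set \<Rightarrow> nat set) (tr :: nat ml \<Rightarrow> nat pl) (rt :: nat pl \<Rightarrow> nat ml).
    (\<forall>\<sigma>. finite \<sigma> \<longrightarrow> finite (hat \<sigma>)) \<and>
    (\<forall>\<sigma> \<phi>. finite \<sigma> \<and> ml_sig \<phi> \<subseteq> \<sigma> \<longrightarrow> pl_sig (tr \<phi>) \<subseteq> hat \<sigma>) \<and>
    (\<forall>\<sigma> \<chi>. finite \<sigma> \<and> pl_sig \<chi> \<subseteq> hat \<sigma> \<longrightarrow> ml_sig (rt \<chi>) \<subseteq> \<sigma>) \<and>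
    polytime ml_code pl_code tr \<and>
    polytime pl_code ml_code rt \<and>
    (\<forall>\<phi> \<psi>. MImp \<phi> \<psi> \<in> L \<longrightarrow>
       tautology (PImp (tr \<phi>) (tr \<psi>)) \<and>
       (\<forall>\<chi>. pl_craig_interpolant (tr \<phi>) (tr \<psi>) \<chi> \<longrightarrow> ml_craig_interpolant L \<phi> \<psi> (rt \<chi>))) \<and>
    (\<forall>\<phi> \<tau> \<chi>. finite \<tau> \<and> pl_uniform_interpolant (hat \<tau>) (tr \<phi>) \<chi> \<longrightarrow>
       strongest_implicate L \<tau> \<phi> (rt \<chi>))"
proof -
  obtain J R rts where rooted: "rooted J R rts L" using tabular_rooted[OF assms(2,3)] by blast
  have "finite rts" using rooted.rts[OF rooted] finite_subset by blast
  then obtain rs where rs: "set rs = rts" "distinct rs" using finite_distinct_list by blast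
  interpret rooted_list J R rs L
    using rooted rs by (simp add: rooted_list_def rooted_list_axioms_def)
  show ?thesis
  proof (intro exI[of _ hat] exI[of _ tr] exI[of _ rt] conjI allI impI)
    show "pl_sig (tr \<phi>) \<subseteq> hat \<sigma>" if "finite \<sigma> \<and> ml_sig \<phi> \<subseteq> \<sigma>" for \<sigma> \<phi>
      using tr(2)[of \<phi>] hat_mono that by blast
  qed (use finite_hat sig_rt_hat polytime_tr polytime_rt tautology_tr craig_rt strongest_rt in auto)
qed

end
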